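(* Let $c=10^{-4}$. There are infinitely many finite Abelian groups $G$ of type I such that \[ 2^{(\frac{1}{2}+c)\mu(G)}\leq f_{\max}(G) \leq 3^{(\frac{1}{3}-c)\mu(G)}. \]
   Context: A finite Abelian group is of type I if its order is divisible by some prime $p\equiv 2 \pmod 3$. A set $S\subseteq G$ is sum-free if there are no $x,y,z\in S$ (not necessarily distinct) with $x+y=z$. $\mu(G)$ is the maximum size of a sum-free subset of $G$, and $f_{\max}(G)$ is the number of maximal (with respect to inclusion) sum-free subsets of $G$. *)

theory Defs
  imports Complex_Main "HOL-Algebra.Coset" "HOL-Number_Theory.Cong"
begin

text \<open>
  Groups are written multiplicatively, following HOL-Algebra, so the sum \<open>x + y\<close> of the
  additive convention for Abelian groups is \<open>x \<otimes>\<^bsub>G\<^esub> y\<close>.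
\<close>

text \<open>
  The notions below are meant for finite Abelian groups; finiteness and commutativity
  are required separately where they are used. (In particular the order of an infinite group
  is \<open>0\<close> here, so \<open>type_I\<close> alone does not exclude infinite groups.)
\<close>

definition type_I :: "('a, 'b) monoid_scheme \<Rightarrow> bool" where
  "type_I G \<longleftrightarrow> (\<exists>p::nat. prime p \<and> [p = 2] (mod 3) \<and> p dvd order G)"

definition sum_free :: "('a, 'b) monoid_scheme \<Rightarrow> 'a set \<Rightarrow> bool" where
  "sum_free G S \<longleftrightarrow>
     S \<subseteq> carrier G \<and> \<not> (\<exists>x\<in>S. \<exists>y\<in>S. \<exists>z\<in>S. x \<otimes>\<^bsub>G\<^esub> y = z)"

definition max_sum_free_size :: "('a, 'b) monoid_scheme \<Rightarrow> nat"  ("\<mu>") where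
  "\<mu> G = Max {card S | S. sum_free G S}"

definition maximal_sum_free :: "('a, 'b) monoid_scheme \<Rightarrow> 'a set \<Rightarrow> bool" where
  "maximal_sum_free G S \<longleftrightarrow> sum_free G S \<and> (\<forall>T. sum_free G T \<and> S \<subseteq> T \<longrightarrow> T = S)"

definition f_max :: "('a, 'b) monoid_scheme \<Rightarrow> nat" where
  "f_max G = card {S. maximal_sum_free G S}"

end

theory Submission
  imports Defs "HOL-Library.FuncSet" "HOL-Library.Product_Plus" "HOL-Library.Function_Algebras"
    "HOL-Library.Numeral_Type" "HOL-Computational_Algebra.Primes"
begin

text \<open>
  The groups are \<open>G = V \<times> Z\<close> with \<open>V = (\<int>/3)\<^sup>m\<close> and \<open>Z = \<int>/23\<close>, and \<open>n = 3\<^sup>m\<close>. The largest sum-free sets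
  are \<open>V \<times> I\<close> for the dilates \<open>I\<close> of \<open>{8..15}\<close>, so \<open>\<mu>(G) = 8n\<close>. A coset of an index three subgroup is
  a slightly smaller sum-free set, of size \<open>23n/3\<close>, but adding an element of order three
  turns it into a disjoint union of triangles, which yields \<open>3\<^bsup>23n/9\<^esup>\<close> maximal sum-free sets. Since
  \<open>3\<^bsup>23/9\<^esup> > 2\<^sup>4\<close> with a little room, this is the lower bound; 23 is the least prime congruent to
  2 modulo 3 for which this works.

  For the upper bound, energy increment over the characters of \<open>V\<close> puts a sum-free set, up
  to \<open>\<epsilon>n\<close> elements \<open>B\<close>, into a sum-free set \<open>A\<close> from a family of polynomial size. A maximal
  sum-free set meets \<open>A\<close> in a maximal independent set of a link graph determined by \<open>B\<close>, so
  the Moon--Moser bound \<open>3\<^bsup>|A|/3\<^esup>\<close> suffices unless \<open>A\<close> has nearly maximal size. By a weak form of Vosper's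
  theorem \<open>A\<close> is then contained in some \<open>V \<times> I\<close>. Every element of \<open>B\<close> outside \<open>V \<times> I\<close> is a
  sum of two elements of \<open>V \<times> I\<close> in at least \<open>n\<close> ways, and the corresponding edges lie in few
  triangle components of the link graph, which improves the Moon--Moser bound.
\<close>

section \<open>Stability of the Moon--Moser bound\<close>

text \<open>The saving over the Moon--Moser bound must be exponential in n uniformly in
  \<open>B\<close>, whether \<open>B\<close> has one element or \<epsilon>n of them. The stability
  bound saves a factor \<open>q\<close> per unit of defect, where \<open>q\<close> is about
  exp(const / D) for a degree bound D. In the link graph of \<open>B\<close> both the degrees and
  the guaranteed defect grow linearly in |B|: the degrees are at most 3|B|, the defect is at least
  about 9/10 n|B|. So |B| cancels, and the saving is (28/25)^(9n/960) up to a constant factor,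
  roughly exp(n/1000). It has to pay for lowering the exponent of 3 from 8n/3 to (1/3 - c) * 8n, for
  the choice of \<open>B\<close>, which is cheap because \<epsilon> is 10^(-6), and for polynomially
  many containers. The value c = 10^(-4) nearly exhausts it. Exponent three enters the upper bound
  twice: L characters cut V into at most 3^L cells, and v + v = -v makes the equations between large
  fibres close up after two doublings.\<close>

definition nbrs :: "('v \<Rightarrow> 'v \<Rightarrow> bool) \<Rightarrow> 'v set \<Rightarrow> 'v \<Rightarrow> 'v set" where
  "nbrs R W u = {v \<in> W. v \<noteq> u \<and> R u v}"

text \<open>The relation \<open>R\<close> may have loops; a vertex with a loop never belongs to an independent set and
  need not be dominated.\<close>

definition mis :: "('v \<Rightarrow> 'v \<Rightarrow> bool) \<Rightarrow> 'v set \<Rightarrow> 'v set set" where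
  "mis R W = {S. S \<subseteq> W \<and> (\<forall>x\<in>S. \<forall>y\<in>S. \<not> R x y) \<and> (\<forall>x\<in>W - S. R x x \<or> (\<exists>y\<in>S. R x y))}"

definition in_triangle :: "('v \<Rightarrow> 'v \<Rightarrow> bool) \<Rightarrow> 'v set \<Rightarrow> 'v \<Rightarrow> bool" where
  "in_triangle R W u \<longleftrightarrow> u \<in> W \<and>
     (\<exists>v w. v \<noteq> w \<and> nbrs R W u = {v, w} \<and> nbrs R W v = {u, w} \<and> nbrs R W w = {u, v})"

text \<open>For symmetric \<open>R\<close> this is twice the number of edges outside triangle
  components. Isolated vertices add nothing, although they too fall short of the Moon--Moser bound;
  the application only supplies edges.\<close>

definition defect :: "('v \<Rightarrow> 'v \<Rightarrow> bool) \<Rightarrow> 'v set \<Rightarrow> nat" where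
  "defect R W = (\<Sum>u \<in> {u\<in>W. \<not> in_triangle R W u}. card (nbrs R W u))"

lemma finite_nbrs [simp]: "finite W \<Longrightarrow> finite (nbrs R W u)"
  by (simp add: nbrs_def)

lemma nbrs_subset: "nbrs R W u \<subseteq> W - {u}"
  by (auto simp: nbrs_def)

lemma finite_mis [simp]: "finite W \<Longrightarrow> finite (mis R W)"
  by (rule finite_subset[of _ "Pow W"]) (auto simp: mis_def)

text \<open>Deleting \<open>y\<close> destroys no domination that is still required: a remaining
  vertex is unrelated to \<open>y\<close>, so whatever dominates it is another member of
  \<open>S\<close>.\<close>

lemma card_mis_branch:
  assumes "finite W" "symp R" "y \<notin> Y"
  shows "card {S \<in> mis R W. y \<in> S \<and> S \<inter> Y = {}} \<le> card (mis R (W - (insert y (nbrs R W y) \<union> Y)))"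
proof (rule card_inj_on_le[where f = "\<lambda>S. S - {y}"])
  show "inj_on (\<lambda>S. S - {y}) {S \<in> mis R W. y \<in> S \<and> S \<inter> Y = {}}"
    unfolding inj_on_def by blast
  show "(\<lambda>S. S - {y}) ` {S \<in> mis R W. y \<in> S \<and> S \<inter> Y = {}}
      \<subseteq> mis R (W - (insert y (nbrs R W y) \<union> Y))"
  proof clarify
    fix S assume S: "S \<in> mis R W" "y \<in> S" "S \<inter> Y = {}"
    then have "S - {y} \<subseteq> W - (insert y (nbrs R W y) \<union> Y)"
      by (auto simp: mis_def nbrs_def)
    moreover have "\<exists>z\<in>S - {y}. R x z"
      if x: "x \<in> W - (insert y (nbrs R W y) \<union> Y) - (S - {y})" "\<not> R x x" for x
    proof -
      have "\<not> R x y" using x sympD[OF assms(2), of x y] by (auto simp: nbrs_def)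
      moreover obtain z where "z \<in> S" "R x z" using S x by (auto simp: mis_def)
      ultimately show ?thesis by blast
    qed
    ultimately show "S - {y} \<in> mis R (W - (insert y (nbrs R W y) \<union> Y))"
      using S unfolding mis_def by blast
  qed
qed (use assms in auto)


lemma card_mis_avoid:
  assumes "finite W"
  shows "card {S \<in> mis R W. S \<inter> Y = {}} \<le> card (mis R (W - Y))"
  by (rule card_mono) (use assms in \<open>auto simp: mis_def\<close>)

lemma sum_card_nbrs_swap:
  assumes "finite W" "symp R" "A \<subseteq> W" "B \<subseteq> W"
  shows "(\<Sum>u\<in>A. card (nbrs R B u)) = (\<Sum>v\<in>B. card (nbrs R A v))"
proof -
  have fin: "finite A" "finite B" using assms finite_subset by auto
  have "(\<Sum>u\<in>A. card (nbrs R B u)) = card (Sigma A (nbrs R B))"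
    using fin by (simp add: card_SigmaI)
  also have "\<dots> = card ((\<lambda>(x, y). (y, x)) ` Sigma A (nbrs R B))"
    by (intro card_image[symmetric]) (auto simp: inj_on_def)
  also have "(\<lambda>(x, y). (y, x)) ` Sigma A (nbrs R B) = Sigma B (nbrs R A)"
    using sympD[OF assms(2)] by (auto simp: nbrs_def image_iff)
  also have "card \<dots> = (\<Sum>v\<in>B. card (nbrs R A v))"
    using fin by (simp add: card_SigmaI)
  finally show ?thesis .
qed

lemma in_triangleD:
  assumes "in_triangle R W u" "v \<in> nbrs R W u"
  shows "in_triangle R W v"
proof -
  obtain x y where xy: "x \<noteq> y" "nbrs R W u = {x, y}" "nbrs R W x = {u, y}" "nbrs R W y = {u, x}"
    using assms(1) by (auto simp: in_triangle_def)
  have "u \<in> W" "v \<in> W" "u \<noteq> x" "u \<noteq> y"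
    using assms xy nbrs_subset[of R W u] by (auto simp: in_triangle_def)
  have "v = x \<or> v = y" using assms(2) xy by auto
  then show ?thesis
  proof
    assume "v = x"
    then show ?thesis using xy \<open>v \<in> W\<close> \<open>u \<noteq> y\<close> unfolding in_triangle_def
      by (intro conjI exI[of _ u] exI[of _ y]) (simp_all add: insert_commute)
  next
    assume "v = y"
    then show ?thesis using xy \<open>v \<in> W\<close> \<open>u \<noteq> x\<close> unfolding in_triangle_def
      by (intro conjI exI[of _ u] exI[of _ x]) (simp_all add: insert_commute)
  qed
qed

lemma card_nbrs_triangle: "in_triangle R W u \<Longrightarrow> card (nbrs R W u) = 2"
  by (auto simp: in_triangle_def)

text \<open>With s the degree sum over \<open>Y\<close>, the factor 8 is 1 + 1 + 6: the vertices of
  \<open>Y\<close> account for s, edges from the rest into \<open>Y\<close> for s, and vertices that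
  fall into a triangle component only after the removal for 6s. Each such new triangle has a corner
  adjacent to \<open>Y\<close>, so there are at most 3s of these vertices, of degree 2 each.\<close>

lemma defect_remove:
  assumes W: "finite W" and R: "symp R" and Y: "Y \<subseteq> W"
  shows "defect R W \<le> defect R (W - Y) + 8 * (\<Sum>y\<in>Y. card (nbrs R W y))"
proof -
  let ?W = "W - Y"
  let ?s = "\<Sum>y\<in>Y. card (nbrs R W y)"
  define N where "N = {u\<in>?W. \<not> in_triangle R W u}"
  define Z where "Z = {z\<in>?W. nbrs R Y z \<noteq> {}}"
  define C where "C = {u\<in>N. in_triangle R ?W u}"
  have fin: "finite N" "finite Z" "finite C" "finite Y" using W Y finite_subset by (auto simp: N_def Z_def C_def)
  have split: "nbrs R W u = nbrs R ?W u \<union> nbrs R Y u" "nbrs R ?W u \<inter> nbrs R Y u = {}" for u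
    using Y by (auto simp: nbrs_def)
  have out: "(\<Sum>u\<in>?W. card (nbrs R Y u)) \<le> ?s"
  proof -
    have "(\<Sum>u\<in>?W. card (nbrs R Y u)) = (\<Sum>y\<in>Y. card (nbrs R ?W y))"
      using sum_card_nbrs_swap[OF W R, of ?W Y] Y by auto
    also have "\<dots> \<le> ?s" by (intro sum_mono card_mono) (use W in \<open>auto simp: nbrs_def\<close>)
    finally show ?thesis .
  qed
  have "card Z \<le> (\<Sum>u\<in>Z. card (nbrs R Y u))"
  proof -
    have "(\<Sum>u\<in>Z. 1) \<le> (\<Sum>u\<in>Z. card (nbrs R Y u))"
      using fin by (intro sum_mono) (auto simp: Z_def Suc_le_eq card_gt_0_iff)
    then show ?thesis by simp
  qed
  also have "\<dots> \<le> (\<Sum>u\<in>?W. card (nbrs R Y u))" by (intro sum_mono2) (use W in \<open>auto simp: Z_def\<close>)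
  finally have Z: "card Z \<le> ?s" using out by linarith
  let ?Z = "{z\<in>Z. in_triangle R ?W z}"
  have "C \<subseteq> (\<Union>z\<in>?Z. insert z (nbrs R ?W z))"
  proof
    fix u assume "u \<in> C"
    then have u: "u \<in> ?W" "\<not> in_triangle R W u" "in_triangle R ?W u" by (auto simp: C_def N_def)
    then obtain v w where vw: "v \<noteq> w" "nbrs R ?W u = {v, w}" "nbrs R ?W v = {u, w}" "nbrs R ?W w = {u, v}"
      by (auto simp: in_triangle_def)
    have "\<exists>z\<in>{u,v,w}. nbrs R Y z \<noteq> {}"
    proof (rule ccontr)
      assume "\<not> ?thesis"
      then have "nbrs R Y z = {}" if "z \<in> {u,v,w}" for z using that by blast
      then have nb: "nbrs R W z = nbrs R ?W z" if "z \<in> {u,v,w}" for z using split(1)[of z] that by simp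
      then have "in_triangle R W u" using vw u nb[of u] nb[of v] nb[of w]
        unfolding in_triangle_def by (intro conjI exI[of _ v] exI[of _ w]) simp_all
      then show False using u by blast
    qed
    then obtain z where z: "z \<in> {u,v,w}" "nbrs R Y z \<noteq> {}" by blast
    have vwW: "v \<in> ?W" "w \<in> ?W" using vw nbrs_subset[of R ?W u] by auto
    have "in_triangle R ?W z" using z u vw in_triangleD[OF u(3)] by auto
    then have "z \<in> ?Z" using z u vwW by (auto simp: Z_def)
    moreover have "u \<in> insert z (nbrs R ?W z)" using z vw by auto
    ultimately show "u \<in> (\<Union>z\<in>?Z. insert z (nbrs R ?W z))" by blast
  qed
  then have "card C \<le> card (\<Union>z\<in>?Z. insert z (nbrs R ?W z))"
    using fin W by (intro card_mono) auto
  also have "\<dots> \<le> (\<Sum>z\<in>?Z. card (insert z (nbrs R ?W z)))" using fin by (intro card_UN_le) auto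
  also have "\<dots> \<le> (\<Sum>z\<in>?Z. 3)"
    using W by (intro sum_mono) (auto simp: card_insert_if card_nbrs_triangle)
  also have "\<dots> \<le> 3 * card Z" using fin by (auto intro: card_mono)
  finally have C: "card C \<le> 3 * ?s" using Z by linarith
  have "(\<Sum>u\<in>N. card (nbrs R ?W u)) = (\<Sum>u\<in>N - C. card (nbrs R ?W u)) + (\<Sum>u\<in>C. card (nbrs R ?W u))"
    using fin by (intro sum.subset_diff) (auto simp: C_def)
  also have "(\<Sum>u\<in>C. card (nbrs R ?W u)) = 2 * card C"
    by (simp add: C_def card_nbrs_triangle)
  also have "(\<Sum>u\<in>N - C. card (nbrs R ?W u)) \<le> defect R ?W"
    unfolding defect_def using W by (intro sum_mono2) (auto simp: N_def C_def)
  finally have N: "(\<Sum>u\<in>N. card (nbrs R ?W u)) \<le> defect R ?W + 6 * ?s" using C by linarith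
  have "(\<Sum>u\<in>N. card (nbrs R Y u)) \<le> (\<Sum>u\<in>?W. card (nbrs R Y u))"
    by (intro sum_mono2) (use W in \<open>auto simp: N_def\<close>)
  then have N2: "(\<Sum>u\<in>N. card (nbrs R Y u)) \<le> ?s" using out by linarith
  have "defect R W \<le> (\<Sum>u\<in>Y \<union> N. card (nbrs R W u))"
    unfolding defect_def using fin by (intro sum_mono2) (auto simp: N_def)
  also have "\<dots> = ?s + (\<Sum>u\<in>N. card (nbrs R W u))"
    using fin by (intro sum.union_disjoint) (auto simp: N_def)
  also have "(\<Sum>u\<in>N. card (nbrs R W u)) = (\<Sum>u\<in>N. card (nbrs R ?W u) + card (nbrs R Y u))"
    by (intro sum.cong refl, subst split(1), intro card_Un_disjoint) (use W fin split in auto)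
  finally show ?thesis using N N2 by (simp add: sum.distrib)
qed

text \<open>No edge leaves \<open>T\<close>, so all other neighbourhoods are unchanged: triangle
  components can be branched away without any loss of defect.\<close>

lemma defect_remove_triangle:
  assumes W: "finite W" and R: "symp R"
    and T: "\<And>x. x \<in> T \<Longrightarrow> in_triangle R W x" "\<And>x. x \<in> T \<Longrightarrow> nbrs R W x \<subseteq> T"
  shows "defect R W \<le> defect R (W - T)"
proof -
  have nb: "nbrs R (W - T) u = nbrs R W u" if "u \<in> W - T" for u
    using T(2) sympD[OF R, of u] that by (fastforce simp: nbrs_def)
  have "\<not> in_triangle R (W - T) u" if "u \<in> W - T" "\<not> in_triangle R W u" for u
  proof
    assume "in_triangle R (W - T) u"
    then obtain v w where vw: "v \<noteq> w" "nbrs R (W - T) u = {v, w}"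
        "nbrs R (W - T) v = {u, w}" "nbrs R (W - T) w = {u, v}"
      by (auto simp: in_triangle_def)
    moreover have "v \<in> W - T" "w \<in> W - T" using vw nbrs_subset[of R "W - T" u] by auto
    ultimately have "in_triangle R W u" using that nb by (auto simp: in_triangle_def)
    then show False using that by blast
  qed
  then have "{u\<in>W. \<not> in_triangle R W u} \<subseteq> {u \<in> W - T. \<not> in_triangle R (W - T) u}"
    using T(1) by blast
  moreover have "(\<Sum>u\<in>{u\<in>W. \<not> in_triangle R W u}. card (nbrs R W u))
      = (\<Sum>u\<in>{u\<in>W. \<not> in_triangle R W u}. card (nbrs R (W - T) u))"
    by (intro sum.cong refl, subst nb) (use T(1) in auto)
  ultimately show ?thesis
    unfolding defect_def using W by (auto intro: sum_mono2)
qed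


text \<open>Every maximal independent set is charged to one branch. The sets \<open>Y i\<close>
  allow an order among the branches: a later one may also discard vertices whose presence is treated
  by an earlier one.\<close>

lemma card_mis_cover:
  assumes "finite W" "symp R" "finite I"
    and "\<And>S. S \<in> mis R W \<Longrightarrow> \<exists>i\<in>I. y i \<in> S \<and> S \<inter> Y i = {}" "\<And>i. i \<in> I \<Longrightarrow> y i \<notin> Y i"
  shows "card (mis R W) \<le> (\<Sum>i\<in>I. card (mis R (W - (insert (y i) (nbrs R W (y i)) \<union> Y i))))"
proof -
  have "mis R W \<subseteq> (\<Union>i\<in>I. {S \<in> mis R W. y i \<in> S \<and> S \<inter> Y i = {}})"
    using assms(4) by auto
  then have "card (mis R W) \<le> card (\<Union>i\<in>I. {S \<in> mis R W. y i \<in> S \<and> S \<inter> Y i = {}})"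
    using assms by (intro card_mono) auto
  also have "\<dots> \<le> (\<Sum>i\<in>I. card {S \<in> mis R W. y i \<in> S \<and> S \<inter> Y i = {}})"
    using assms by (intro card_UN_le) auto
  also have "\<dots> \<le> (\<Sum>i\<in>I. card (mis R (W - (insert (y i) (nbrs R W (y i)) \<union> Y i))))"
    using assms by (intro sum_mono card_mis_branch) auto
  finally show ?thesis .
qed

lemma mis_meets_closed_nbrs:
  assumes "S \<in> mis R W" "v \<in> W" "\<not> R v v"
  shows "v \<in> S \<or> (\<exists>z \<in> nbrs R W v. z \<in> S)"
proof (cases "v \<in> S")
  case False
  then obtain z where "z \<in> S" "R v z" using assms by (auto simp: mis_def)
  then show ?thesis using assms by (auto simp: mis_def nbrs_def)
qed simp

lemma cube_root_three_bounds:
  fixes t :: real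
  assumes "t ^ 3 = 3" "0 < t"
  shows "t > 1442 / 1000" "t < 1443 / 1000"
proof -
  show "t > 1442 / 1000"
  proof (rule ccontr)
    assume "\<not> ?thesis"
    then have "t ^ 3 \<le> (1442 / 1000) ^ 3" using assms by (intro power_mono) auto
    then show False using assms by (simp add: power3_eq_cube)
  qed
  show "t < 1443 / 1000"
  proof (rule ccontr)
    assume "\<not> ?thesis"
    then have "t ^ 3 \<ge> (1443 / 1000) ^ 3" by (intro power_mono) auto
    then show False using assms by (simp add: power3_eq_cube)
  qed
qed

text \<open>The rate at which branching on a vertex of degree \<open>d \<ge> 3\<close> beats the Moon--Moser bound.\<close>

lemma branching_rate:
  fixes q t :: real
  assumes t: "t ^ 3 = 3" "0 < t" and q: "1 \<le> q" "q ^ (8 * D) \<le> 28 / 25" "12 \<le> D" and d: "3 \<le> d" "d \<le> D"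
  shows "q ^ (8 * d) / t + q ^ (8 * (d * (d + 1))) / t ^ (d + 1) \<le> 1"
proof -
  define s where "s = q ^ (8 * d)"
  have tb: "t > 1442 / 1000" using cube_root_three_bounds t by blast
  have s1: "1 \<le> s" unfolding s_def using q by simp
  have pow: "s ^ k \<le> 28 / 25" if "d * k \<le> D" for k
  proof -
    have "s ^ k = q ^ (8 * (d * k))" by (simp add: s_def power_mult)
    also have "\<dots> \<le> q ^ (8 * D)" using q that by (intro power_increasing) auto
    finally show ?thesis using q by linarith
  qed
  have "q ^ (8 * (d * (d + 1))) = s ^ (d + 1)" by (simp add: s_def power_mult[symmetric] power_add[symmetric] algebra_simps)
  then have eq: "q ^ (8 * d) / t + q ^ (8 * (d * (d + 1))) / t ^ (d + 1) = s / t + (s / t) ^ (d + 1)"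
    by (simp add: s_def power_divide)
  have st: "s / t \<le> r" if "s \<le> r * (1442 / 1000)" "0 \<le> r" for r
  proof -
    have "s \<le> r * t" using that tb by (smt (verit) mult_left_mono)
    then show ?thesis using t by (simp add: divide_le_eq)
  qed
  have st0: "0 \<le> s / t" using s1 t by simp
  have fin: "s / t + (s / t) ^ (d + 1) \<le> 1" if "s / t \<le> r" "k \<le> d + 1" "r + r ^ k \<le> 1" "0 \<le> r" "r \<le> 1" for r k
  proof -
    have "(s / t) ^ (d + 1) \<le> r ^ (d + 1)" using st0 that by (intro power_mono) auto
    also have "\<dots> \<le> r ^ k" using that by (intro power_decreasing) auto
    finally show ?thesis using that by linarith
  qed
  \<comment> \<open>Here \<open>12 \<le> D\<close> matters: it bounds \<open>s ^ 4\<close> for d = 3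
    and \<open>s ^ 3\<close> for d = 4 by 28/25, as 3 * 4 = 12. For d at least 5 the bound on
    \<open>s\<close> itself is enough, because the second summand then has exponent at least
    6.\<close>
  consider "d = 3" | "d = 4" | "5 \<le> d" using d by linarith
  then have "s / t + (s / t) ^ (d + 1) \<le> 1"
  proof cases
    case 1
    have "s ^ 4 \<le> 28 / 25" using pow[of 4] 1 q by simp
    then have "s \<le> 103 / 100"
      using power_mono[of "103 / 100" s 4] by (rule_tac ccontr) (simp add: power4_eq_xxxx)
    then have "s / t \<le> 715 / 1000" by (intro st) auto
    then show ?thesis by (rule fin[where k = 4]) (use 1 in \<open>simp_all add: power4_eq_xxxx\<close>)
  next
    case 2
    have "s ^ 3 \<le> 28 / 25" using pow[of 3] 2 q by simp
    then have "s \<le> 104 / 100"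
      using power_mono[of "104 / 100" s 3] by (rule_tac ccontr) (simp add: power3_eq_cube)
    then have "s / t \<le> 722 / 1000" by (intro st) auto
    then show ?thesis by (rule fin[where k = 4]) (use 2 in \<open>simp_all add: power4_eq_xxxx\<close>)
  next
    case 3
    have "s \<le> 28 / 25" using pow[of 1] d by simp
    then have "s / t \<le> 777 / 1000" by (intro st) auto
    then show ?thesis by (rule fin[where k = 6]) (use 3 in \<open>simp_all add: numeral_eq_Suc\<close>)
  qed
  then show ?thesis using eq by simp
qed

text \<open>Stability for the Moon--Moser bound \<open>3\<^bsup>n/3\<^esup>\<close>, which is attained by disjoint triangles. The
  bound on the degrees cannot be dropped: a single vertex joined to all triangles of a disjoint
  union has nearly no influence on the number of maximal independent sets. The factor 8 comes
  from \<open>defect_remove\<close>; 28/25 and 12 are such that no branching step of the induction loses.\<close>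

theorem card_mis_defect:
  fixes q t :: real
  assumes t: "t ^ 3 = 3" "0 < t" and q: "1 \<le> q" "q ^ (8 * D) \<le> 28 / 25" "12 \<le> D" and R: "symp R"
    and "finite W" "\<And>u. u \<in> W \<Longrightarrow> card (nbrs R W u) \<le> D"
  shows "card (mis R W) * q ^ defect R W \<le> t ^ card W"
  using assms(7,8)
proof (induction "card W" arbitrary: W rule: less_induct)
  case (less W)
  note W = \<open>finite W\<close> and deg = less.prems(2)
  have tb: "t > 1442 / 1000" using cube_root_three_bounds t by blast
  have t1: "1 \<le> t" using tb by linarith
  have q0: "0 < q" using q by linarith
  have deg': "card (nbrs R (W - Y) u) \<le> D" if "u \<in> W - Y" for u Y
  proof -
    have "card (nbrs R (W - Y) u) \<le> card (nbrs R W u)"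
      using W by (intro card_mono) (auto simp: nbrs_def)
    then show ?thesis using deg[of u] that by auto
  qed
  have IH0: "card (mis R (W - Y)) * q ^ defect R (W - Y) \<le> t ^ card (W - Y)" if "Y \<subseteq> W" "Y \<noteq> {}" for Y
    using that W by (intro less.hyps deg') (auto intro!: psubset_card_mono)
  \<comment> \<open>The price of one branch: each removed vertex gains a factor 1/t, and the lost
    defect costs at most \<open>q ^ 8\<close> per unit of degree in \<open>Y\<close>.\<close>
  have IH: "card (mis R (W - Y)) * q ^ defect R W \<le> t ^ card W * (q ^ (8 * s) / t ^ k)"
    if Y: "Y \<subseteq> W" "Y \<noteq> {}" and k: "k \<le> card Y" and s: "(\<Sum>y\<in>Y. card (nbrs R W y)) \<le> s" for Y k s
  proof -
    have "defect R W \<le> defect R (W - Y) + 8 * s"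
      using defect_remove[OF W R Y(1)] s by linarith
    then have "q ^ defect R W \<le> q ^ defect R (W - Y) * q ^ (8 * s)"
      using q by (simp add: power_add[symmetric] power_increasing)
    then have "card (mis R (W - Y)) * q ^ defect R W \<le> (card (mis R (W - Y)) * q ^ defect R (W - Y)) * q ^ (8 * s)"
      by (metis mult.assoc mult_left_mono of_nat_0_le_iff)
    also have "\<dots> \<le> t ^ card (W - Y) * q ^ (8 * s)"
      using IH0[OF Y] q0 by (intro mult_right_mono) auto
    also have "\<dots> \<le> (t ^ card W / t ^ k) * q ^ (8 * s)"
    proof -
      have "card Y \<le> card W" using Y W by (intro card_mono) auto
      then have "card (W - Y) \<le> card W - k" "k \<le> card W"
        using k Y W by (auto simp: card_Diff_subset finite_subset)
      then have "t ^ card (W - Y) \<le> t ^ card W / t ^ k"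
        using t1 t by (simp add: power_diff[symmetric] power_increasing)
      then show ?thesis using q0 by (intro mult_right_mono) auto
    qed
    finally show ?thesis by simp
  qed
  have bound: ?case if "card (mis R W) * q ^ defect R W \<le> t ^ card W * c" "c \<le> 1" for c
  proof -
    have "t ^ card W * c \<le> t ^ card W * 1" using that(2) t by (intro mult_left_mono) auto
    then show ?thesis using that(1) by simp
  qed
  have qpow: "q ^ i \<le> 28 / 25" if "i \<le> 8 * D" for i
    using power_increasing[OF that q(1)] q by linarith
  have mono: "real (card (mis R W)) * q ^ defect R W \<le> (\<Sum>i\<in>I. real (c i) * q ^ defect R W)"
    if "card (mis R W) \<le> (\<Sum>i\<in>I. c i)" for c :: "'a \<Rightarrow> nat" and I
  proof -
    have "real (card (mis R W)) \<le> (\<Sum>i\<in>I. real (c i))" using that by (metis of_nat_le_iff of_nat_sum)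
    then show ?thesis unfolding sum_distrib_right[symmetric] using q0 by (intro mult_right_mono) auto
  qed
  note nbW = nbrs_subset[of R W]
  show ?case
  proof (cases "\<exists>y\<in>W. R y y")
    case True
    then obtain y where y: "y \<in> W" "R y y" by blast
    have "mis R W = {S \<in> mis R W. S \<inter> {y} = {}}" using y by (auto simp: mis_def)
    then have "card (mis R W) \<le> card (mis R (W - {y}))" by (metis card_mis_avoid W)
    then have "card (mis R W) * q ^ defect R W \<le> card (mis R (W - {y})) * q ^ defect R W"
      using q0 by (intro mult_right_mono) auto
    also have "\<dots> \<le> t ^ card W * (q ^ (8 * D) / t ^ 1)"
      using y deg by (intro IH) auto
    finally show ?thesis by (rule bound) (use tb q in \<open>simp add: divide_le_eq\<close>)
  next
    case noloop: False
    show ?thesis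
    proof (cases "\<exists>y\<in>W. 3 \<le> card (nbrs R W y)")
      case True
      then obtain x where x: "x \<in> W" "3 \<le> card (nbrs R W x)" by blast
      have "\<forall>z. z \<in> W \<longrightarrow> card (nbrs R W z) < Suc D" using deg by (simp add: le_imp_less_Suc)
      \<comment> \<open>Branching at a vertex of maximum degree d keeps the degree sum of its closed
        neighbourhood below d(d + 1).\<close>
      then obtain y where y: "y \<in> W" "\<And>z. z \<in> W \<Longrightarrow> card (nbrs R W z) \<le> card (nbrs R W y)"
        using ex_has_greatest_nat[of "\<lambda>y. y \<in> W" x "\<lambda>y. card (nbrs R W y)" "Suc D"] x by blast
      define d where "d = card (nbrs R W y)"
      have d: "3 \<le> d" "d \<le> D" using x y deg unfolding d_def by (meson le_trans)+
      have "card (mis R W) = card {S \<in> mis R W. S \<inter> {y} = {}} + card {S \<in> mis R W. y \<in> S \<and> S \<inter> {} = {}}"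
        using W by (subst card_Un_disjoint[symmetric]) (auto intro!: arg_cong[where f = card])
      also have "\<dots> \<le> card (mis R (W - {y})) + card (mis R (W - insert y (nbrs R W y)))"
        using card_mis_avoid[OF W, of R "{y}"] card_mis_branch[OF W R, of y "{}"] by auto
      finally have "card (mis R W) * q ^ defect R W
          \<le> card (mis R (W - {y})) * q ^ defect R W + card (mis R (W - insert y (nbrs R W y))) * q ^ defect R W"
        using q0 by (simp add: distrib_right[symmetric] of_nat_add[symmetric] del: of_nat_add)
      also have "\<dots> \<le> t ^ card W * (q ^ (8 * d) / t ^ 1) + t ^ card W * (q ^ (8 * (d * (d + 1))) / t ^ (d + 1))"
      proof (intro add_mono IH)
        have "(\<Sum>z\<in>insert y (nbrs R W y). card (nbrs R W z)) \<le> (\<Sum>z\<in>insert y (nbrs R W y). d)"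
          using y nbW by (intro sum_mono) (auto simp: d_def nbrs_def)
        also have "\<dots> = d * (d + 1)"
          using W nbW[of y] by (subst sum_constant, subst card_insert_disjoint) (auto simp: d_def)
        finally show "(\<Sum>z\<in>insert y (nbrs R W y). card (nbrs R W z)) \<le> d * (d + 1)" .
        show "d + 1 \<le> card (insert y (nbrs R W y))"
          using W nbW[of y] by (subst card_insert_disjoint) (auto simp: d_def)
      qed (use y nbW[of y] in \<open>auto simp: d_def\<close>)
      also have "\<dots> = t ^ card W * (q ^ (8 * d) / t + q ^ (8 * (d * (d + 1))) / t ^ (d + 1))"
        by (simp add: algebra_simps)
      finally show ?thesis by (rule bound) (rule branching_rate[OF t q d])
    next
      case False
      then have deg2: "card (nbrs R W z) \<le> 2" if "z \<in> W" for z using that by fastforce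
      \<comment> \<open>The maximum degree is now at most 2, so the components are paths and cycles.
        In the last case only cycles of length at least 4 are left.\<close>
      consider (empty) "W = {}" | (tri) u where "in_triangle R W u"
        | (leaf) v where "v \<in> W" "card (nbrs R W v) \<le> 1"
        | (cycle) v where "v \<in> W" "\<And>u. \<not> in_triangle R W u" "\<And>u. u \<in> W \<Longrightarrow> card (nbrs R W u) = 2"
        using deg2 by (metis One_nat_def Suc_1 equals0I le_SucE)
      then show ?thesis
      proof cases
        case empty
        have "mis R {} = {{}}" by (auto simp: mis_def)
        then show ?thesis using empty by (simp add: defect_def)
      next
        case tri
        then obtain v w where vw: "v \<noteq> w" "nbrs R W u = {v, w}" "nbrs R W v = {u, w}" "nbrs R W w = {u, v}" "u \<in> W"
          by (auto simp: in_triangle_def)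
        let ?T = "{u, v, w}"
        have TW: "?T \<subseteq> W" using nbW[of u] vw by auto
        have uvw: "u \<noteq> v" "u \<noteq> w" using nbW[of u] vw by auto
        have nT: "insert z (nbrs R W z) = ?T" if "z \<in> ?T" for z using that vw by auto
        have dT: "defect R W \<le> defect R (W - ?T)"
        proof (rule defect_remove_triangle[OF W R])
          show "in_triangle R W x" if "x \<in> ?T" for x
            using that tri vw in_triangleD[OF tri] by auto
          show "nbrs R W x \<subseteq> ?T" if "x \<in> ?T" for x using nT[OF that] by blast
        qed
        have "card (mis R W) \<le> (\<Sum>z\<in>?T. card (mis R (W - (insert z (nbrs R W z) \<union> {}))))"
        proof (rule card_mis_cover[OF W R])
          fix S assume "S \<in> mis R W"
          then show "\<exists>z\<in>?T. z \<in> S \<and> S \<inter> {} = {}"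
            using mis_meets_closed_nbrs[of S R W u] vw noloop by auto
        qed auto
        also have "\<dots> = (\<Sum>z\<in>?T. card (mis R (W - ?T)))"
          using nT by (intro sum.cong) auto
        also have "\<dots> = 3 * card (mis R (W - ?T))" using uvw vw by simp
        finally have "card (mis R W) * q ^ defect R W \<le> (3 * card (mis R (W - ?T))) * q ^ defect R W"
          using q0 by (intro mult_right_mono) (auto simp del: of_nat_mult)
        also have "\<dots> \<le> (3 * card (mis R (W - ?T))) * q ^ defect R (W - ?T)"
          using dT q by (intro mult_left_mono power_increasing) auto
        also have "\<dots> \<le> 3 * t ^ card (W - ?T)" using IH0[of ?T] TW by simp
        also have "\<dots> = t ^ (3 + card (W - ?T))" using t by (simp add: power_add)
        also have "3 + card (W - ?T) = card W"
        proof -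
          have "card ?T = 3" using uvw vw by simp
          moreover have "card ?T \<le> card W" using TW W by (intro card_mono) auto
          ultimately show ?thesis using TW W by (subst card_Diff_subset) auto
        qed
        finally show ?thesis by simp
      next
        case leaf
        have q24: "q ^ 24 \<le> 103 / 100"
        proof (rule ccontr)
          assume "\<not> ?thesis"
          then have "(103 / 100) ^ 4 \<le> (q ^ 24) ^ 4" by (intro power_mono) auto
          also have "(q ^ 24) ^ 4 = q ^ 96" by (simp add: power_mult[symmetric])
          also have "\<dots> \<le> 28 / 25" using q by (intro qpow) auto
          finally show False by (simp add: power4_eq_xxxx)
        qed
        show ?thesis
        proof (cases "nbrs R W v = {}")
          case True
          have "card (mis R W) \<le> (\<Sum>z\<in>{v}. card (mis R (W - (insert z (nbrs R W z) \<union> {}))))"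
          proof (rule card_mis_cover[OF W R])
            fix S assume "S \<in> mis R W"
            then show "\<exists>z\<in>{v}. z \<in> S \<and> S \<inter> {} = {}"
              using mis_meets_closed_nbrs[of S R W v] leaf noloop True by auto
          qed auto
          then have "card (mis R W) * q ^ defect R W \<le> card (mis R (W - {v})) * q ^ defect R W"
            using q0 True by (intro mult_right_mono) auto
          also have "\<dots> \<le> t ^ card W * (q ^ (8 * 0) / t ^ 1)"
            using leaf True by (intro IH) auto
          finally show ?thesis by (rule bound) (use tb in simp)
        next
          case False
          then have "card (nbrs R W v) = 1" using leaf W by (simp add: le_Suc_eq)
          then obtain w where w: "nbrs R W v = {w}" by (auto simp: card_1_singleton_iff)
          then have wW: "w \<in> W" "w \<noteq> v" "v \<in> nbrs R W w"
            using sympD[OF R, of v w] leaf by (auto simp: nbrs_def)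
          let ?Y = "insert w (nbrs R W w)"
          have "card (mis R W) \<le> (\<Sum>z\<in>{v, w}. card (mis R (W - (insert z (nbrs R W z) \<union> {}))))"
          proof (rule card_mis_cover[OF W R])
            fix S assume "S \<in> mis R W"
            then show "\<exists>z\<in>{v, w}. z \<in> S \<and> S \<inter> {} = {}"
              using mis_meets_closed_nbrs[of S R W v] leaf noloop w by auto
          qed auto
          then have "card (mis R W) * q ^ defect R W
              \<le> (\<Sum>z\<in>{v, w}. card (mis R (W - (insert z (nbrs R W z) \<union> {}))) * q ^ defect R W)"
            by (rule mono)
          also have "\<dots> = card (mis R (W - {v, w})) * q ^ defect R W + card (mis R (W - ?Y)) * q ^ defect R W"
            using w wW by simp
          also have "\<dots> \<le> t ^ card W * (q ^ (8 * 3) / t ^ 2) + t ^ card W * (q ^ (8 * 3) / t ^ 2)"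
          proof (intro add_mono)
            have "card (nbrs R W v) + card (nbrs R W w) \<le> 3" using w deg2[OF wW(1)] by simp
            then show "card (mis R (W - {v, w})) * q ^ defect R W \<le> t ^ card W * (q ^ (8 * 3) / t ^ 2)"
              using wW leaf by (intro IH) auto
            show "card (mis R (W - ?Y)) * q ^ defect R W \<le> t ^ card W * (q ^ (8 * 3) / t ^ 2)"
            \<comment> \<open>Either the edge is isolated, with degree sum 2, or \<open>w\<close>
              has a second neighbour: then the degree sum may rise to 5, but the third removed
              vertex gains a factor t, which exceeds the additional \<open>q ^ 16\<close>.\<close>
            proof (cases "card (nbrs R W w) = 1")
              case True
              then have "nbrs R W w = {v}" using wW by (auto simp: card_1_singleton_iff)
              then show ?thesis using wW leaf w by (intro IH) auto
            next
              case c: False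
              have "card (nbrs R W w) \<noteq> 0" using wW W by auto
              then have c2: "card (nbrs R W w) = 2" using c deg2[OF wW(1)] by linarith
              have cY: "card ?Y = 3" using nbW[of w] W c2 by (subst card_insert_disjoint) auto
              have "(\<Sum>z\<in>?Y. card (nbrs R W z)) = card (nbrs R W v) + (\<Sum>z\<in>?Y - {v}. card (nbrs R W z))"
                using wW W by (intro sum.remove) auto
              also have "(\<Sum>z\<in>?Y - {v}. card (nbrs R W z)) \<le> (\<Sum>z\<in>?Y - {v}. 2)"
                using nbW[of w] wW deg2 by (intro sum_mono) auto
              also have "\<dots> = 4" using cY wW W by simp
              finally have "(\<Sum>z\<in>?Y. card (nbrs R W z)) \<le> 5" using w by simp
              then have "card (mis R (W - ?Y)) * q ^ defect R W \<le> t ^ card W * (q ^ (8 * 5) / t ^ 3)"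
                using cY nbW[of w] wW by (intro IH) auto
              also have "\<dots> \<le> t ^ card W * (q ^ (8 * 3) / t ^ 2)"
              proof (intro mult_left_mono)
                have "q ^ 16 \<le> t" using qpow[of 16] q tb by simp
                then have "q ^ 24 * q ^ 16 \<le> q ^ 24 * t" using q0 by (intro mult_left_mono) auto
                then have "q ^ 40 \<le> q ^ 24 * t" by (simp add: power_add[symmetric])
                then have "q ^ 40 / t ^ 3 \<le> q ^ 24 * t / t ^ 3"
                  using t by (intro divide_right_mono) auto
                also have "\<dots> = q ^ 24 / t ^ 2"
                  using t(2) by (simp add: power3_eq_cube power2_eq_square)
                finally show "q ^ (8 * 5) / t ^ 3 \<le> q ^ (8 * 3) / t ^ 2" by simp
              qed (use t in auto)
              finally show ?thesis .
            qed
          qed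
          also have "\<dots> = t ^ card W * (2 * q ^ 24 / t ^ 2)" by simp
          finally show ?thesis
          proof (rule bound)
            have "(1442 / 1000)\<^sup>2 \<le> t\<^sup>2" using tb by (intro power_mono) auto
            then show "2 * q ^ 24 / t ^ 2 \<le> 1" using q24 t by (simp add: divide_le_eq power2_eq_square)
          qed
        qed
      next
        case cycle
        obtain u w where uw: "nbrs R W v = {u, w}" "u \<noteq> w" using cycle by (meson card_2_iff)
        have W3: "u \<in> W" "w \<in> W" "u \<noteq> v" "w \<noteq> v" using nbW[of v] uw by auto
        have vu: "v \<in> nbrs R W u" "v \<in> nbrs R W w"
          using uw sympD[OF R, of v] cycle(1) by (auto simp: nbrs_def)
        have no: "u \<notin> nbrs R W w"
        proof
          assume "u \<in> nbrs R W w"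
          moreover from this have "w \<in> nbrs R W u" using sympD[OF R, of w u] W3 by (auto simp: nbrs_def)
          moreover have "A = {a, b}" if "a \<in> A" "b \<in> A" "a \<noteq> b" "card A = 2" for A :: "'a set" and a b
            using that by (intro card_seteq[symmetric]) (auto intro: card_ge_0_finite)
          ultimately have "nbrs R W w = {v, u}" "nbrs R W u = {v, w}" using W3 vu cycle(3) by metis+
          then have "in_triangle R W v" using uw cycle(1) unfolding in_triangle_def
            by (intro conjI exI[of _ u] exI[of _ w]) (simp_all add: insert_commute)
          then show False using cycle(2) by blast
        qed
        have N3: "card (insert z (nbrs R W z)) = 3" "insert z (nbrs R W z) \<subseteq> W" if "z \<in> W" for z
        proof -
          have "z \<notin> nbrs R W z" using nbW[of z] by blast
          then show "card (insert z (nbrs R W z)) = 3" using W cycle(3)[OF that] by simp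
          show "insert z (nbrs R W z) \<subseteq> W" using nbW[of z] that by blast
        qed
        have N6: "(\<Sum>x\<in>Y. card (nbrs R W x)) = 2 * card Y" if "Y \<subseteq> W" for Y
          
        proof -
          have "(\<Sum>x\<in>Y. card (nbrs R W x)) = (\<Sum>x\<in>Y. 2)" using that by (intro sum.cong refl cycle(3)) blast
          then show ?thesis by simp
        qed
        have nvw: "v \<noteq> w" "w \<noteq> u" using W3 uw by auto
        \<comment> \<open>The third branch may assume that \<open>u\<close> is absent. As
          \<open>u\<close> is not adjacent to \<open>w\<close>, it removes four vertices instead of
          three, so the rates add up to about 2/3 + 1/(3t) < 1, where three equal branches would
          only give 1.\<close>
        have "card (mis R W) \<le> (\<Sum>z\<in>{v, u, w}. card (mis R (W - (insert z (nbrs R W z) \<union> (if z = w then {u} else {})))))"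
        proof (rule card_mis_cover[OF W R])
          fix S assume "S \<in> mis R W"
          then show "\<exists>z\<in>{v, u, w}. z \<in> S \<and> S \<inter> (if z = w then {u} else {}) = {}"
            using mis_meets_closed_nbrs[of S R W v] cycle(1) noloop uw nvw by auto
        qed (use uw in auto)
        then have "card (mis R W) * q ^ defect R W
            \<le> (\<Sum>z\<in>{v, u, w}. card (mis R (W - (insert z (nbrs R W z) \<union> (if z = w then {u} else {})))) * q ^ defect R W)"
          by (rule mono)
        also have "\<dots> = card (mis R (W - insert v (nbrs R W v))) * q ^ defect R W
            + card (mis R (W - insert u (nbrs R W u))) * q ^ defect R W
            + card (mis R (W - insert u (insert w (nbrs R W w)))) * q ^ defect R W"
          using W3 uw(2) nvw by (simp add: insert_commute)
        also have "\<dots> \<le> t ^ card W * (q ^ (8 * 6) / t ^ 3) + t ^ card W * (q ^ (8 * 6) / t ^ 3)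
            + t ^ card W * (q ^ (8 * 8) / t ^ 4)"
        proof (intro add_mono)
          have "card (mis R (W - insert z (nbrs R W z))) * q ^ defect R W \<le> t ^ card W * (q ^ (8 * 6) / t ^ 3)"
            if "z \<in> W" for z
            using N3[OF that] N6[OF N3(2)[OF that]] by (intro IH) auto
          then show "card (mis R (W - insert v (nbrs R W v))) * q ^ defect R W \<le> t ^ card W * (q ^ (8 * 6) / t ^ 3)"
            "card (mis R (W - insert u (nbrs R W u))) * q ^ defect R W \<le> t ^ card W * (q ^ (8 * 6) / t ^ 3)"
            using cycle(1) W3 by blast+
          let ?Y = "insert u (insert w (nbrs R W w))"
          have "card ?Y = 4" using no uw W N3[OF W3(2)] by (subst card_insert_disjoint) auto
          moreover have YW: "?Y \<subseteq> W" using N3[OF W3(2)] W3 by blast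
          ultimately show "card (mis R (W - ?Y)) * q ^ defect R W \<le> t ^ card W * (q ^ (8 * 8) / t ^ 4)"
            using N6[OF YW] by (intro IH) auto
        qed
        also have "\<dots> = t ^ card W * (2 * q ^ 48 / 3 + q ^ 64 / (3 * t))"
          using t by (simp add: algebra_simps power4_eq_xxxx power3_eq_cube)
        finally show ?thesis
        proof (rule bound)
          have "q ^ 48 \<le> 106 / 100"
          proof (rule ccontr)
            assume "\<not> ?thesis"
            then have "(106 / 100)\<^sup>2 \<le> (q ^ 48)\<^sup>2" by (intro power_mono) auto
            also have "(q ^ 48)\<^sup>2 = q ^ 96" by (simp add: power_mult[symmetric])
            also have "\<dots> \<le> 28 / 25" using q by (intro qpow) auto
            finally show False by (simp add: power2_eq_square)
          qed
          moreover have "q ^ 64 / (3 * t) \<le> 26 / 100"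
            using qpow[of 64] q tb by (simp add: divide_le_eq)
          ultimately show "2 * q ^ 48 / 3 + q ^ 64 / (3 * t) \<le> 1" by linarith
        qed
      qed
    qed
  qed
qed

section \<open>Regularity in groups of exponent three\<close>

definition sumfree :: "'a::plus set \<Rightarrow> bool" where
  "sumfree S \<longleftrightarrow> (\<forall>x\<in>S. \<forall>y\<in>S. x + y \<notin> S)"

text \<open>The value 1 off \<open>V\<close> makes a character determined by its restriction to
  \<open>V\<close>, so that there are exactly \<open>card V\<close> of them.\<close>

definition chars :: "'a::plus set \<Rightarrow> ('a \<Rightarrow> complex) set" where
  "chars V = {\<chi>. (\<forall>x\<in>V. \<forall>y\<in>V. \<chi> (x + y) = \<chi> x * \<chi> y) \<and> (\<forall>x\<in>V. \<chi> x ^ 3 = 1) \<and> (\<forall>x. x \<notin> V \<longrightarrow> \<chi> x = 1)}"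

definition ker :: "'a set \<Rightarrow> ('a \<Rightarrow> complex) set \<Rightarrow> 'a set" where
  "ker V C = {x\<in>V. \<forall>\<chi>\<in>C. \<chi> x = 1}"

definition cell_trace :: "('a::plus \<times> 'b) set \<Rightarrow> 'a set \<Rightarrow> 'a \<Rightarrow> 'b \<Rightarrow> 'a set" where
  "cell_trace S H v j = {h\<in>H. (v + h, j) \<in> S}"

text \<open>\<open>\<chi>\<close> witnesses that \<open>S\<close> is not Fourier-uniform on the
  coset \<open>v + H\<close> in layer \<open>j\<close>. Characters trivial on \<open>H\<close> are
  excluded since they only measure density.\<close>

definition nonunif :: "real \<Rightarrow> 'a::plus set \<Rightarrow> ('a \<times> 'b) set \<Rightarrow> 'a set \<Rightarrow> 'a \<Rightarrow> 'b \<Rightarrow> ('a \<Rightarrow> complex) \<Rightarrow> bool" where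
  "nonunif \<eta> V S H v j \<chi> \<longleftrightarrow> \<chi> \<in> chars V \<and> (\<exists>h\<in>H. \<chi> h \<noteq> 1) \<and> \<eta> * card H \<le> norm (\<Sum>h\<in>cell_trace S H v j. \<chi> h)"

text \<open>For a subgroup \<open>H\<close> this is the conditional expectation of \<open>g\<close>
  on the cosets of \<open>H\<close>.\<close>

definition avg :: "'a::plus set \<Rightarrow> ('a \<Rightarrow> real) \<Rightarrow> 'a \<Rightarrow> real" where
  "avg H g v = (\<Sum>h\<in>H. g (v + h)) / card H"

text \<open>Bounds the number of characters after i refinements: L characters define at most
  \<open>3 ^ L\<close> cosets in each of p layers, and every such cell contributes at most one new
  character.\<close>

fun char_bound :: "nat \<Rightarrow> nat \<Rightarrow> nat" where
  "char_bound p 0 = 0"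
| "char_bound p (Suc i) = char_bound p i + p * 3 ^ char_bound p i"

text \<open>That characters separate points is assumed instead of being derived from a basis of
  \<open>V\<close>; for the concrete groups the coordinates provide it.\<close>

locale exp3_group =
  fixes V :: "'a::ab_group_add set"
  assumes finite_V [simp]: "finite V" and zero_V [simp]: "0 \<in> V"
    and add_V [simp]: "x \<in> V \<Longrightarrow> y \<in> V \<Longrightarrow> x + y \<in> V"
    and triple_V: "x \<in> V \<Longrightarrow> x + x + x = 0"
    and separating: "x \<in> V \<Longrightarrow> x \<noteq> 0 \<Longrightarrow> \<exists>\<chi>\<in>chars V. \<chi> x \<noteq> 1"
begin

text \<open>Closure under negation is automatic, as -x = x + x in exponent three.\<close>

definition subgrp :: "'a set \<Rightarrow> bool" where
  "subgrp H \<longleftrightarrow> H \<subseteq> V \<and> 0 \<in> H \<and> (\<forall>x\<in>H. \<forall>y\<in>H. x + y \<in> H)"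

lemma uminus_eq: "x \<in> V \<Longrightarrow> - x = x + x"
  using triple_V[of x] minus_unique[of x "x + x"] by (simp add: add.assoc)

lemma subgrp_uminus: "subgrp H \<Longrightarrow> x \<in> H \<Longrightarrow> - x \<in> H"
  unfolding subgrp_def by (metis uminus_eq subsetD)

lemma subgrp_diff: "subgrp H \<Longrightarrow> x \<in> H \<Longrightarrow> y \<in> H \<Longrightarrow> x - y \<in> H"
  using subgrp_uminus unfolding subgrp_def by (metis add_uminus_conv_diff)

lemma subgrp_V: "subgrp V"
  by (simp add: subgrp_def)

lemma uminus_V [simp]: "x \<in> V \<Longrightarrow> - x \<in> V"
  using subgrp_uminus[OF subgrp_V] .

lemma diff_V [simp]: "x \<in> V \<Longrightarrow> y \<in> V \<Longrightarrow> x - y \<in> V"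
  using subgrp_diff[OF subgrp_V] .

lemma subgrp_finite: "subgrp H \<Longrightarrow> finite H"
  unfolding subgrp_def using finite_subset finite_V by blast

lemma subgrp_card_pos: "subgrp H \<Longrightarrow> 0 < card H"
  using subgrp_finite unfolding subgrp_def card_gt_0_iff by blast

lemma subgrp_memD: "subgrp H \<Longrightarrow> x \<in> H \<Longrightarrow> x \<in> V"
  unfolding subgrp_def by blast

lemma subgrp_add: "subgrp H \<Longrightarrow> x \<in> H \<Longrightarrow> y \<in> H \<Longrightarrow> x + y \<in> H"
  unfolding subgrp_def by blast

section \<open>Orthogonality of characters and Schur triples\<close>

lemma char_add: "\<chi> \<in> chars V \<Longrightarrow> x \<in> V \<Longrightarrow> y \<in> V \<Longrightarrow> \<chi> (x + y) = \<chi> x * \<chi> y"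
  by (simp add: chars_def)

lemma char_cube: "\<chi> \<in> chars V \<Longrightarrow> \<chi> x ^ 3 = 1"
  by (cases "x \<in> V") (auto simp: chars_def)

lemma char_norm: "\<chi> \<in> chars V \<Longrightarrow> norm (\<chi> x) = 1"
  using char_cube[of \<chi> x] by (metis norm_ge_zero norm_one norm_power power_eq_1_iff zero_neq_numeral)

lemma char_neq_0: "\<chi> \<in> chars V \<Longrightarrow> \<chi> x \<noteq> 0"
  using char_norm[of \<chi> x] by auto

lemma char_0: "\<chi> \<in> chars V \<Longrightarrow> \<chi> 0 = 1"
  using char_add[of \<chi> 0 0] char_neq_0[of \<chi> 0] by simp

lemma char_uminus: "\<chi> \<in> chars V \<Longrightarrow> x \<in> V \<Longrightarrow> \<chi> (- x) = cnj (\<chi> x)"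
proof -
  assume \<chi>: "\<chi> \<in> chars V" and x: "x \<in> V"
  have "\<chi> x * \<chi> (- x) = 1" using char_add[OF \<chi> x, of "- x"] x char_0[OF \<chi>] by simp
  moreover have "\<chi> x * cnj (\<chi> x) = 1" using char_norm[OF \<chi>, of x] by (simp add: complex_norm_square[symmetric])
  ultimately show ?thesis using char_neq_0[OF \<chi>, of x] by (metis mult_left_cancel)
qed

lemma char_diff: "\<chi> \<in> chars V \<Longrightarrow> x \<in> V \<Longrightarrow> y \<in> V \<Longrightarrow> \<chi> (x - y) = \<chi> x * cnj (\<chi> y)"
  using char_add[of \<chi> x "- y"] char_uminus[of \<chi> y] by simp

lemma one_char: "(\<lambda>x. 1) \<in> chars V"
  by (simp add: chars_def)

lemma mult_char: "\<chi> \<in> chars V \<Longrightarrow> \<psi> \<in> chars V \<Longrightarrow> (\<lambda>x. \<chi> x * \<psi> x) \<in> chars V"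
  by (auto simp: chars_def power_mult_distrib)

lemma finite_roots: "finite {z::complex. z ^ 3 = 1}"
  by (rule card_ge_0_finite) (simp add: card_roots_unity_eq)

lemma finite_chars [simp]: "finite (chars V)"
proof (rule finite_subset)
  show "chars V \<subseteq> {f. \<forall>x. (x \<in> V \<longrightarrow> f x \<in> {z. z ^ 3 = 1}) \<and> (x \<notin> V \<longrightarrow> f x = 1)}"
    by (auto simp: chars_def)
qed (intro finite_set_of_finite_funs finite_V finite_roots)

lemma sum_translate_sub:
  assumes "subgrp H" "y \<in> H"
  shows "(\<Sum>x\<in>H. f (x + y)) = (\<Sum>x\<in>H. f x)"
  by (rule sum.reindex_bij_witness[of _ "\<lambda>x. x - y" "\<lambda>x. x + y"])
    (use assms in \<open>simp_all add: subgrp_diff subgrp_add\<close>)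

lemma sum_char_sub:
  assumes H: "subgrp H" and \<chi>: "\<chi> \<in> chars V"
  shows "(\<Sum>x\<in>H. \<chi> x) = (if \<forall>x\<in>H. \<chi> x = 1 then of_nat (card H) else 0)"
proof (cases "\<forall>x\<in>H. \<chi> x = 1")
  case False
  then obtain y where y: "y \<in> H" "\<chi> y \<noteq> 1" by blast
  have "(\<Sum>x\<in>H. \<chi> x) = (\<Sum>x\<in>H. \<chi> (x + y))" by (rule sum_translate_sub[OF H y(1), symmetric])
  also have "\<dots> = \<chi> y * (\<Sum>x\<in>H. \<chi> x)"
    unfolding sum_distrib_left using subgrp_memD[OF H] y \<chi> by (intro sum.cong) (auto simp: char_add)
  finally have "(\<Sum>x\<in>H. \<chi> x) = 0" using y by simp
  then show ?thesis by (subst if_not_P[OF False])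
qed simp

lemma sum_over_chars:
  assumes x: "x \<in> V"
  shows "(\<Sum>\<chi>\<in>chars V. \<chi> x) = (if x = 0 then of_nat (card (chars V)) else 0)"
proof (cases "x = 0")
  case True
  then show ?thesis by (simp add: char_0)
next
  case False
  then obtain \<psi> where \<psi>: "\<psi> \<in> chars V" "\<psi> x \<noteq> 1" using separating[OF x] by blast
  have cube: "\<psi> z * (\<psi> z * \<psi> z) = 1" for z using char_cube[OF \<psi>(1), of z] by (simp add: power3_eq_cube mult.assoc)
  have "(\<Sum>\<chi>\<in>chars V. \<chi> x) = (\<Sum>\<chi>\<in>chars V. \<psi> x * \<chi> x)"
    by (rule sum.reindex_bij_witness[of _ "\<lambda>\<chi> z. \<psi> z * \<chi> z" "\<lambda>\<chi> z. \<psi> z * (\<psi> z * \<chi> z)"])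
      (use cube in \<open>auto simp: mult.assoc[symmetric] intro!: mult_char \<psi>\<close>)
  also have "\<dots> = \<psi> x * (\<Sum>\<chi>\<in>chars V. \<chi> x)" by (simp add: sum_distrib_left)
  finally have "(\<Sum>\<chi>\<in>chars V. \<chi> x) = 0" using \<psi> by simp
  then show ?thesis using False by simp
qed

text \<open>Double counting of the sum of \<open>\<chi> x\<close> over \<open>x\<close> in
  \<open>H\<close> and all characters, by the two orthogonality relations.\<close>

lemma card_chars_sub:
  assumes H: "subgrp H"
  shows "card {\<chi>\<in>chars V. \<forall>x\<in>H. \<chi> x = 1} * card H = card (chars V)"
proof -
  have "(\<Sum>x\<in>H. \<Sum>\<chi>\<in>chars V. \<chi> x) = (\<Sum>x\<in>H. if x = 0 then of_nat (card (chars V)) else 0)"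
    using subgrp_memD[OF H] by (intro sum.cong) (auto simp: sum_over_chars)
  also have "\<dots> = of_nat (card (chars V))" using H subgrp_finite[OF H] by (simp add: subgrp_def)
  finally have 1: "(\<Sum>x\<in>H. \<Sum>\<chi>\<in>chars V. \<chi> x) = of_nat (card (chars V))" .
  have "(\<Sum>\<chi>\<in>chars V. \<Sum>x\<in>H. \<chi> x) = (\<Sum>\<chi>\<in>chars V. if \<forall>x\<in>H. \<chi> x = 1 then of_nat (card H) else (0::complex))"
    by (intro sum.cong refl sum_char_sub[OF H])
  also have "\<dots> = of_nat (card {\<chi>\<in>chars V. \<forall>x\<in>H. \<chi> x = 1} * card H)"
    by (simp add: sum.inter_filter[symmetric])
  finally have "of_nat (card {\<chi>\<in>chars V. \<forall>x\<in>H. \<chi> x = 1} * card H) = (of_nat (card (chars V)) :: complex)"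
    by (subst 1[symmetric], subst sum.swap) simp
  then show ?thesis using of_nat_eq_iff by blast
qed

lemma card_chars: "card (chars V) = card V"
proof -
  have "{\<chi>\<in>chars V. \<forall>x\<in>V. \<chi> x = 1} = {\<lambda>x. 1}"
    using one_char by (auto simp: chars_def intro!: ext)
  then show ?thesis using card_chars_sub[OF subgrp_V] by simp
qed

definition hat :: "'a set \<Rightarrow> ('a \<Rightarrow> complex) \<Rightarrow> complex" where
  "hat X \<chi> = (\<Sum>x\<in>X. \<chi> x)"

lemma Parseval:
  assumes "X \<subseteq> V"
  shows "(\<Sum>\<chi>\<in>chars V. (norm (hat X \<chi>))\<^sup>2) = real (card (chars V)) * card X"
proof -
  have fin: "finite X" using assms by (rule finite_subset) simp
  have "complex_of_real (\<Sum>\<chi>\<in>chars V. (norm (hat X \<chi>))\<^sup>2) = (\<Sum>\<chi>\<in>chars V. hat X \<chi> * cnj (hat X \<chi>))"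
    by (simp add: complex_norm_square del: of_real_power)
  also have "\<dots> = (\<Sum>\<chi>\<in>chars V. \<Sum>x\<in>X. \<Sum>y\<in>X. \<chi> (x - y))"
    unfolding hat_def cnj_sum sum_product using assms
    by (intro sum.cong refl) (auto simp: char_diff subset_iff)
  also have "\<dots> = (\<Sum>x\<in>X. \<Sum>y\<in>X. \<Sum>\<chi>\<in>chars V. \<chi> (x - y))"
    by (subst sum.swap, rule sum.cong[OF refl], rule sum.swap)
  also have "\<dots> = (\<Sum>x\<in>X. \<Sum>y\<in>X. if x = y then of_nat (card (chars V)) else 0)"
    using assms by (intro sum.cong refl) (auto simp: sum_over_chars subset_iff)
  also have "\<dots> = (\<Sum>x\<in>X. of_nat (card (chars V)))"
    using fin by (intro sum.cong refl) simp
  also have "\<dots> = complex_of_real (real (card (chars V)) * card X)" by simp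
  finally show ?thesis using of_real_eq_iff by blast
qed

text \<open>By orthogonality the sum is the number of characters times the number of solutions of x
  + y = z.\<close>

lemma sum_chars_no_solution:
  assumes "X \<subseteq> V" "Y \<subseteq> V" "Z \<subseteq> V" and no: "\<And>x y. x \<in> X \<Longrightarrow> y \<in> Y \<Longrightarrow> x + y \<notin> Z"
  shows "(\<Sum>\<chi>\<in>chars V. hat X \<chi> * hat Y \<chi> * cnj (hat Z \<chi>)) = 0"
proof -
  have "(\<Sum>\<chi>\<in>chars V. hat X \<chi> * hat Y \<chi> * cnj (hat Z \<chi>))
      = (\<Sum>\<chi>\<in>chars V. \<Sum>p\<in>X \<times> Y. \<Sum>z\<in>Z. \<chi> (fst p + snd p - z))"
    unfolding hat_def cnj_sum sum_product sum.cartesian_product using assms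
    by (intro sum.cong refl) (auto simp: char_diff char_add subset_iff intro!: sum.cong)
  also have "\<dots> = (\<Sum>p\<in>X \<times> Y. \<Sum>z\<in>Z. \<Sum>\<chi>\<in>chars V. \<chi> (fst p + snd p - z))"
    by (subst sum.swap) (intro sum.cong refl sum.swap)
  also have "\<dots> = (\<Sum>p\<in>X \<times> Y. \<Sum>z\<in>Z. 0)"
  proof (rule sum.cong[OF refl], rule sum.cong[OF refl])
    fix p z assume p: "p \<in> X \<times> Y" and z: "z \<in> Z"
    then have "fst p + snd p \<noteq> z" using no by auto
    moreover have "fst p \<in> V" "snd p \<in> V" "z \<in> V" using p z assms(1-3) by auto
    then have "fst p + snd p - z \<in> V" by simp
    ultimately show "(\<Sum>\<chi>\<in>chars V. \<chi> (fst p + snd p - z)) = 0" by (simp add: sum_over_chars)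
  qed
  finally show ?thesis by simp
qed

text \<open>In the vanishing sum over characters, those trivial on \<open>H\<close> contribute a
  positive main term proportional to |X||Y||Z|, which the others must cancel. If all of these were
  small at \<open>X\<close>, then the inequality of the means together with Parseval for
  \<open>Y\<close> and \<open>Z\<close> would bound their contribution by half of the main
  term.\<close>

lemma large_coefficient:
  fixes d :: real
  assumes H: "subgrp H" and XYZ: "X \<subseteq> H" "Y \<subseteq> H" "Z \<subseteq> H" and d: "0 < d"
    and big: "d * card H \<le> card X" "d * card H \<le> card Y" "d * card H \<le> card Z"
    and no: "\<And>x y. x \<in> X \<Longrightarrow> y \<in> Y \<Longrightarrow> x + y \<notin> Z"
  shows "\<exists>\<chi>\<in>chars V. (\<exists>h\<in>H. \<chi> h \<noteq> 1) \<and> d\<^sup>2 / 2 * card H \<le> norm (hat X \<chi>)"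
proof (rule ccontr)
  assume contra: "\<not> ?thesis"
  define M where "M = d\<^sup>2 / 2 * card H"
  define P where "P = {\<chi>\<in>chars V. \<forall>x\<in>H. \<chi> x = 1}"
  let ?f = "\<lambda>\<chi>. hat X \<chi> * hat Y \<chi> * cnj (hat Z \<chi>)"
  have small: "norm (hat X \<chi>) \<le> M" if "\<chi> \<in> chars V - P" for \<chi>
    using contra that unfolding P_def M_def by fastforce
  have H0: "0 < real (card H)" using subgrp_card_pos[OF H] by simp
  have M0: "0 \<le> M" unfolding M_def by simp
  have XV: "X \<subseteq> V" "Y \<subseteq> V" "Z \<subseteq> V" using XYZ subgrp_memD[OF H] by auto
  have hatP: "hat A \<chi> = of_nat (card A)" if "A \<subseteq> H" "\<chi> \<in> P" for A \<chi>
    using that by (simp add: hat_def P_def subset_iff)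
  have "0 = (\<Sum>\<chi>\<in>chars V - P. ?f \<chi>) + (\<Sum>\<chi>\<in>P. ?f \<chi>)"
    using sum_chars_no_solution[OF XV no] by (subst sum.subset_diff[of P "chars V", symmetric]) (auto simp: P_def)
  moreover have "(\<Sum>\<chi>\<in>P. ?f \<chi>) = (\<Sum>\<chi>\<in>P. of_nat (card X) * of_nat (card Y) * of_nat (card Z))"
    by (intro sum.cong refl) (simp add: hatP XYZ)
  then have "(\<Sum>\<chi>\<in>P. ?f \<chi>) = complex_of_real (card P * (card X * card Y * card Z))" by simp
  ultimately have "complex_of_real (card P * (card X * card Y * card Z)) = - (\<Sum>\<chi>\<in>chars V - P. ?f \<chi>)"
    by (metis add_eq_0_iff)
  then have "norm (complex_of_real (card P * (card X * card Y * card Z))) = norm (\<Sum>\<chi>\<in>chars V - P. ?f \<chi>)"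
    by (metis norm_minus_cancel)
  then have "card P * (card X * card Y * card Z) = norm (\<Sum>\<chi>\<in>chars V - P. ?f \<chi>)"
    by (simp only: norm_of_real)
  also have "\<dots> \<le> (\<Sum>\<chi>\<in>chars V - P. M * (((norm (hat Y \<chi>))\<^sup>2 + (norm (hat Z \<chi>))\<^sup>2) / 2))"
  proof (intro order_trans[OF norm_sum] sum_mono)
    fix \<chi> assume \<chi>: "\<chi> \<in> chars V - P"
    have "norm (?f \<chi>) = norm (hat X \<chi>) * (norm (hat Y \<chi>) * norm (hat Z \<chi>))" by (simp add: norm_mult)
    also have "\<dots> \<le> M * (norm (hat Y \<chi>) * norm (hat Z \<chi>))"
      using small[OF \<chi>] by (intro mult_right_mono) auto
    also have "norm (hat Y \<chi>) * norm (hat Z \<chi>) \<le> ((norm (hat Y \<chi>))\<^sup>2 + (norm (hat Z \<chi>))\<^sup>2) / 2"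
      using zero_le_power2[of "norm (hat Y \<chi>) - norm (hat Z \<chi>)"] by (simp add: power2_diff)
    finally show "norm (?f \<chi>) \<le> M * (((norm (hat Y \<chi>))\<^sup>2 + (norm (hat Z \<chi>))\<^sup>2) / 2)"
      using M0 by (simp add: mult_left_mono)
  qed
  also have "\<dots> \<le> (\<Sum>\<chi>\<in>chars V. M * (((norm (hat Y \<chi>))\<^sup>2 + (norm (hat Z \<chi>))\<^sup>2) / 2))"
    using M0 by (intro sum_mono2) auto
  also have "\<dots> = M * ((card (chars V) * card Y + card (chars V) * card Z) / 2)"
    by (simp only: sum_distrib_left[symmetric] sum_divide_distrib[symmetric] sum.distrib Parseval[OF XV(2)] Parseval[OF XV(3)] of_nat_add of_nat_mult)
  also have "\<dots> = M * ((card P * card H * card Y + card P * card H * card Z) / 2)"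
    using card_chars_sub[OF H] unfolding P_def by simp
  finally have "card P * (real (card X) * card Y * card Z) \<le> card P * (M * card H * ((card Y + card Z) / 2))"
    by (simp add: algebra_simps)
  moreover have "0 < card P * card H"
    unfolding P_def card_chars_sub[OF H] card_chars by (rule subgrp_card_pos[OF subgrp_V])
  then have "0 < real (card P)" by simp
  ultimately have 1: "real (card X) * card Y * card Z \<le> M * card H * ((card Y + card Z) / 2)" by simp
  define a b c h where "a = real (card X)" and "b = real (card Y)" and "c = real (card Z)" and "h = real (card H)"
  have h: "0 < h" "d * h \<le> a" "d * h \<le> b" "d * h \<le> c" using H0 big by (auto simp: a_def b_def c_def h_def)
  have le: "a * b * c \<le> d\<^sup>2 / 2 * h * h * ((b + c) / 2)" using 1 by (simp add: a_def b_def c_def h_def M_def)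
  have dh: "0 < d * h" using d h by simp
  then have pos: "0 < a" "0 < b" "0 < c" using h by linarith+
  have "(d * h) * (b + c) / 2 \<le> b * c"
  proof -
    have "d * h * b \<le> c * b" "d * h * c \<le> b * c" using h pos by (auto intro: mult_right_mono)
    then show ?thesis by (simp add: algebra_simps)
  qed
  then have "(d * h) * ((d * h) * (b + c) / 2) \<le> a * (b * c)"
    using h dh pos by (intro mult_mono) auto
  also have "\<dots> \<le> d\<^sup>2 / 2 * h * h * ((b + c) / 2)" using le by (simp add: mult.assoc)
  finally have "d\<^sup>2 * h\<^sup>2 * (b + c) \<le> 0" by (simp add: power2_eq_square algebra_simps)
  moreover have "0 < d\<^sup>2 * h\<^sup>2 * (b + c)" using d h pos by simp
  ultimately show False by linarith
qed


section \<open>Coset averages and energy increment\<close>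

lemma sum_V_translate: "y \<in> V \<Longrightarrow> (\<Sum>x\<in>V. f (x + y)) = (\<Sum>x\<in>V. f x)"
  using sum_translate_sub[OF subgrp_V] .

lemma avg_invariant:
  assumes "subgrp H" "h \<in> H"
  shows "avg H g (v + h) = avg H g v"
  using sum_translate_sub[OF assms, of "\<lambda>x. g (v + x)"] by (simp add: avg_def add.assoc add.commute[of h])

text \<open>Translating the sum by \<open>h\<close> moves the average from \<open>g\<close> to
  \<open>k\<close>, which is invariant. The group \<open>W\<close> is all of \<open>V\<close> in
  energy computations and a single coset group when one non-uniform coset is studied.\<close>

lemma sum_avg_mult:
  assumes H: "subgrp H" and W: "subgrp W" "H \<subseteq> W" and k: "\<And>v h. v \<in> W \<Longrightarrow> h \<in> H \<Longrightarrow> k (v + h) = k v"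
  shows "(\<Sum>v\<in>W. of_real (avg H g v) * k v) = (\<Sum>v\<in>W. of_real (g v) * k v :: 'c::real_normed_field)"
proof -
  have h0: "(of_nat (card H) :: 'c) \<noteq> 0" using subgrp_card_pos[OF H] by simp
  have "of_nat (card H) * (\<Sum>v\<in>W. of_real (avg H g v) * k v) = (\<Sum>v\<in>W. \<Sum>h\<in>H. of_real (g (v + h)) * k v)"
    unfolding sum_distrib_left
  proof (rule sum.cong[OF refl])
    fix v
    have "(of_nat (card H) :: 'c) * of_real (avg H g v) = (\<Sum>h\<in>H. of_real (g (v + h)))"
      using h0 by (simp add: avg_def)
    then show "of_nat (card H) * (of_real (avg H g v) * k v) = (\<Sum>h\<in>H. of_real (g (v + h)) * k v)"
      by (simp add: mult.assoc[symmetric] sum_distrib_right)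
  qed
  also have "\<dots> = (\<Sum>h\<in>H. \<Sum>v\<in>W. of_real (g (v + h)) * k v)" by (rule sum.swap)
  also have "\<dots> = (\<Sum>h\<in>H. \<Sum>v\<in>W. of_real (g (v + h)) * k (v + h))"
    by (intro sum.cong refl) (simp add: k)
  also have "\<dots> = (\<Sum>h\<in>H. \<Sum>v\<in>W. of_real (g v) * k v)"
    using W by (intro sum.cong refl sum_translate_sub[where f = "\<lambda>v. of_real (g v) * k v"]) auto
  finally have "of_nat (card H) * (\<Sum>v\<in>W. of_real (avg H g v) * k v) = of_nat (card H) * (\<Sum>v\<in>W. of_real (g v) * k v)"
    by simp
  then show ?thesis using h0 by simp
qed

lemma sum_avg_mult_real:
  assumes "subgrp H" "\<And>v h. v \<in> V \<Longrightarrow> h \<in> H \<Longrightarrow> k (v + h) = k v"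
  shows "(\<Sum>v\<in>V. avg H g v * k v) = (\<Sum>v\<in>V. g v * (k v :: real))"
proof -
  have "H \<subseteq> V" using assms(1) by (simp add: subgrp_def)
  from sum_avg_mult[OF assms(1) subgrp_V this assms(2), of g] show ?thesis by simp
qed

text \<open>Both averages have the same inner product with the coarser one, namely that of
  \<open>g\<close>, so their difference is orthogonal to it.\<close>

lemma energy_Pythagoras:
  assumes H: "subgrp H" and K: "subgrp K" "K \<subseteq> H"
  shows "(\<Sum>v\<in>V. (avg K g v)\<^sup>2) = (\<Sum>v\<in>V. (avg H g v)\<^sup>2) + (\<Sum>v\<in>V. (avg K g v - avg H g v)\<^sup>2)"
proof -
  have inv: "avg H g (v + h) = avg H g v" if "h \<in> K" for v h
    using avg_invariant[OF H] K that by blast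
  have "(\<Sum>v\<in>V. avg K g v * avg H g v) = (\<Sum>v\<in>V. g v * avg H g v)"
    by (rule sum_avg_mult_real[OF K(1)]) (rule inv)
  moreover have "(\<Sum>v\<in>V. avg H g v * avg H g v) = (\<Sum>v\<in>V. g v * avg H g v)"
    by (rule sum_avg_mult_real[OF H]) (rule avg_invariant[OF H])
  ultimately show ?thesis
    by (simp add: power2_eq_square algebra_simps sum.distrib sum_subtractf sum_distrib_left[symmetric])
qed

lemma subgrp_ker: "C \<subseteq> chars V \<Longrightarrow> subgrp (ker V C)"
  unfolding subgrp_def ker_def by (auto simp: char_0 char_add subset_iff)

definition ind :: "('a \<times> 'b) set \<Rightarrow> 'b \<Rightarrow> 'a \<Rightarrow> real" where
  "ind S j v = (if (v, j) \<in> S then 1 else 0)"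

lemma avg_ind: "finite H \<Longrightarrow> avg H (ind S j) v = card (cell_trace S H v j) / card H"
  by (simp add: avg_def ind_def cell_trace_def sum.inter_filter[symmetric])

text \<open>Moving the base point within its coset multiplies the character sum by
  \<open>\<chi> h\<close>, of norm 1. Non-uniformity is therefore a property of the cell.\<close>

lemma nonunif_translate:
  assumes H: "subgrp H" and h: "h \<in> H" and v: "v \<in> V" and nu: "nonunif \<eta> V S H v j \<chi>"
  shows "nonunif \<eta> V S H (v + h) j \<chi>"
proof -
  have \<chi>: "\<chi> \<in> chars V" using nu by (simp add: nonunif_def)
  have "(\<Sum>x\<in>cell_trace S H v j. \<chi> x) = (\<Sum>x\<in>cell_trace S H (v + h) j. \<chi> (x + h))"
    by (rule sum.reindex_bij_witness[of _ "\<lambda>x. x + h" "\<lambda>x. x - h"])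
      (use H h in \<open>auto simp: cell_trace_def subgrp_add subgrp_diff algebra_simps\<close>)
  also have "\<dots> = \<chi> h * (\<Sum>x\<in>cell_trace S H (v + h) j. \<chi> x)"
    unfolding sum_distrib_left using subgrp_memD[OF H] h \<chi>
    by (intro sum.cong refl) (auto simp: char_add cell_trace_def)
  finally have "norm (\<Sum>x\<in>cell_trace S H v j. \<chi> x) = norm (\<Sum>x\<in>cell_trace S H (v + h) j. \<chi> x)"
    using char_norm[OF \<chi>] by (simp add: norm_mult)
  then show ?thesis using nu by (simp add: nonunif_def)
qed

text \<open>Since \<open>\<chi>\<close> is trivial on \<open>K\<close>, its coefficient does not
  change when \<open>S\<close> is averaged over \<open>K\<close>; since \<open>\<chi>\<close> is not
  trivial on \<open>H\<close>, the constant average over \<open>H\<close> may be subtracted. This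
  bounds the L1 distance of the two averages from below, and the inequality 2\<eta>|D| - \<eta>^2 <=
  D^2 turns that into an L2 bound.\<close>

lemma nonunif_increment:
  assumes H: "subgrp H" and K: "subgrp K" "K \<subseteq> H" and v: "v \<in> V" and \<eta>: "0 \<le> \<eta>"
    and nu: "nonunif \<eta> V S H v j \<chi>" and \<chi>K: "\<And>x. x \<in> K \<Longrightarrow> \<chi> x = 1"
  shows "\<eta>\<^sup>2 * card H \<le> (\<Sum>h\<in>H. (avg K (ind S j) (v + h) - avg H (ind S j) (v + h))\<^sup>2)"
proof -
  let ?g = "ind S j"
  let ?D = "\<lambda>h. avg K ?g (v + h) - avg H ?g (v + h)"
  have \<chi>: "\<chi> \<in> chars V" using nu by (simp add: nonunif_def)
  have nontriv: "\<not> (\<forall>h\<in>H. \<chi> h = 1)" using nu by (auto simp: nonunif_def)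
  have shift: "avg K ?g (v + h) = avg K (\<lambda>x. ?g (v + x)) h" for h by (simp add: avg_def add.assoc)
  have "(\<Sum>h\<in>cell_trace S H v j. \<chi> h) = (\<Sum>h\<in>H. of_real (?g (v + h)) * \<chi> h)"
    unfolding cell_trace_def using subgrp_finite[OF H] by (auto simp: sum.inter_filter ind_def intro!: sum.cong)
  also have "\<dots> = (\<Sum>h\<in>H. of_real (avg K (\<lambda>x. ?g (v + x)) h) * \<chi> h)"
  proof (rule sum_avg_mult[OF K(1) H K(2), symmetric])
    fix x k assume "x \<in> H" "k \<in> K"
    then show "\<chi> (x + k) = \<chi> x" using \<chi> \<chi>K subgrp_memD[OF H] subgrp_memD[OF K(1)] by (simp add: char_add)
  qed
  also have "\<dots> = (\<Sum>h\<in>H. of_real (?D h) * \<chi> h) + (\<Sum>h\<in>H. of_real (avg H ?g (v + h)) * \<chi> h)"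
  proof -
    have "complex_of_real (avg K (\<lambda>x. ?g (v + x)) h) * \<chi> h
        = of_real (?D h) * \<chi> h + of_real (avg H ?g (v + h)) * \<chi> h" for h
      unfolding distrib_right[symmetric] of_real_add[symmetric] by (simp add: shift)
    then show ?thesis by (simp only: sum.distrib)
  qed
  also have "(\<Sum>h\<in>H. of_real (avg H ?g (v + h)) * \<chi> h) = of_real (avg H ?g v) * (\<Sum>h\<in>H. \<chi> h)"
    unfolding sum_distrib_left by (intro sum.cong refl) (simp add: avg_invariant[OF H])
  also have "(\<Sum>h\<in>H. \<chi> h) = 0" using sum_char_sub[OF H \<chi>] nontriv by simp
  finally have "norm (\<Sum>h\<in>cell_trace S H v j. \<chi> h) = norm (\<Sum>h\<in>H. of_real (?D h) * \<chi> h)" by simp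
  also have "\<dots> \<le> (\<Sum>h\<in>H. \<bar>?D h\<bar>)"
    by (rule order_trans[OF norm_sum]) (simp only: norm_mult norm_of_real char_norm[OF \<chi>] mult_1_right order_refl)
  finally have 1: "\<eta> * card H \<le> (\<Sum>h\<in>H. \<bar>?D h\<bar>)" using nu by (simp add: nonunif_def)
  have "(\<Sum>h\<in>H. 2 * \<eta> * \<bar>?D h\<bar> - \<eta>\<^sup>2) \<le> (\<Sum>h\<in>H. (?D h)\<^sup>2)"
  proof (rule sum_mono)
    fix h
    show "2 * \<eta> * \<bar>?D h\<bar> - \<eta>\<^sup>2 \<le> (?D h)\<^sup>2"
      using zero_le_power2[of "\<bar>?D h\<bar> - \<eta>"] by (simp add: power2_diff algebra_simps)
  qed
  moreover have "(\<Sum>h\<in>H. 2 * \<eta> * \<bar>?D h\<bar> - \<eta>\<^sup>2) = 2 * \<eta> * (\<Sum>h\<in>H. \<bar>?D h\<bar>) - \<eta>\<^sup>2 * card H"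
    by (simp add: sum_subtractf sum_distrib_left)
  moreover have "2 * \<eta> * (\<eta> * card H) \<le> 2 * \<eta> * (\<Sum>h\<in>H. \<bar>?D h\<bar>)"
    using 1 \<eta> by (intro mult_left_mono) auto
  ultimately show ?thesis by (simp add: power2_eq_square algebra_simps)
qed

definition energy :: "('a \<times> 'b::finite) set \<Rightarrow> 'a set \<Rightarrow> real" where
  "energy S H = (\<Sum>j\<in>UNIV. \<Sum>v\<in>V. (avg H (ind S j) v)\<^sup>2)"

definition bad_set :: "real \<Rightarrow> ('a \<times> 'b) set \<Rightarrow> 'a set \<Rightarrow> ('a \<times> 'b) set" where
  "bad_set \<eta> S H = {(v, j). v \<in> V \<and> (\<exists>\<chi>. nonunif \<eta> V S H v j \<chi>)}"

lemma energy_le: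
  fixes S :: "('a \<times> 'b::finite) set"
  assumes "subgrp H"
  shows "energy S H \<le> CARD('b) * card V"
proof -
  have "(avg H (ind S j) v)\<^sup>2 \<le> 1" for j v
  proof -
    have "card (cell_trace S H v j) \<le> card H" using subgrp_finite[OF assms] by (intro card_mono) (auto simp: cell_trace_def)
    then have "avg H (ind S j) v \<le> 1" "0 \<le> avg H (ind S j) v"
      using subgrp_finite[OF assms] subgrp_card_pos[OF assms] by (auto simp: avg_ind divide_le_eq)
    then show ?thesis by (simp add: power_le_one)
  qed
  then have "energy S H \<le> (\<Sum>j\<in>(UNIV::'b set). \<Sum>v\<in>V. 1)" unfolding energy_def by (intro sum_mono)
  then show ?thesis by simp
qed

lemma diff_in_ker:
  assumes C: "C \<subseteq> chars V" and v: "v \<in> V" "w \<in> V" and eq: "\<And>\<chi>. \<chi> \<in> C \<Longrightarrow> \<chi> v = \<chi> w"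
  shows "v - w \<in> ker V C"
proof -
  have "\<chi> (v - w) = 1" if "\<chi> \<in> C" for \<chi>
  proof -
    have "\<chi> w * cnj (\<chi> w) = 1"
      using char_norm[of \<chi> w] that C by (auto simp: complex_norm_square[symmetric])
    moreover have "\<chi> \<in> chars V" using that C by blast
    ultimately show ?thesis using v eq[OF that] by (simp add: char_diff)
  qed
  then show ?thesis using v by (simp add: ker_def)
qed

text \<open>One witness is chosen per non-uniform cell, not per point, and all witnesses are
  adjoined to \<open>C\<close>. The number of new characters then depends only on the number of
  cells.\<close>

lemma energy_increment:
  fixes S :: "('a \<times> 'b::finite) set"
  assumes C: "C \<subseteq> chars V" "card C \<le> L" and \<eta>: "0 \<le> \<eta>"
  shows "\<exists>C'\<subseteq>chars V. card C' \<le> L + CARD('b) * 3 ^ L \<and>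
    energy S (ker V C) + \<eta>\<^sup>2 * card (bad_set \<eta> S (ker V C)) \<le> energy S (ker V C')"
proof -
  let ?H = "ker V C"
  have H: "subgrp ?H" using subgrp_ker[OF C(1)] .
  \<comment> \<open>The label of the coset of \<open>?H\<close> that contains
    \<open>v\<close>.\<close>
  define \<kappa> where "\<kappa> v = restrict (\<lambda>\<chi>. \<chi> v) C" for v :: 'a
  define I where "I = (\<lambda>(v, j). (\<kappa> v, j)) ` bad_set \<eta> S ?H"
  have finC: "finite C" using C finite_subset finite_chars by blast
  have "\<exists>\<xi>. \<exists>v. \<kappa> v = fst p \<and> v \<in> V \<and> nonunif \<eta> V S ?H v (snd p) \<xi>" if "p \<in> I" for p
    using that by (fastforce simp: I_def bad_set_def)
  then obtain \<xi> where \<xi>: "\<exists>v. \<kappa> v = fst p \<and> v \<in> V \<and> nonunif \<eta> V S ?H v (snd p) (\<xi> p)" if "p \<in> I" for p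
    by metis
  define C' where "C' = C \<union> \<xi> ` I"
  have C'V: "C' \<subseteq> chars V" using C \<xi> by (fastforce simp: C'_def nonunif_def)
  have "I \<subseteq> (C \<rightarrow>\<^sub>E {z. z ^ 3 = 1}) \<times> UNIV"
    using C(1) char_cube by (fastforce simp: I_def \<kappa>_def)
  moreover have "finite ((C \<rightarrow>\<^sub>E {z::complex. z ^ 3 = 1}) \<times> (UNIV::'b set))"
    using finC finite_roots by (intro finite_cartesian_product finite_PiE) auto
  ultimately have finI: "finite I" and "card I \<le> card ((C \<rightarrow>\<^sub>E {z::complex. z ^ 3 = 1}) \<times> (UNIV::'b set))"
    by (auto intro: finite_subset card_mono)
  then have "card I \<le> 3 ^ card C * CARD('b)"
    using finC by (simp add: card_PiE card_cartesian_product card_roots_unity_eq)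
  also have "\<dots> \<le> 3 ^ L * CARD('b)" using C by (simp add: power_increasing)
  finally have cI: "card I \<le> CARD('b) * 3 ^ L" by (simp add: mult.commute)
  have "card C' \<le> card C + card (\<xi> ` I)" unfolding C'_def by (rule card_Un_le)
  also have "card (\<xi> ` I) \<le> card I" using finI by (rule card_image_le)
  finally have cC': "card C' \<le> L + CARD('b) * 3 ^ L" using cI C by linarith
  let ?K = "ker V C'"
  have K: "subgrp ?K" using subgrp_ker[OF C'V] .
  have KH: "?K \<subseteq> ?H" by (auto simp: ker_def C'_def)
  let ?D = "\<lambda>j v. (avg ?K (ind S j) v - avg ?H (ind S j) v)\<^sup>2"
  have inc: "\<eta>\<^sup>2 * card ?H \<le> (\<Sum>h\<in>?H. ?D j (v + h))" if "(v, j) \<in> bad_set \<eta> S ?H" for v j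
  proof -
    have v: "v \<in> V" using that by (auto simp: bad_set_def)
    have p: "(\<kappa> v, j) \<in> I" using that by (force simp: I_def)
    then obtain w where w: "\<kappa> w = \<kappa> v" "w \<in> V" "nonunif \<eta> V S ?H w j (\<xi> (\<kappa> v, j))"
      using \<xi>[OF p] by auto
    have "\<chi> v = \<chi> w" if "\<chi> \<in> C" for \<chi> using fun_cong[OF w(1), of \<chi>] that by (simp add: \<kappa>_def)
    then have "v - w \<in> ?H" using diff_in_ker[OF C(1) v w(2)] by blast
    then have "nonunif \<eta> V S ?H (w + (v - w)) j (\<xi> (\<kappa> v, j))"
      using w by (intro nonunif_translate[OF H])
    then have "nonunif \<eta> V S ?H v j (\<xi> (\<kappa> v, j))" by simp
    then show ?thesis
      by (rule nonunif_increment[OF H K KH v \<eta>]) (use p in \<open>auto simp: ker_def C'_def\<close>)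
  qed
  have Hpos: "0 < real (card ?H)" using subgrp_card_pos[OF H] by simp
  have fb: "bad_set \<eta> S ?H \<subseteq> V \<times> UNIV" by (auto simp: bad_set_def)
  \<comment> \<open>Every cell is summed once for each of its base points, which produces the common
    factor \<open>card ?H\<close>.\<close>
  have "(\<eta>\<^sup>2 * card (bad_set \<eta> S ?H)) * card ?H = (\<Sum>p\<in>bad_set \<eta> S ?H. \<eta>\<^sup>2 * card ?H)" by simp
  also have "\<dots> \<le> (\<Sum>(v, j)\<in>bad_set \<eta> S ?H. \<Sum>h\<in>?H. ?D j (v + h))"
    using inc by (intro sum_mono) auto
  also have "\<dots> \<le> (\<Sum>(v, j)\<in>V \<times> UNIV. \<Sum>h\<in>?H. ?D j (v + h))"
    using fb by (intro sum_mono2) (auto intro!: sum_nonneg)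
  also have "\<dots> = (\<Sum>j\<in>UNIV. \<Sum>v\<in>V. \<Sum>h\<in>?H. ?D j (v + h))"
    by (simp add: sum.cartesian_product[symmetric]) (rule sum.swap)
  also have "\<dots> = (\<Sum>j\<in>UNIV. \<Sum>h\<in>?H. \<Sum>v\<in>V. ?D j (v + h))"
    by (intro sum.cong refl sum.swap)
  also have "\<dots> = (\<Sum>j\<in>UNIV. \<Sum>h\<in>?H. \<Sum>v\<in>V. ?D j v)"
    by (intro sum.cong refl sum_V_translate) (use subgrp_memD[OF H] in auto)
  also have "\<dots> = (\<Sum>j\<in>UNIV. \<Sum>v\<in>V. ?D j v) * card ?H"
    by (simp add: sum_distrib_left[symmetric] mult.commute)
  finally have "\<eta>\<^sup>2 * card (bad_set \<eta> S ?H) \<le> (\<Sum>j\<in>UNIV. \<Sum>v\<in>V. ?D j v)" using Hpos by simp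
  moreover have "energy S ?K = energy S ?H + (\<Sum>j\<in>UNIV. \<Sum>v\<in>V. ?D j v)"
    unfolding energy_def by (subst energy_Pythagoras[OF H K KH]) (simp add: sum.distrib)
  ultimately show ?thesis using C'V cC' by (intro exI[of _ C']) auto
qed

text \<open>Otherwise \<open>N\<close> successive refinements would each raise the energy by
  \<eta>^2 \<epsilon> \<open>card V\<close>, beyond its trivial maximum.\<close>

lemma few_bad:
  fixes S :: "('a \<times> 'b::finite) set" and \<epsilon> :: real
  assumes \<epsilon>: "0 < \<epsilon>" and \<eta>: "0 \<le> \<eta>" and N: "real CARD('b) < N * (\<eta>\<^sup>2 * \<epsilon>)"
  shows "\<exists>C\<subseteq>chars V. card C \<le> char_bound CARD('b) N \<and> card (bad_set \<eta> S (ker V C)) \<le> \<epsilon> * card V"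
proof (rule ccontr)
  assume contra: "\<not> ?thesis"
  have V0: "0 < real (card V)" using subgrp_card_pos[OF subgrp_V] by simp
  have "\<exists>C\<subseteq>chars V. card C \<le> char_bound CARD('b) i \<and> i * (\<eta>\<^sup>2 * \<epsilon> * card V) \<le> energy S (ker V C)"
    if "i \<le> N" for i
    using that
  proof (induction i)
    case 0
    then show ?case by (intro exI[of _ "{}"]) (simp add: energy_def sum_nonneg)
  next
    case (Suc i)
    then obtain C where C: "C \<subseteq> chars V" "card C \<le> char_bound CARD('b) i"
        "i * (\<eta>\<^sup>2 * \<epsilon> * card V) \<le> energy S (ker V C)" by auto
    have "char_bound p i \<le> char_bound p N" for p
      by (rule lift_Suc_mono_le[of "char_bound p"]) (use Suc in auto)
    then have "\<not> card (bad_set \<eta> S (ker V C)) \<le> \<epsilon> * card V" using C contra by (meson le_trans)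
    then have "\<eta>\<^sup>2 * (\<epsilon> * card V) \<le> \<eta>\<^sup>2 * card (bad_set \<eta> S (ker V C))" by (intro mult_left_mono) auto
    moreover obtain C' where "C' \<subseteq> chars V" "card C' \<le> char_bound CARD('b) (Suc i)"
        "energy S (ker V C) + \<eta>\<^sup>2 * card (bad_set \<eta> S (ker V C)) \<le> energy S (ker V C')"
      using energy_increment[OF C(1,2) \<eta>, of S] by auto
    ultimately show ?case using C by (intro exI[of _ C']) (auto simp: algebra_simps)
  qed
  then obtain C where C: "C \<subseteq> chars V" "N * (\<eta>\<^sup>2 * \<epsilon> * card V) \<le> energy S (ker V C)" by blast
  have "energy S (ker V C) \<le> CARD('b) * card V" using energy_le[OF subgrp_ker[OF C(1)]] by simp
  then have "N * (\<eta>\<^sup>2 * \<epsilon>) * card V \<le> CARD('b) * card V" using C by (simp add: mult.assoc)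
  then show False using V0 N by simp
qed


section \<open>Sum-free containers that are unions of cells\<close>

definition cellwise :: "('a \<Rightarrow> complex) set \<Rightarrow> ('a \<times> 'b) set \<Rightarrow> bool" where
  "cellwise C A \<longleftrightarrow> (\<forall>v\<in>V. \<forall>w\<in>V. \<forall>j. (\<forall>\<chi>\<in>C. \<chi> v = \<chi> w) \<longrightarrow> ((v, j) \<in> A \<longleftrightarrow> (w, j) \<in> A))"

text \<open>The indicator \<open>k\<close> of the sparse cells is \<open>H\<close>-invariant, so it
  may be summed against the coset densities in place of \<open>S\<close>; these are below
  \<open>d\<close> wherever \<open>k\<close> does not vanish.\<close>

lemma card_sparse:
  fixes S :: "('a \<times> 'b::finite) set" and d :: real
  assumes H: "subgrp H" and d: "0 \<le> d" and S: "S \<subseteq> V \<times> UNIV"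
  shows "card {(v, j) \<in> S. card (cell_trace S H v j) < d * card H} \<le> d * CARD('b) * card V"
proof -
  have Hpos: "0 < real (card H)" using subgrp_card_pos[OF H] by simp
  define k where "k j v = (if avg H (ind S j) v < d then 1 else 0 :: real)" for j v
  have kfib: "card (cell_trace S H v j) < d * card H \<longleftrightarrow> avg H (ind S j) v < d" for v j
    using Hpos subgrp_finite[OF H] by (simp add: avg_ind divide_less_eq)
  have "{(v, j) \<in> S. card (cell_trace S H v j) < d * card H} = {p \<in> V \<times> UNIV. ind S (snd p) (fst p) * k (snd p) (fst p) = 1}"
    using S unfolding kfib by (auto simp: ind_def k_def)
  moreover have "real (card \<dots>) = (\<Sum>p\<in>V \<times> UNIV. ind S (snd p) (fst p) * k (snd p) (fst p))"
  proof -
    have "(\<Sum>p\<in>V \<times> UNIV. ind S (snd p) (fst p) * k (snd p) (fst p))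
        = (\<Sum>p\<in>V \<times> UNIV. if ind S (snd p) (fst p) * k (snd p) (fst p) = 1 then 1 else 0)"
      by (intro sum.cong refl) (auto simp: ind_def k_def)
    then show ?thesis by (simp add: sum.inter_filter[symmetric])
  qed
  moreover have "\<dots> = (\<Sum>v\<in>V. \<Sum>j\<in>UNIV. ind S j v * k j v)"
    by (simp add: sum.cartesian_product case_prod_beta)
  moreover have "\<dots> = (\<Sum>j\<in>UNIV. \<Sum>v\<in>V. ind S j v * k j v)" by (rule sum.swap)
  moreover have "\<dots> = (\<Sum>j\<in>UNIV. \<Sum>v\<in>V. avg H (ind S j) v * k j v)"
    by (intro sum.cong refl sum_avg_mult_real[OF H, symmetric]) (simp add: k_def avg_invariant[OF H])
  moreover have "\<dots> \<le> (\<Sum>j\<in>(UNIV::'b set). \<Sum>v\<in>V. d)"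
    using d by (intro sum_mono) (auto simp: k_def)
  ultimately show ?thesis by (simp add: mult_ac)
qed

text \<open>\<open>A\<close> consists of the cells that are dense and uniform for \<open>S\<close>.
  Three such cells forming a Schur triple would contain a Schur triple of \<open>S\<close>, as
  otherwise \<open>large_coefficient\<close> makes the first cell non-uniform; this fixes the
  threshold \<open>d\<^sup>2 / 2\<close>. The points of \<open>S\<close> lost lie in non-uniform or
  in sparse cells, with \<epsilon>/2 for each kind.\<close>

lemma sumfree_container:
  fixes S :: "('a \<times> 'b::{finite,ab_group_add}) set" and \<epsilon> d :: real
  assumes S: "S \<subseteq> V \<times> UNIV" "sumfree S" and \<epsilon>: "0 < \<epsilon>" and d: "d = \<epsilon> / (2 * CARD('b))"
    and N: "real CARD('b) < N * ((d\<^sup>2 / 2)\<^sup>2 * (\<epsilon> / 2))"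
  shows "\<exists>C\<subseteq>chars V. card C \<le> char_bound CARD('b) N \<and>
    (\<exists>A\<subseteq>V \<times> UNIV. cellwise C A \<and> sumfree A \<and> card (S - A) \<le> \<epsilon> * card V)"
proof -
  let ?\<eta> = "d\<^sup>2 / 2"
  obtain C where C: "C \<subseteq> chars V" "card C \<le> char_bound CARD('b) N"
      "card (bad_set ?\<eta> S (ker V C)) \<le> \<epsilon> / 2 * card V"
    using few_bad[of "\<epsilon> / 2" ?\<eta> N S] \<epsilon> N by auto
  let ?H = "ker V C"
  have H: "subgrp ?H" using subgrp_ker[OF C(1)] .
  have d0: "0 < d" using d \<epsilon> by simp
  define A where "A = {(v, j). v \<in> V \<and> d * card ?H \<le> card (cell_trace S ?H v j) \<and> (v, j) \<notin> bad_set ?\<eta> S ?H}"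
  have fibH: "cell_trace S ?H v j \<subseteq> ?H" for v j by (auto simp: cell_trace_def)
  have "sumfree A"
    unfolding sumfree_def
  proof (intro ballI notI)
    fix p q assume p: "p \<in> A" and q: "q \<in> A" and pq: "p + q \<in> A"
    obtain v i w j where vw: "p = (v, i)" "q = (w, j)" by (cases p, cases q)
    have "\<exists>\<chi>\<in>chars V. (\<exists>h\<in>?H. \<chi> h \<noteq> 1) \<and> d\<^sup>2 / 2 * card ?H \<le> norm (hat (cell_trace S ?H v i) \<chi>)"
    proof (rule large_coefficient[OF H fibH fibH fibH d0])
      show "x + y \<notin> cell_trace S ?H (v + w) (i + j)" if "x \<in> cell_trace S ?H v i" "y \<in> cell_trace S ?H w j" for x y
      proof
        assume "x + y \<in> cell_trace S ?H (v + w) (i + j)"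
        then have "(v + x, i) + (w + y, j) \<in> S" by (simp add: cell_trace_def ac_simps)
        moreover have "(v + x, i) \<in> S" "(w + y, j) \<in> S" using that by (auto simp: cell_trace_def)
        ultimately show False using S(2) unfolding sumfree_def by blast
      qed
    qed (use p q pq vw in \<open>auto simp: A_def\<close>)
    then have "(v, i) \<in> bad_set ?\<eta> S ?H"
      using p vw by (auto simp: bad_set_def nonunif_def hat_def A_def)
    then show False using p vw by (simp add: A_def)
  qed
  moreover have "cellwise C A"
  proof -
    have imp: "(w, j) \<in> A" if "v \<in> V" "w \<in> V" "\<And>\<chi>. \<chi> \<in> C \<Longrightarrow> \<chi> v = \<chi> w" "(v, j) \<in> A" for v w j
    proof -
      have h: "w - v \<in> ?H" "v - w \<in> ?H" using that diff_in_ker[OF C(1)] by metis+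
      have "avg ?H (ind S j) (v + (w - v)) = avg ?H (ind S j) v" by (rule avg_invariant[OF H h(1)])
      then have "card (cell_trace S ?H w j) = card (cell_trace S ?H v j)"
        using H subgrp_finite[OF H] by (auto simp: avg_ind subgrp_def)
      moreover have "nonunif ?\<eta> V S ?H (w + (v - w)) j \<chi>" if "nonunif ?\<eta> V S ?H w j \<chi>" for \<chi>
        by (rule nonunif_translate[OF H h(2) \<open>w \<in> V\<close> that])
      ultimately show ?thesis using that by (auto simp: A_def bad_set_def)
    qed
    show ?thesis unfolding cellwise_def
    proof (intro ballI allI impI iffI)
      fix v w j assume vw: "v \<in> V" "w \<in> V" "\<forall>\<chi>\<in>C. \<chi> v = \<chi> w"
      show "(w, j) \<in> A" if "(v, j) \<in> A" by (rule imp[OF vw(1,2) _ that]) (use vw in auto)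
      show "(v, j) \<in> A" if "(w, j) \<in> A" by (rule imp[OF vw(2,1) _ that]) (use vw in auto)
    qed
  qed
  moreover have "card (S - A) \<le> \<epsilon> * card V"
  proof -
    have finV: "finite (V \<times> (UNIV::'b set))" by simp
    have "bad_set ?\<eta> S ?H \<subseteq> V \<times> UNIV" by (auto simp: bad_set_def)
    then have fin: "finite (bad_set ?\<eta> S ?H)" "finite S" using finV S(1) finite_subset by blast+
    have "S - A \<subseteq> bad_set ?\<eta> S ?H \<union> {(v, j) \<in> S. card (cell_trace S ?H v j) < d * card ?H}"
      using S(1) by (auto simp: A_def)
    then have "card (S - A) \<le> card (bad_set ?\<eta> S ?H \<union> {(v, j) \<in> S. card (cell_trace S ?H v j) < d * card ?H})"
      using fin by (intro card_mono finite_UnI) (auto intro: finite_subset[OF _ fin(2)])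
    also have "\<dots> \<le> card (bad_set ?\<eta> S ?H) + card {(v, j) \<in> S. card (cell_trace S ?H v j) < d * card ?H}"
      by (rule card_Un_le)
    finally have "real (card (S - A)) \<le> \<epsilon> / 2 * card V + d * CARD('b) * card V"
      using C(3) card_sparse[OF H _ S(1), of d] d0 by linarith
    also have "d * CARD('b) = \<epsilon> / 2" by (simp add: d)
    finally show ?thesis by (simp add: algebra_simps)
  qed
  moreover have "A \<subseteq> V \<times> UNIV" by (auto simp: A_def)
  ultimately show ?thesis using C by blast
qed

text \<open>\<open>A\<close> is encoded by a list of L characters and the set of labels of its
  cells. For fixed L the count is polynomial in \<open>card V\<close>, hence negligible against
  exponential bounds.\<close>

lemma card_cellwise:
  shows "finite {A :: ('a \<times> 'b::finite) set. A \<subseteq> V \<times> UNIV \<and> (\<exists>C\<subseteq>chars V. card C \<le> L \<and> cellwise C A)}" (is "finite ?F")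
    and "card {A :: ('a \<times> 'b::finite) set. A \<subseteq> V \<times> UNIV \<and> (\<exists>C\<subseteq>chars V. card C \<le> L \<and> cellwise C A)}
      \<le> card V ^ L * 2 ^ (3 ^ L * CARD('b))"
proof -
  define \<kappa> where "\<kappa> f v = restrict (\<lambda>i. f i v) {..<L}" for f :: "nat \<Rightarrow> 'a \<Rightarrow> complex" and v
  define M where "M = (\<lambda>(f, P). {(v, j). v \<in> V \<and> (\<kappa> f v, j) \<in> (P :: ((nat \<Rightarrow> complex) \<times> 'b) set)})"
  let ?R = "({..<L} \<rightarrow>\<^sub>E {z::complex. z ^ 3 = 1}) \<times> (UNIV :: 'b set)"
  let ?D = "({..<L} \<rightarrow>\<^sub>E chars V) \<times> Pow ?R"
  have finR: "finite ?R" using finite_roots by (intro finite_cartesian_product finite_PiE) auto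
  have finD: "finite ?D" using finR by (intro finite_cartesian_product finite_PiE) auto
  have subgrp: "?F \<subseteq> M ` ?D"
  proof
    fix A assume "A \<in> ?F"
    then obtain C where A: "A \<subseteq> V \<times> UNIV" and C: "C \<subseteq> chars V" "card C \<le> L" "cellwise C A" by auto
    have "finite C" using C finite_subset finite_chars by blast
    then obtain g where g: "C = g ` {..<card C}"
      using ex_bij_betw_nat_finite[of C] by (auto simp: bij_betw_def atLeast0LessThan)
    \<comment> \<open>Fewer than L characters are padded with the trivial one, so that all lists
      have the same length.\<close>
    define f where "f = restrict (\<lambda>i. if i < card C then g i else (\<lambda>x. 1)) {..<L}"
    have gC: "g i \<in> C" if "i < card C" for i using that by (subst g) simp
    then have "g i \<in> chars V" if "i < card C" for i using that C(1) by blast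
    then have f: "f \<in> {..<L} \<rightarrow>\<^sub>E chars V" using one_char by (auto simp: f_def)
    have Cf: "\<exists>i<L. \<chi> = f i" if "\<chi> \<in> C" for \<chi>
    proof -
      have "\<chi> \<in> g ` {..<card C}" using that g by simp
      then obtain i where "i < card C" "\<chi> = g i" by auto
      then show ?thesis using C by (intro exI[of _ i]) (auto simp: f_def)
    qed
    let ?P = "{(\<kappa> f v, j) | v j. (v, j) \<in> A}"
    have "?P \<subseteq> ?R" using f char_cube by (fastforce simp: \<kappa>_def PiE_iff)
    moreover have "A = M (f, ?P)"
    proof (intro equalityI subsetI)
      fix p assume "p \<in> A" then show "p \<in> M (f, ?P)" using A by (cases p) (auto simp: M_def)
    next
      fix p assume "p \<in> M (f, ?P)"
      then obtain v j w where p: "p = (v, j)" "v \<in> V" "(w, j) \<in> A" "\<kappa> f v = \<kappa> f w" by (auto simp: M_def)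
      have "\<chi> w = \<chi> v" if \<chi>: "\<chi> \<in> C" for \<chi>
      proof -
        obtain i where "i < L" "\<chi> = f i" using Cf[OF \<chi>] by blast
        then show ?thesis using fun_cong[OF p(4), of i] by (simp add: \<kappa>_def)
      qed
      moreover have "w \<in> V" using p A by auto
      ultimately show "p \<in> A" using p C(3) unfolding cellwise_def by blast
    qed
    ultimately show "A \<in> M ` ?D" using f by blast
  qed
  then show "finite ?F" by (rule finite_subset) (rule finite_imageI[OF finD])
  have "card ?F \<le> card (M ` ?D)" using subgrp finD by (intro card_mono) auto
  also have "\<dots> \<le> card ?D" using finD by (rule card_image_le)
  also have "\<dots> = card (chars V) ^ L * 2 ^ (card {z::complex. z ^ 3 = 1} ^ L * CARD('b))"
    using finR by (simp add: card_cartesian_product card_PiE card_Pow)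
  also have "\<dots> = card V ^ L * 2 ^ (3 ^ L * CARD('b))"
    by (simp add: card_chars card_roots_unity_eq)
  finally show "card ?F \<le> card V ^ L * 2 ^ (3 ^ L * CARD('b))" .
qed

end

section \<open>Cauchy--Davenport and critical pairs\<close>

definition sumset :: "'b::plus set \<Rightarrow> 'b set \<Rightarrow> 'b set" where
  "sumset A B = {a + b | a b. a \<in> A \<and> b \<in> B}"

lemma sumset_iff: "x \<in> sumset A B \<longleftrightarrow> (\<exists>a\<in>A. \<exists>b\<in>B. x = a + b)"
  by (auto simp: sumset_def)

section \<open>Translates and multiples in a group of prime order\<close>

lemma card_translate: "card ((\<lambda>x. x + d) ` A) = card (A :: 'b::ab_group_add set)"
  by (rule card_image) (auto simp: inj_on_def)

lemma translate_iff: "x \<in> (\<lambda>x. x + d) ` A \<longleftrightarrow> x - d \<in> (A :: 'b::ab_group_add set)"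
  by (auto simp: image_iff intro: bexI[of _ "x - d"])

lemma of_nat_card_eq_0: "of_nat CARD('b) = (0 :: 'b::{finite,comm_ring_1})"
proof -
  have "(\<Sum>x\<in>(UNIV::'b set). x) = (\<Sum>x\<in>(UNIV::'b set). x + 1)"
    by (rule sum.reindex_bij_witness[of _ "\<lambda>x. x + 1" "\<lambda>x. x - 1"]) auto
  then show ?thesis by (simp add: sum.distrib)
qed

lemma of_nat_mult_eq_0_prime_card:
  fixes d :: "'b::{finite,comm_ring_1}"
  assumes p: "prime CARD('b)" and k: "0 < k" "k < CARD('b)" and "of_nat k * d = 0"
  shows "d = 0"
proof -
  have "coprime k CARD('b)"
    using p k by (metis coprime_commute nat_dvd_not_less prime_imp_coprime)
  then obtain x y where "k * x = CARD('b) * y + 1"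
    using k bezout_nat[of k "CARD('b)"] coprime_imp_gcd_eq_1 by (metis not_gr0)
  then have "of_nat (k * x) = (of_nat (CARD('b) * y + 1) :: 'b)" by simp
  then have "of_nat k * of_nat x = (1 :: 'b)" by (simp add: of_nat_card_eq_0)
  then have "d = of_nat x * (of_nat k * d)" by (metis mult.assoc mult.commute mult.left_neutral)
  then show ?thesis using assms by simp
qed

lemma inj_on_of_nat_mult_prime_card:
  fixes d :: "'b::{finite,comm_ring_1}"
  assumes p: "prime CARD('b)" and d: "d \<noteq> 0"
  shows "inj_on (\<lambda>n. of_nat n * d) {..<CARD('b)}"
proof -
  have *: "m = n" if "m \<le> n" "n < CARD('b)" "of_nat m * d = of_nat n * d" for m n
  proof (rule ccontr)
    assume "m \<noteq> n"
    have "of_nat (n - m) * d = 0" using that by (simp add: of_nat_diff algebra_simps)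
    then show False
      using of_nat_mult_eq_0_prime_card[OF p, of "n - m" d] that d \<open>m \<noteq> n\<close>
      by (meson diff_is_0_eq le_antisym less_imp_diff_less not_gr0)
  qed
  show ?thesis
    unfolding inj_on_def by (metis * lessThan_iff nat_le_linear)
qed

lemma of_nat_mult_surj_prime_card:
  fixes d :: "'b::{finite,comm_ring_1}"
  assumes p: "prime CARD('b)" and d: "d \<noteq> 0"
  shows "\<exists>n<CARD('b). x = of_nat n * d"
proof -
  have "(\<lambda>n. of_nat n * d) ` {..<CARD('b)} = UNIV"
    by (rule card_subset_eq) (auto simp: card_image[OF inj_on_of_nat_mult_prime_card[OF p d]])
  then have "x \<in> (\<lambda>n. of_nat n * d) ` {..<CARD('b)}" by simp
  then show ?thesis by auto
qed

lemma translate_neq_prime_card: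
  fixes X :: "'b::{finite,comm_ring_1} set"
  assumes p: "prime CARD('b)" and d: "d \<noteq> 0" and X: "X \<noteq> {}" "X \<noteq> UNIV"
  shows "\<exists>x\<in>X. x + d \<notin> X"
proof (rule ccontr)
  assume "\<not> ?thesis"
  then have step: "x + d \<in> X" if "x \<in> X" for x using that by blast
  obtain x where x: "x \<in> X" using X by blast
  have all: "x + of_nat n * d \<in> X" for n
    using x by (induction n) (auto simp: algebra_simps dest: step)
  have "y \<in> X" for y
  proof -
    obtain n where "y - x = of_nat n * d" using of_nat_mult_surj_prime_card[OF p d] by blast
    then have "y = x + of_nat n * d" by (simp add: algebra_simps)
    then show ?thesis using all by simp
  qed
  then show False using X by blast
qed

text \<open>Dyson's e-transform: what B + e adds to \<open>A\<close> is exactly what is cut from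
  \<open>B\<close>.\<close>

lemma card_e_transform:
  fixes A B :: "'b::{finite,comm_ring_1} set"
  shows "card (A \<union> (\<lambda>x. x + e) ` B) + card {b\<in>B. b + e \<in> A} = card A + card B"
proof -
  have "(\<lambda>x. x + e) ` {b\<in>B. b + e \<in> A} = A \<inter> (\<lambda>x. x + e) ` B" by auto
  then have "card {b\<in>B. b + e \<in> A} = card (A \<inter> (\<lambda>x. x + e) ` B)" by (metis card_translate)
  then show ?thesis using card_Un_Int[of A "(\<lambda>x. x + e) ` B"] by (simp add: card_translate)
qed

lemma sumset_e_transform:
  fixes A B :: "'b::{finite,comm_ring_1} set"
  shows "sumset (A \<union> (\<lambda>x. x + e) ` B) {b\<in>B. b + e \<in> A} \<subseteq> sumset A B"
proof
  fix x assume "x \<in> sumset (A \<union> (\<lambda>x. x + e) ` B) {b\<in>B. b + e \<in> A}"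
  then obtain a b where ab: "a \<in> A \<union> (\<lambda>x. x + e) ` B" "b \<in> B" "b + e \<in> A" "x = a + b"
    by (auto simp: sumset_iff)
  show "x \<in> sumset A B"
  proof (cases "a \<in> A")
    case True then show ?thesis using ab by (auto simp: sumset_iff)
  next
    case False
    then obtain b' where "b' \<in> B" "a = b' + e" using ab by auto
    then have "x = (b + e) + b'" using ab by (simp add: algebra_simps)
    then show ?thesis using ab \<open>b' \<in> B\<close> unfolding sumset_iff by blast
  qed
qed

text \<open>Some e-transform shrinks \<open>B\<close> without emptying it: \<open>e = a - b1\<close>
  keeps \<open>b1\<close>, and it drops \<open>b2\<close> if \<open>a + (b2 - b1)\<close> is outside
  \<open>A\<close>. Such an \<open>a\<close> exists because no nonempty proper subset is invariant
  under a nonzero translation.\<close>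

theorem Cauchy_Davenport:
  fixes A B :: "'b::{finite,comm_ring_1} set"
  assumes p: "prime CARD('b)" and "A \<noteq> {}" "B \<noteq> {}"
  shows "min CARD('b) (card A + card B - 1) \<le> card (sumset A B)"
  using assms(2,3)
proof (induction "card B" arbitrary: A B rule: less_induct)
  case less
  show ?case
  proof (cases "A = UNIV \<or> card B = 1")
    case True
    then show ?thesis
    proof
      assume A: "A = UNIV"
      obtain b where "b \<in> B" using less by blast
      then have "x \<in> sumset A B" for x unfolding A sumset_iff by (intro bexI[of _ "x - b"] bexI[of _ b]) auto
      then have "sumset A B = UNIV" by blast
      then show ?thesis by simp
    next
      assume "card B = 1"
      then obtain b where B: "B = {b}" by (auto simp: card_1_singleton_iff)
      have "sumset A B = (\<lambda>x. x + b) ` A" by (auto simp: B sumset_def)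
      then show ?thesis by (simp add: card_translate B)
    qed
  next
    case False
    obtain b1 where b1: "b1 \<in> B" using less by blast
    have "B \<noteq> {b1}" using False by auto
    then obtain b2 where b2: "b2 \<in> B" "b2 \<noteq> b1" using b1 by blast
    obtain a where a: "a \<in> A" "a + (b2 - b1) \<notin> A"
      using translate_neq_prime_card[OF p, of "b2 - b1" A] b2 less False by auto
    define e where "e = a - b1"
    let ?A = "A \<union> (\<lambda>x. x + e) ` B" and ?B = "{b\<in>B. b + e \<in> A}"
    have "b1 \<in> ?B" "b2 \<notin> ?B" using a b1 by (auto simp: e_def algebra_simps)
    then have "card ?B < card B" using b2 by (intro psubset_card_mono) auto
    then have "min CARD('b) (card ?A + card ?B - 1) \<le> card (sumset ?A ?B)"
      using less \<open>b1 \<in> ?B\<close> by blast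
    also have "\<dots> \<le> card (sumset A B)" by (intro card_mono sumset_e_transform) auto
    finally show ?thesis by (simp add: card_e_transform)
  qed
qed

lemma Cauchy_Davenport_translate:
  fixes A B :: "'b::{finite,comm_ring_1} set"
  assumes "prime CARD('b)" and "A \<noteq> {}" "B \<noteq> {}" and "sumset A B \<subseteq> C" "card C < CARD('b)"
  shows "card A + card B \<le> card C + 1"
proof -
  have "card (sumset A B) \<le> card C" using assms by (intro card_mono) auto
  then show ?thesis using Cauchy_Davenport[OF assms(1-3)] assms(5) by linarith
qed

text \<open>A weak form of Vosper's theorem. As in the proof of the latter, an e-transform reduces to a
  smaller second set; if there were none with at least two elements, then many shifts would
  meet \<open>A\<close> in one point, two of them coming from the same element of \<open>B\<close>, which is absurd.\<close>

lemma critical_pair_translate: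
  fixes A B :: "'b::{finite,comm_ring_1} set"
  assumes p: "prime CARD('b)" and "2 \<le> card A" "2 \<le> card B"
    and "card (sumset A B) + 1 = card A + card B" "card (sumset A B) < CARD('b)"
  shows "\<exists>d\<noteq>0. card ((\<lambda>x. x + d) ` sumset A B - sumset A B) \<le> 1"
  using assms(2-5)
proof (induction "card B" arbitrary: A B rule: less_induct)
  case less
  have AB: "A \<noteq> {}" "B \<noteq> {}" using less.prems by auto
  show ?case
  proof (cases "card B = 2")
    case True
    then obtain b b' where B: "B = {b, b'}" "b \<noteq> b'" by (meson card_2_iff)
    define d where "d = b' - b"
    let ?T = "\<lambda>d X. (\<lambda>x. x + d) ` X"
    let ?A = "?T b A"
    have C: "sumset A B = ?A \<union> ?T d ?A" by (auto simp: B sumset_def d_def image_image)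
    have "card (?A \<union> ?T d ?A) = card ?A + card (?T d ?A - ?A)"
      by (subst card_Un_disjoint[symmetric]) (auto intro!: arg_cong[where f=card])
    then have "card (?T d ?A - ?A) = 1" using less.prems True by (simp add: C card_translate)
    \<comment> \<open>What C + d has outside C = A' \<union> (A' + d) lies in A' + 2d but not in A'
      + d, hence is a translate of the single new point of A' + d.\<close>
    moreover have "?T d (?A \<union> ?T d ?A) - (?A \<union> ?T d ?A) \<subseteq> ?T d (?T d ?A - ?A)" by auto
    then have "card (?T d (?A \<union> ?T d ?A) - (?A \<union> ?T d ?A)) \<le> card (?T d (?T d ?A - ?A))"
      by (intro card_mono) auto
    ultimately show ?thesis unfolding C using B by (intro exI[of _ d]) (auto simp: d_def card_translate)
  next
    case False
    let ?A = "\<lambda>e. A \<union> (\<lambda>x. x + e) ` B" and ?B = "\<lambda>e. {b\<in>B. b + e \<in> A}"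
    have size: "card (?A e) + card (?B e) = card A + card B" for e by (rule card_e_transform)
    have crit: "sumset (?A e) (?B e) = sumset A B" if "?B e \<noteq> {}" for e
    proof (rule card_subset_eq)
      have "min CARD('b) (card (?A e) + card (?B e) - 1) \<le> card (sumset (?A e) (?B e))"
        using AB that by (intro Cauchy_Davenport p) auto
      moreover have "card (sumset (?A e) (?B e)) \<le> card (sumset A B)"
        by (intro card_mono sumset_e_transform) auto
      ultimately show "card (sumset (?A e) (?B e)) = card (sumset A B)"
        using less.prems size[of e] by linarith
    qed (auto intro: sumset_e_transform[THEN subsetD])
    have "\<exists>e. 2 \<le> card (?B e) \<and> card (?B e) < card B"
    proof (rule ccontr)
      assume no: "\<not> ?thesis"
      define E where "E = sumset A (uminus ` B)"
      define X where "X = {e. \<forall>b\<in>B. b + e \<in> A}"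
      have "min CARD('b) (card A + card (uminus ` B) - 1) \<le> card E"
        unfolding E_def using AB by (intro Cauchy_Davenport p) auto
      moreover have "card (uminus ` B) = card B" by (intro card_image) (auto simp: inj_on_def)
      ultimately have E: "card A + card B \<le> card E + 1" using less.prems by linarith
      have EB: "?B e \<noteq> {}" if "e \<in> E" for e
        using that by (force simp: E_def sumset_iff)
      have XE: "X \<subseteq> E"
      proof
        fix e assume "e \<in> X"
        obtain b where "b \<in> B" using AB by blast
        then show "e \<in> E" using \<open>e \<in> X\<close> unfolding E_def sumset_iff X_def
          by (intro bexI[of _ "b + e"] bexI[of _ "- b"]) auto
      qed
      \<comment> \<open>\<open>E\<close> contains shifts with nonempty transform and
        \<open>X\<close> those that keep all of \<open>B\<close>. Cauchy--Davenport gives |E| >= |A|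
        + |B| - 1 and, for nonempty X, |X| <= |A| - |B| + 1; the difference 2|B| - 2 exceeds |B|
        because |B| is at least 3.\<close>
      have "card B < card (E - X)"
      proof (cases "X = {}")
        case True then show ?thesis using E less.prems by simp
      next
        case X: False
        have "card A \<le> card (sumset A B)" using less.prems by linarith
        then have "card X + card B \<le> card A + 1"
          using X AB less.prems by (intro Cauchy_Davenport_translate p) (auto simp: X_def sumset_iff add.commute)
        moreover have "card (E - X) = card E - card X" using XE by (intro card_Diff_subset) auto
        ultimately show ?thesis using E less.prems False by linarith
      qed
      have single: "\<exists>b. ?B e = {b}" if "e \<in> E - X" for e
      proof -
        have "?B e \<subset> B" using that by (auto simp: X_def)
        then have "card (?B e) < card B" by (intro psubset_card_mono) auto
        then have "card (?B e) < 2" using no by (meson not_le)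
        moreover have "card (?B e) \<noteq> 0" using EB[of e] that by auto
        ultimately have "card (?B e) = 1" by linarith
        then show ?thesis by (simp add: card_1_singleton_iff)
      qed
      then obtain f where f: "?B e = {f e}" if "e \<in> E - X" for e by metis
      have "f ` (E - X) \<subseteq> B" using f by blast
      then have "\<not> inj_on f (E - X)"
        using \<open>card B < card (E - X)\<close> by (meson card_inj_on_le finite leD)
      then obtain e e' where ee: "e \<in> E - X" "e' \<in> E - X" "f e = f e'" "e \<noteq> e'"
        by (auto simp: inj_on_def)
      define b where "b = f e"
      have Be: "?B e = {b}" "?B e' = {b}" using f ee b_def by metis+
      \<comment> \<open>Both transformed pairs are critical with the same sumset, so the unions
        agree. Comparing what they add to \<open>A\<close> shows that \<open>B - {b}\<close> is
        invariant under translation by \<open>e - e'\<close>.\<close>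
      have "sumset (?A e) {b} = sumset (?A e') {b}" using crit[of e] crit[of e'] Be by simp
      moreover have "sumset X {b} = (\<lambda>x. x + b) ` X" for X by (auto simp: sumset_def)
      ultimately have "?A e = ?A e'" by (simp add: inj_image_eq_iff[of "\<lambda>x. x + b"] inj_def)
      then have "?A e - A = ?A e' - A" by simp
      moreover have "?A e - A = (\<lambda>x. x + e) ` (B - {b})" "?A e' - A = (\<lambda>x. x + e') ` (B - {b})"
        using Be by auto
      ultimately have eq: "(\<lambda>x. x + e) ` (B - {b}) = (\<lambda>x. x + e') ` (B - {b})" by simp
      have "b \<in> B" using Be by blast
      then have cB: "card (B - {b}) = card B - 1" by simp
      have ne: "B - {b} \<noteq> {}"
      proof
        assume "B - {b} = {}"
        then have "card (B - {b}) = 0" by (simp only: card.empty)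
        then have "card B - 1 = 0" using cB by simp
        then show False using less.prems(2) by linarith
      qed
      obtain x where x: "x \<in> B - {b}" "x + (e - e') \<notin> B - {b}"
        using translate_neq_prime_card[OF p, of "e - e'" "B - {b}"] ee ne by auto
      have "x + e \<in> (\<lambda>x. x + e') ` (B - {b})" using x eq by blast
      then show False using x by (auto simp: algebra_simps)
    qed
    then obtain e where e: "2 \<le> card (?B e)" "card (?B e) < card B" by blast
    then have ne: "?B e \<noteq> {}" by (metis card.empty not_numeral_le_zero)
    have "card A \<le> card (?A e)" by (intro card_mono) auto
    then have "\<exists>d\<noteq>0. card ((\<lambda>x. x + d) ` sumset (?A e) (?B e) - sumset (?A e) (?B e)) \<le> 1"
      using less.prems size[of e] e \<open>card A \<le> card (?A e)\<close>
      by (intro less.hyps[OF e(2)]) (auto simp: crit[OF ne])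
    then show ?thesis unfolding crit[OF ne] .
  qed
qed

text \<open>At most one element of \<open>C\<close> has no predecessor in \<open>C\<close> under
  adding d, so \<open>C\<close> is a single chain: a point left over after the chain starting at
  \<open>s\<close> would need a second start.\<close>

lemma arith_progression_of_translate:
  fixes C :: "'b::{finite,comm_ring_1} set"
  assumes p: "prime CARD('b)" and d: "d \<noteq> 0" and C: "C \<noteq> {}" "C \<noteq> UNIV"
    and C1: "card ((\<lambda>x. x + d) ` C - C) \<le> 1"
  shows "\<exists>s. C = (\<lambda>i. s + of_nat i * d) ` {..<card C}"
proof -
  let ?T = "(\<lambda>x. x + d) ` C"
  have "card (C - ?T) \<le> 1"
  proof -
    have *: "card (X - Y) + card (X \<inter> Y) = card X" for X Y :: "'b set"
      by (subst card_Un_disjoint[symmetric]) (auto intro!: arg_cong[where f=card])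
    have "card (C - ?T) + card (C \<inter> ?T) = card C" by (rule *)
    moreover have "card (?T - C) + card (C \<inter> ?T) = card C"
      using *[of ?T C] by (simp add: card_translate Int_commute)
    ultimately show ?thesis using C1 by linarith
  qed
  then have uniq: "x = y" if "x \<in> C - ?T" "y \<in> C - ?T" for x y
    using that card_le_Suc0_iff_eq[of "C - ?T"] \<open>card (C - ?T) \<le> 1\<close> by simp
  obtain s where s: "s \<in> C" "s - d \<notin> C"
    using translate_neq_prime_card[OF p, of "- d" C] d C by auto
  let ?e = "\<lambda>i. s + of_nat i * d"
  have "\<exists>k. ?e k \<notin> C"
  proof -
    obtain x where "x \<notin> C" using C by blast
    moreover obtain n where "x - s = of_nat n * d" using of_nat_mult_surj_prime_card[OF p d] by blast
    ultimately show ?thesis by (metis add.commute diff_add_cancel)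
  qed
  define k where "k = (LEAST k. ?e k \<notin> C)"
  have k: "?e k \<notin> C" unfolding k_def using \<open>\<exists>k. ?e k \<notin> C\<close> by (rule LeastI_ex)
  have lt: "?e i \<in> C" if "i < k" for i using that not_less_Least unfolding k_def by blast
  let ?K = "?e ` {..<k}"
  have CK: "C = ?K"
  proof (rule ccontr)
    assume "C \<noteq> ?K"
    then have "C - ?K \<noteq> {}" using lt by auto
    then obtain c where c: "c \<in> C - ?K" "c - d \<notin> C - ?K"
      using translate_neq_prime_card[OF p, of "- d" "C - ?K"] d C by auto
    show False
    proof (cases "c - d \<in> C")
      case False
      then have "c = s" using c s by (intro uniq) (auto simp: translate_iff)
      moreover have "k \<noteq> 0" using k s by (intro notI) auto
      ultimately have "c \<in> ?K" by (intro image_eqI[of _ _ 0]) auto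
      then show False using c by blast
    next
      case True
      then obtain i where i: "i < k" "c - d = ?e i" using c by auto
      then have ce: "c = ?e (Suc i)" by (simp add: algebra_simps)
      then have "Suc i \<noteq> k" using c k by auto
      then have "c \<in> ?K" using i ce by (intro image_eqI[of _ _ "Suc i"]) auto
      then show False using c by blast
    qed
  qed
  have "k \<le> CARD('b)"
  proof (rule ccontr)
    assume "\<not> ?thesis"
    then have "x \<in> C" for x
    proof -
      obtain n where "n < CARD('b)" "x - s = of_nat n * d" using of_nat_mult_surj_prime_card[OF p d] by blast
      then show ?thesis using lt[of n] \<open>\<not> k \<le> CARD('b)\<close> by (simp add: algebra_simps)
    qed
    then show False using C by blast
  qed
  then have "inj_on ?e {..<k}"
    using inj_on_subset[OF inj_on_of_nat_mult_prime_card[OF p d], of "{..<k}"] by (auto simp: inj_on_def)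
  then have "card C = k" by (subst CK) (simp add: card_image)
  then show ?thesis using CK by metis
qed

section \<open>Large sum-free sets\<close>

lemma card_translate_Compl:
  fixes X :: "'b::{finite,comm_ring_1} set"
  shows "card ((\<lambda>x. x + d) ` (- X) - (- X)) = card ((\<lambda>x. x + d) ` X - X)"
proof -
  let ?T = "\<lambda>X. (\<lambda>x. x + d) ` X"
  have *: "card (A - B) + card (A \<inter> B) = card A" for A B :: "'b set"
    by (subst card_Un_disjoint[symmetric]) (auto intro!: arg_cong[where f=card])
  have "?T (- X) - (- X) = X - ?T X" by (auto simp: translate_iff)
  then show ?thesis using *[of X "?T X"] *[of "?T X" X] by (simp add: card_translate Int_commute)
qed

text \<open>The start is a natural multiple of the step: after division by \<open>d\<close> this is
  the interval {a..<a + n} modulo the prime, and starts can be computed in the natural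
  numbers.\<close>

definition prog :: "'b::{finite,comm_ring_1} \<Rightarrow> nat \<Rightarrow> nat \<Rightarrow> 'b set" where
  "prog d a n = (\<lambda>i. of_nat (a + i) * d) ` {..<n}"

lemma of_nat_mult_eq_iff_cong:
  fixes d :: "'b::{finite,comm_ring_1}"
  assumes p: "prime CARD('b)" and d: "d \<noteq> 0"
  shows "of_nat x * d = of_nat y * d \<longleftrightarrow> x mod CARD('b) = y mod CARD('b)"
proof -
  let ?p = "CARD('b)"
  have red: "of_nat x * d = of_nat (x mod ?p) * d" for x
  proof -
    have "(of_nat x :: 'b) = of_nat (?p * (x div ?p) + x mod ?p)" by simp
    then show ?thesis by (simp only: of_nat_add of_nat_mult of_nat_card_eq_0) simp
  qed
  have pos: "0 < ?p" using p by (simp add: prime_gt_0_nat)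
  show ?thesis
    using inj_onD[OF inj_on_of_nat_mult_prime_card[OF p d], of "x mod ?p" "y mod ?p"] red[of x] red[of y] pos
    by auto
qed

lemma prog_mod:
  fixes d :: "'b::{finite,comm_ring_1}"
  assumes p: "prime CARD('b)" and "a mod CARD('b) = b mod CARD('b)"
  shows "prog d a n = prog d b n"
proof (cases "d = 0")
  case False
  show ?thesis unfolding prog_def
    by (intro image_cong refl) (auto simp: of_nat_mult_eq_iff_cong[OF p False] intro: mod_add_cong assms simp del: of_nat_add)
qed (simp add: prog_def)

lemma card_prog:
  fixes d :: "'b::{finite,comm_ring_1}"
  assumes p: "prime CARD('b)" and d: "d \<noteq> 0" and n: "n \<le> CARD('b)"
  shows "card (prog d a n) = n"
proof -
  have "inj_on (\<lambda>i. of_nat (a + i) * d) {..<n}"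
  proof (rule inj_onI)
    fix i j assume ij: "i \<in> {..<n}" "j \<in> {..<n}" and eq: "of_nat (a + i) * d = of_nat (a + j) * d"
    then have "of_nat i * d = of_nat j * d" by (simp add: algebra_simps)
    then show "i = j" using ij n by (simp add: of_nat_mult_eq_iff_cong[OF p d])
  qed
  then show ?thesis by (simp add: prog_def card_image)
qed

lemma sumset_prog:
  assumes "0 < m" "0 < n"
  shows "sumset (prog d a m) (prog d b n) = prog d (a + b) (m + n - 1)"
proof (intro equalityI subsetI)
  fix x assume "x \<in> sumset (prog d a m) (prog d b n)"
  then obtain i j where "i < m" "j < n" "x = of_nat (a + i) * d + of_nat (b + j) * d"
    by (auto simp: sumset_iff prog_def)
  then show "x \<in> prog d (a + b) (m + n - 1)"
    unfolding prog_def by (intro image_eqI[of _ _ "i + j"]) (auto simp: algebra_simps)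
next
  fix x assume "x \<in> prog d (a + b) (m + n - 1)"
  then obtain k where k: "k < m + n - 1" "x = of_nat (a + b + k) * d" by (auto simp: prog_def)
  define i where "i = min k (m - 1)"
  define j where "j = k - i"
  have ij: "i < m" "j < n" "k = i + j" using k assms by (auto simp: i_def j_def)
  have "x = of_nat (a + i) * d + of_nat (b + j) * d" unfolding k(2) ij(3) by (simp add: algebra_simps)
  then show "x \<in> sumset (prog d a m) (prog d b n)"
    using ij unfolding sumset_iff prog_def by blast
qed

lemma card_Compl_finite: "card (- X) = CARD('b) - card (X :: 'b::finite set)"
  by (simp add: Compl_eq_Diff_UNIV card_Diff_subset)

lemma Compl_prog:
  fixes d :: "'b::{finite,comm_ring_1}"
  assumes p: "prime CARD('b)" and d: "d \<noteq> 0" and mn: "m + n = CARD('b)"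
  shows "- prog d a m = prog d (a + m) n"
proof -
  have "prog d a m \<inter> prog d (a + m) n = {}"
  proof (rule ccontr)
    assume "\<not> ?thesis"
    then obtain i j where ij: "i < m" "j < n" "of_nat (a + i) * d = of_nat (a + m + j) * d"
      by (auto simp: prog_def)
    then have "of_nat i * d = of_nat (m + j) * d" by (simp add: algebra_simps)
    then have "i mod CARD('b) = (m + j) mod CARD('b)" unfolding of_nat_mult_eq_iff_cong[OF p d] .
    then show False using ij mn by simp
  qed
  then have "prog d (a + m) n \<subseteq> - prog d a m" by blast
  moreover have "card (- prog d a m) = n" using card_prog[OF p d, of m a] mn by (simp add: card_Compl_finite)
  moreover have "card (prog d (a + m) n) = n" using card_prog[OF p d] mn by simp
  ultimately show ?thesis by (metis card_subset_eq finite)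
qed

text \<open>Each start lies in the other progression, at offsets i and j with i + j divisible by the
  prime; progressions shorter than half the group force i = j = 0.\<close>

lemma prog_inject:
  fixes d :: "'b::{finite,comm_ring_1}"
  assumes p: "prime CARD('b)" and d: "d \<noteq> 0" and n: "0 < n" "2 * n < CARD('b)"
    and eq: "prog d a n = prog d b n"
  shows "a mod CARD('b) = b mod CARD('b)"
proof -
  have start: "of_nat a * d \<in> prog d a n" for a
    using n unfolding prog_def by (intro image_eqI[of _ _ 0]) auto
  obtain i where i: "i < n" "of_nat a * d = of_nat (b + i) * d"
    using start[of a] unfolding eq by (auto simp: prog_def)
  obtain j where j: "j < n" "of_nat b * d = of_nat (a + j) * d"
    using start[of b] unfolding eq[symmetric] by (auto simp: prog_def)
  have "of_nat (i + j) * d = of_nat 0 * d" using i j by (simp add: algebra_simps)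
  then have "(i + j) mod CARD('b) = 0" using of_nat_mult_eq_iff_cong[OF p d, of "i + j" 0] by simp
  moreover have "i + j < CARD('b)" using i j n by linarith
  ultimately have "i = 0" by simp
  then show ?thesis using i of_nat_mult_eq_iff_cong[OF p d] by simp
qed

lemma prime_23: "prime (23 :: nat)"
  by simp

text \<open>Doubling {8..15} gives {16..30}, whose complement modulo 23 is {31..38}, the same
  interval.\<close>

lemma prog_8_8:
  fixes d :: "'b::{finite,comm_ring_1}"
  assumes c: "CARD('b) = 23" and d: "d \<noteq> 0"
  shows "card (prog d 8 8) = 8 \<and> sumset (prog d 8 8) (prog d 8 8) = - prog d 8 8"
proof
  have p: "prime CARD('b)" using c prime_23 by simp
  show "card (prog d 8 8) = 8" using card_prog[OF p d] c by simp
  have "sumset (prog d 8 8) (prog d 8 8) = prog d 16 15" using sumset_prog[of 8 8 d 8 8] by simp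
  moreover have "- prog d 16 15 = prog d 31 8" using Compl_prog[OF p d, of 15 8 16] c by simp
  moreover have "prog d 31 8 = prog d 8 8" by (rule prog_mod[OF p]) (simp add: c)
  ultimately show "sumset (prog d 8 8) (prog d 8 8) = - prog d 8 8" by (metis double_compl)
qed

context exp3_group
begin

section \<open>Fibres of a sum-free set over V\<close>

definition fibre :: "('a \<times> 'b) set \<Rightarrow> 'a \<Rightarrow> 'b set" where
  "fibre S v = {j. (v, j) \<in> S}"

lemma card_eq_sum_fibre:
  fixes S :: "('a \<times> 'b::finite) set"
  assumes "S \<subseteq> V \<times> UNIV"
  shows "card S = (\<Sum>v\<in>V. card (fibre S v))"
proof -
  have "S = Sigma V (fibre S)" using assms by (auto simp: fibre_def)
  then show ?thesis by (metis card_SigmaI finite_V finite)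
qed

lemma sumset_fibre:
  assumes "sumfree S"
  shows "sumset (fibre S u) (fibre S v) \<subseteq> - fibre S (u + v)"
  using assms by (fastforce simp: sumset_iff fibre_def sumfree_def)

lemma card_fibre_sum:
  fixes S :: "('a \<times> 'b::{finite,comm_ring_1}) set"
  assumes p: "prime CARD('b)" and S: "sumfree S"
    and ne: "fibre S u \<noteq> {}" "fibre S v \<noteq> {}" "fibre S (u + v) \<noteq> {}"
  shows "card (fibre S u) + card (fibre S v) + card (fibre S (u + v)) \<le> CARD('b) + 1"
proof -
  have pos: "0 < card (fibre S (u + v))" "card (fibre S (u + v)) \<le> CARD('b)"
    using ne by (auto simp: card_gt_0_iff intro: card_mono)
  then have "card (- fibre S (u + v)) < CARD('b)" by (simp add: card_Compl_finite)
  from Cauchy_Davenport_translate[OF p ne(1,2) sumset_fibre[OF S] this]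
  show ?thesis using pos by (simp add: card_Compl_finite)
qed

text \<open>A fibre with at least 9 elements, at v, forces every line w, w + v, w + 2v to carry at
  most 23 points: two nonempty fibres on it have at most 24 - 9 = 15 points together, any two being
  consecutive since the line closes up. Hence three nonempty fibres have at most 45/2.\<close>

lemma fibre_dichotomy:
  fixes S :: "('a \<times> 'b::{finite,comm_ring_1}) set"
  assumes c: "CARD('b) = 23" and S: "S \<subseteq> V \<times> UNIV" "sumfree S"
  shows "(\<forall>v\<in>V. card (fibre S v) \<le> 8) \<or> 3 * card S \<le> 23 * card V"
proof (cases "\<forall>v\<in>V. card (fibre S v) \<le> 8")
  case False
  then obtain v where v: "v \<in> V" "9 \<le> card (fibre S v)" by fastforce
  have p: "prime CARD('b)" using c prime_23 by simp
  let ?a = "\<lambda>w. card (fibre S w)"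
  have le: "?a w \<le> 23" for w using card_mono[of UNIV "fibre S w"] c by simp
  have vne: "fibre S v \<noteq> {}" using v by auto
  have three: "?a w + ?a v + ?a (w + v) \<le> 24" if "?a w \<noteq> 0" "?a (w + v) \<noteq> 0" for w
    using card_fibre_sum[OF p S(2), of w v] that vne c by auto
  have line: "?a w + ?a (w + v) + ?a (w + v + v) \<le> 23" if "w \<in> V" for w
  proof -
    have "w + v + v + v = w" using triple_V[OF v(1)] by (simp add: add.assoc)
    then show ?thesis
      using three[of w] three[of "w + v"] three[of "w + v + v"] le[of w] le[of "w + v"] le[of "w + v + v"] v(2)
      by (cases "?a w = 0"; cases "?a (w + v) = 0"; cases "?a (w + v + v) = 0") auto
  qed
  have "3 * card S = (\<Sum>w\<in>V. ?a w) + (\<Sum>w\<in>V. ?a (w + v)) + (\<Sum>w\<in>V. ?a (w + v + v))"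
    using sum_V_translate[of "v + v" ?a] sum_V_translate[OF v(1), of ?a] v card_eq_sum_fibre[OF S(1)]
    by (simp add: add.assoc)
  also have "\<dots> = (\<Sum>w\<in>V. ?a w + ?a (w + v) + ?a (w + v + v))" by (simp add: sum.distrib)
  also have "\<dots> \<le> (\<Sum>w\<in>V. 23)" by (intro sum_mono line)
  finally show ?thesis by simp
qed simp

lemma card_sumfree_le:
  fixes S :: "('a \<times> 'b::{finite,comm_ring_1}) set"
  assumes c: "CARD('b) = 23" and S: "S \<subseteq> V \<times> UNIV" "sumfree S"
  shows "card S \<le> 8 * card V"
  using fibre_dichotomy[OF assms]
proof
  assume "\<forall>v\<in>V. card (fibre S v) \<le> 8"
  then have "card S \<le> (\<Sum>v\<in>V. 8)" unfolding card_eq_sum_fibre[OF S(1)] by (intro sum_mono) auto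
  then show ?thesis by simp
qed simp

text \<open>Replacing \<open>X\<close> by X \<union> (X + d) and \<open>P\<close> by P \<inter> (P -
  d) keeps the sumset inside \<open>Y\<close>. The second set loses at most one element, so
  Cauchy--Davenport lets the first gain at most one.\<close>

lemma card_translate_eq_of_tight:
  fixes X Y P :: "'b::{finite,comm_ring_1} set"
  assumes p: "prime CARD('b)" and XP: "sumset X P \<subseteq> Y" "card Y + 1 = card X + card P" "card Y < CARD('b)"
    and "X \<noteq> {}" "2 \<le> card P" and d: "card ((\<lambda>x. x + d) ` P - P) \<le> 1"
  shows "card ((\<lambda>x. x + d) ` X - X) \<le> 1"
proof -
  let ?T = "\<lambda>X. (\<lambda>x. x + d) ` X"
  let ?P = "{b\<in>P. b + d \<in> P}"
  have *: "card (A - B) + card (A \<inter> B) = card A" for A B :: "'b set"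
    by (subst card_Un_disjoint[symmetric]) (auto intro!: arg_cong[where f=card])
  have "?T ?P = ?T P \<inter> P" by auto
  then have "card ?P = card (?T P \<inter> P)" by (metis card_translate)
  then have cP: "card P \<le> card ?P + 1" using *[of "?T P" P] d by (simp add: card_translate)
  then have "card ?P \<noteq> 0" using assms(6) by linarith
  then have "?P \<noteq> {}" by (metis card.empty)
  moreover have "sumset (X \<union> ?T X) ?P \<subseteq> Y"
  proof
    fix x assume "x \<in> sumset (X \<union> ?T X) ?P"
    then obtain a b where ab: "a \<in> X \<union> ?T X" "b \<in> P" "b + d \<in> P" "x = a + b" by (auto simp: sumset_iff)
    have "x \<in> sumset X P"
    proof (cases "a \<in> X")
      case True then show ?thesis using ab unfolding sumset_iff by blast
    next
      case False
      then obtain a' where "a' \<in> X" "a = a' + d" using ab by auto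
      then have "x = a' + (b + d)" using ab by (simp add: ac_simps)
      then show ?thesis using ab \<open>a' \<in> X\<close> unfolding sumset_iff by blast
    qed
    then show "x \<in> Y" using XP by blast
  qed
  ultimately have "card (X \<union> ?T X) + card ?P \<le> card Y + 1"
    using assms by (intro Cauchy_Davenport_translate[OF p]) auto
  moreover have "card (X \<union> ?T X) = card X + card (?T X - X)"
    by (subst card_Un_disjoint[symmetric]) (auto intro!: arg_cong[where f=card])
  ultimately show ?thesis using XP cP by linarith
qed

lemma exists_avoiding:
  assumes B: "finite B" "finite F" and F: "\<And>f. f \<in> F \<Longrightarrow> inj_on f V" and "card F * card B < card V"
  shows "\<exists>v\<in>V. \<forall>f\<in>F. f v \<notin> B"
proof (rule ccontr)
  assume "\<not> ?thesis"
  then have "V \<subseteq> (\<Union>f\<in>F. {v\<in>V. f v \<in> B})" by blast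
  then have "card V \<le> card (\<Union>f\<in>F. {v\<in>V. f v \<in> B})" using B by (intro card_mono) auto
  also have "\<dots> \<le> (\<Sum>f\<in>F. card {v\<in>V. f v \<in> B})" using B by (intro card_UN_le)
  also have "\<dots> \<le> (\<Sum>f\<in>F. card B)"
  proof (rule sum_mono)
    fix f assume "f \<in> F"
    then have "inj_on f {v\<in>V. f v \<in> B}" using F by (auto intro: inj_on_subset)
    then show "card {v\<in>V. f v \<in> B} \<le> card B" using B by (intro card_inj_on_le) auto
  qed
  finally show False using assms by simp
qed


text \<open>As 8 + 8 - 1 = 23 - 8, Cauchy--Davenport leaves no room in the inclusion of
  \<open>sumset_fibre\<close>.\<close>

lemma tight_fibres:
  fixes S :: "('a \<times> 'b::{finite,comm_ring_1}) set"
  assumes c: "CARD('b) = 23" and S: "sumfree S"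
    and "card (fibre S u) = 8" "card (fibre S v) = 8" "card (fibre S (u + v)) = 8"
  shows "sumset (fibre S u) (fibre S v) = - fibre S (u + v)"
proof (rule card_subset_eq)
  have p: "prime CARD('b)" using c prime_23 by simp
  have "fibre S u \<noteq> {}" "fibre S v \<noteq> {}" using assms by auto
  from Cauchy_Davenport[OF p this] show "card (sumset (fibre S u) (fibre S v)) = card (- fibre S (u + v))"
    using assms card_mono[OF _ sumset_fibre[OF S, of u v]] by (simp add: card_Compl_finite)
qed (use sumset_fibre[OF S] in auto)

text \<open>Since 198/25 = 8 - 2/25, the fibres with fewer than eight elements lie over less than
  2/25 of \<open>V\<close>, and a union bound can make eight prescribed fibres full at once. Full
  fibres turn out to be progressions with a common step, the doubling equations determine their
  start, and any remaining fibre is confined by two full ones.\<close>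

theorem sumfree_stability:
  fixes S :: "('a \<times> 'b::{finite,comm_ring_1}) set"
  assumes c: "CARD('b) = 23" and S: "S \<subseteq> V \<times> UNIV" "sumfree S" and big: "198 * card V < 25 * card S"
  shows "\<exists>I. card I = 8 \<and> sumset I I = - I \<and> S \<subseteq> V \<times> I"
proof -
  have p: "prime CARD('b)" using c prime_23 by simp
  define A where "A = fibre S"
  have A8: "card (A v) \<le> 8" if "v \<in> V" for v
    using fibre_dichotomy[OF c S] big that unfolding A_def by auto
  define B where "B = {v\<in>V. card (A v) \<noteq> 8}"
  have finB: "finite B" by (simp add: B_def)
  have "card S = (\<Sum>v\<in>B. card (A v)) + (\<Sum>v\<in>V - B. card (A v))"
    unfolding card_eq_sum_fibre[OF S(1)] A_def
    by (subst sum.subset_diff[of B V]) (auto simp: B_def)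
  also have "(\<Sum>v\<in>B. card (A v)) \<le> (\<Sum>v\<in>B. 7)"
    using A8 by (intro sum_mono) (fastforce simp: B_def)
  also have "(\<Sum>v\<in>V - B. card (A v)) \<le> (\<Sum>v\<in>V - B. 8)" using A8 by (intro sum_mono) auto
  finally have "card S \<le> 7 * card B + 8 * card (V - B)" by simp
  moreover have "card (V - B) + card B = card V"
    using card_Diff_subset[of B V] card_mono[of V B] finB by (simp add: B_def)
  ultimately have cB: "25 * card B < 2 * card V" using big by linarith
  have Vpos: "0 < card V" using subgrp_card_pos[OF subgrp_V] .
  have good: "card (A v) = 8" if "v \<in> V" "v \<notin> B" for v using that by (simp add: B_def)
  have tight: "sumset (A u) (A v) = - A (u + v)" if "u \<in> V" "v \<in> V" "u \<notin> B" "v \<notin> B" "u + v \<notin> B" for u v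
    using that good unfolding A_def by (intro tight_fibres[OF c S(2)]) auto
  have dbl: "v + v = - v" if "v \<in> V" for v using uminus_eq[OF that] by simp
  obtain v0 where v0: "v0 \<in> V" "v0 \<notin> B" "- v0 \<notin> B"
  proof -
    let ?F = "{\<lambda>v. v, uminus} :: ('a \<Rightarrow> 'a) set"
    have "card ?F \<le> 2" by (simp add: card_insert_if)
    then have "card ?F * card B \<le> 2 * card B" by (rule mult_right_mono) simp
    also have "\<dots> < card V" using cB Vpos by linarith
    finally have lt: "card ?F * card B < card V" .
    have inj: "inj_on f V" if "f \<in> ?F" for f using that by (auto simp: inj_on_def)
    obtain v where "v \<in> V" "\<forall>f\<in>?F. f v \<notin> B"
      using exists_avoiding[OF finB _ inj lt] by auto
    then show thesis using that by simp
  qed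
  \<comment> \<open>In exponent three v0 + v0 = -v0, so the critical pair consists of one fibre
    added to itself, and its sumset is the complement of the fibre at \<open>w0\<close>. The step
    \<open>d\<close> found there is then imposed on all other fibres.\<close>
  define w0 where "w0 = - v0"
  have w0: "w0 \<in> V" "w0 \<notin> B" using v0 by (auto simp: w0_def)
  have t0: "sumset (A v0) (A v0) = - A w0"
    using tight[of v0 v0] v0 dbl[OF v0(1)] by (simp add: w0_def)
  have "card (- A w0) = 15" using good[OF w0] c by (simp add: card_Compl_finite)
  then obtain d where d: "d \<noteq> 0" "card ((\<lambda>x. x + d) ` (- A w0) - (- A w0)) \<le> 1"
    using critical_pair_translate[OF p, of "A v0" "A v0"] good[OF v0(1,2)] c unfolding t0 by auto
  then have dw0: "card ((\<lambda>x. x + d) ` A w0 - A w0) \<le> 1" by (simp only: card_translate_Compl)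
  define Gd where "Gd = {v\<in>V. v \<notin> B \<and> - v \<notin> B \<and> v + w0 \<notin> B \<and> - v + w0 \<notin> B}"
  have prog: "\<exists>t<23. A v = prog d t 8" if "v \<in> V" "v \<notin> B" "v + w0 \<notin> B" for v
  proof -
    have c8: "card (A v) = 8" using good that by simp
    have "card ((\<lambda>x. x + d) ` A v - A v) \<le> 1"
    proof (rule card_translate_eq_of_tight[OF p _ _ _ _ _ dw0])
      show "sumset (A v) (A w0) \<subseteq> - A (v + w0)" using sumset_fibre[OF S(2)] unfolding A_def .
      show "card (- A (v + w0)) + 1 = card (A v) + card (A w0)"
        using c8 good[OF w0] good[of "v + w0"] that w0 c by (simp add: card_Compl_finite)
      show "card (- A (v + w0)) < CARD('b)"
        using good[of "v + w0"] that w0 c by (simp add: card_Compl_finite)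
    qed (use c8 good[OF w0] in auto)
    moreover have "A v \<noteq> {}" "A v \<noteq> UNIV" using c8 c by auto
    ultimately obtain s where s: "A v = (\<lambda>i. s + of_nat i * d) ` {..<8}"
      using arith_progression_of_translate[OF p d(1), of "A v"] c8 by auto
    obtain t where t: "t < 23" "s = of_nat t * d" using of_nat_mult_surj_prime_card[OF p d(1), of s] c by auto
    have "A v = prog d t 8" unfolding s prog_def t by (intro image_cong) (auto simp: algebra_simps)
    then show ?thesis using t by blast
  qed
  have GI: "A v = prog d 8 8" if v: "v \<in> Gd" for v
  proof -
    have vV: "v \<in> V" "- v \<in> V" and nB: "v \<notin> B" "- v \<notin> B" "v + w0 \<notin> B" "- v + w0 \<notin> B"
      using v by (auto simp: Gd_def)
    obtain t where t: "t < 23" "A v = prog d t 8" using prog[of v] vV nB by blast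
    \<comment> \<open>Passing from v to -v sends the start t to 2t + 15; doing it twice returns to v
      and gives t = 4t + 45 modulo 23, whose only solution is 8.\<close>
    have neg: "A (- v) = prog d (t + t + 15) 8"
    proof -
      have "- A (- v) = prog d (t + t) 15"
      proof -
        have "sumset (A v) (A v) = - A (- v)"
          using tight[OF vV(1) vV(1) nB(1) nB(1)] nB(2) unfolding dbl[OF vV(1)] by simp
        then have "- A (- v) = sumset (prog d t 8) (prog d t 8)" by (simp only: t)
        also have "\<dots> = prog d (t + t) (8 + 8 - 1)" by (rule sumset_prog) simp_all
        finally show ?thesis by simp
      qed
      then have "A (- v) = - prog d (t + t) 15" by (metis double_compl)
      then show ?thesis using Compl_prog[OF p d(1), of 15 8 "t + t"] c by simp
    qed
    have "- A v = prog d (2 * (t + t + 15)) 15"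
    proof -
      have e: "- v + - v = v" using dbl[OF vV(2)] by (simp only: minus_minus)
      have "sumset (A (- v)) (A (- v)) = - A (- v + - v)"
        by (rule tight) (simp_all only: e vV nB not_False_eq_True)
      then have "- A v = sumset (prog d (t + t + 15) 8) (prog d (t + t + 15) 8)"
        by (simp only: e neg)
      also have "\<dots> = prog d (t + t + 15 + (t + t + 15)) (8 + 8 - 1)" by (rule sumset_prog) simp_all
      finally show ?thesis by (simp only: mult_2) simp
    qed
    then have "A v = - prog d (2 * (t + t + 15)) 15" by (metis double_compl)
    then have "A v = prog d (2 * (t + t + 15) + 15) 8" using Compl_prog[OF p d(1), of 15 8] c by simp
    then have "t mod 23 = (2 * (t + t + 15) + 15) mod 23"
      using prog_inject[OF p d(1), of 8 t "2 * (t + t + 15) + 15"] t c by simp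
    then have "4 * t + 45 = 23 * ((4 * t + 45) div 23) + t"
      using t(1) mult_div_mod_eq[of 23 "4 * t + 45"] by (simp add: algebra_simps)
    then obtain q where q: "3 * t + 45 = 23 * q" by (intro that[of "(4 * t + 45) div 23"]) linarith
    then consider "q = 2" | "q = 3" | "q = 4" using t(1) by linarith
    then have "t = 8" by cases (use q in presburger)+
    then show ?thesis using t by simp
  qed
  let ?I = "prog d 8 8"
  have I: "card ?I = 8" "sumset ?I ?I = - ?I" using prog_8_8[OF c d(1)] by blast+
  have "S \<subseteq> V \<times> ?I"
  proof
    fix x assume "x \<in> S"
    then obtain k j where k: "x = (k, j)" "k \<in> V" "j \<in> A k" using S(1) by (auto simp: A_def fibre_def)
    \<comment> \<open>The eight points that have to avoid \<open>B\<close> in order that both v and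
      k - v lie in \<open>Gd\<close>; then the fibre at k is disjoint from the sumset of
      \<open>?I\<close> with itself.\<close>
    define fs where "fs = [\<lambda>v. v, uminus, \<lambda>v. v + w0, \<lambda>v. - v + w0,
      \<lambda>v. k - v, \<lambda>v. - (k - v), \<lambda>v. k - v + w0, \<lambda>v. - (k - v) + w0]"
    have "card (set fs) \<le> 8" using card_length[of fs] by (simp add: fs_def del: set_simps)
    then have "card (set fs) * card B \<le> 8 * card B" by (rule mult_right_mono) simp
    also have "\<dots> < card V" using cB by linarith
    finally have lt: "card (set fs) * card B < card V" .
    have inj: "inj_on f V" if "f \<in> set fs" for f
      using that unfolding fs_def by (auto simp: inj_on_def)
    obtain v where v: "v \<in> V" "\<forall>f\<in>set fs. f v \<notin> B"
      using exists_avoiding[OF finB _ inj lt] by blast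
    then have "v \<in> Gd" "k - v \<in> Gd" using k unfolding fs_def Gd_def by (simp_all add: algebra_simps)
    then have "sumset ?I ?I \<subseteq> - A k"
      using sumset_fibre[OF S(2), of v "k - v"] GI unfolding A_def by simp
    then have "j \<in> ?I" using k I(2) by blast
    then show "x \<in> V \<times> ?I" using k by simp
  qed
  then show ?thesis using I by blast
qed

end

section \<open>Link graphs\<close>

definition maximal_sumfree :: "'g::plus set \<Rightarrow> 'g set \<Rightarrow> bool" where
  "maximal_sumfree G S \<longleftrightarrow> S \<subseteq> G \<and> sumfree S \<and> (\<forall>T\<subseteq>G. sumfree T \<and> S \<subseteq> T \<longrightarrow> T = S)"

text \<open>Two elements are linked if together with an element of \<open>B\<close> they form a
  Schur triple, in any of its three positions. The last clause puts a loop at an element that forms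
  a Schur triple with two elements of \<open>B\<close>.\<close>

definition link :: "'g::ab_group_add set \<Rightarrow> 'g \<Rightarrow> 'g \<Rightarrow> bool" where
  "link B a c \<longleftrightarrow> a - c \<in> B \<or> c - a \<in> B \<or> a + c \<in> B \<or>
     a = c \<and> ((\<exists>x\<in>B. \<exists>y\<in>B. a = x + y) \<or> (\<exists>x\<in>B. a + x \<in> B))"

lemma symp_link: "symp (link B)"
  by (auto simp: symp_def link_def add.commute)

lemma sumfreeD: "sumfree S \<Longrightarrow> x \<in> S \<Longrightarrow> y \<in> S \<Longrightarrow> x + y \<notin> S"
  by (simp add: sumfree_def)

text \<open>An edge inside S \<inter> A would be a Schur triple in \<open>S\<close>. An element of
  \<open>A\<close> that is neither looped nor dominated could be added to \<open>S\<close>: triples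
  inside \<open>A\<close> are excluded because \<open>A\<close> is sum-free, all others are recorded
  by the link graph.\<close>

lemma maximal_sumfree_Int_mis:
  fixes S :: "'g::ab_group_add set"
  assumes S: "maximal_sumfree G S" and A: "A \<subseteq> G" "sumfree A"
  shows "S \<inter> A \<in> mis (link (S - A)) A"
proof -
  let ?B = "S - A"
  have sf: "sumfree S" using S by (simp add: maximal_sumfree_def)
  have "\<not> link ?B x y" if "x \<in> S \<inter> A" "y \<in> S \<inter> A" for x y
  proof
    assume "link ?B x y"
    then consider "x - y \<in> S" | "y - x \<in> S" | "x + y \<in> S" | u v where "u \<in> S" "v \<in> S" "x = u + v"
      | u where "u \<in> S" "x + u \<in> S"
      by (auto simp: link_def)
    then show False
      by cases (use that sumfreeD[OF sf, of "x - y" y] sumfreeD[OF sf, of "y - x" x] sumfreeD[OF sf] in auto)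
  qed
  moreover have "link ?B a a \<or> (\<exists>s\<in>S \<inter> A. link ?B a s)" if a: "a \<in> A - S \<inter> A" for a
  proof (rule ccontr)
    assume no: "\<not> ?thesis"
    have l: "\<not> link ?B a s" if "s = a \<or> s \<in> S" "s \<in> A" for s using no that by auto
    have aA: "a \<in> A" using a by blast
    \<comment> \<open>\<open>H1\<close> treats triples with \<open>a\<close> as a summand,
      \<open>H2\<close> those with \<open>a\<close> as the sum.\<close>
    have H1: False if p: "p \<in> insert a S" "a + p \<in> insert a S" for p
    proof (cases "p \<in> A")
      case True
      then have "a + p \<notin> A" using aA A(2) by (auto dest: sumfreeD)
      then have "a + p \<in> ?B" using p aA by auto
      then show False using l[of p] True p(1) by (auto simp: link_def)
    next
      case False
      then have pB: "p \<in> ?B" using p aA by auto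
      show False
      proof (cases "a + p \<in> A")
        case True
        then show False using l[of "a + p"] pB p(2) by (auto simp: link_def)
      next
        case False
        then have "a + p \<in> ?B" using p aA by auto
        then show False using l[of a] aA pB unfolding link_def by blast
      qed
    qed
    have H2: False if p: "p \<in> S" "q \<in> S" "p + q = a" for p q
    proof -
      have diff: "a - p = q" "a - q = p" using p by auto
      consider "p \<in> A" "q \<in> A" | "p \<in> A" "q \<in> ?B" | "p \<in> ?B" "q \<in> A" | "p \<in> ?B" "q \<in> ?B"
        using p(1,2) by blast
      then show False
      proof cases
        case 1 then show False using A(2) p(3) aA by (auto dest: sumfreeD)
      next
        case 2 then show False using l[of p] p(1) diff unfolding link_def by auto
      next
        case 3 then show False using l[of q] p(2) diff unfolding link_def by auto
      next
        case 4 then show False using l[of a] aA p(3) unfolding link_def by blast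
      qed
    qed
    have "sumfree (insert a S)"
      unfolding sumfree_def
    proof (intro ballI notI)
      fix x y assume xy: "x \<in> insert a S" "y \<in> insert a S" "x + y \<in> insert a S"
      show False
      proof (cases "x = a")
        case True
        then show False using H1 xy by blast
      next
        case x: False
        show False
        proof (cases "y = a")
          case True
          then show False using H1[of x] xy by (simp add: add.commute)
        next
          case False
          then have "x \<in> S" "y \<in> S" using x xy by auto
          then show False using H2[of x y] sf xy(3) by (auto dest: sumfreeD)
        qed
      qed
    qed
    moreover have "insert a S \<subseteq> G" using S A a by (auto simp: maximal_sumfree_def)
    ultimately have "insert a S = S" using S unfolding maximal_sumfree_def by blast
    then show False using a by blast
  qed
  ultimately show ?thesis unfolding mis_def by blast
qed

lemma card_maximal_sumfree_le_mis:
  fixes G :: "'g::ab_group_add set"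
  assumes "finite G" "A \<subseteq> G" "sumfree A"
  shows "card {S. maximal_sumfree G S \<and> S - A = B} \<le> card (mis (link B) A)"
proof (rule card_inj_on_le[where f = "\<lambda>S. S \<inter> A"])
  show "inj_on (\<lambda>S. S \<inter> A) {S. maximal_sumfree G S \<and> S - A = B}" by (rule inj_onI) blast
  show "(\<lambda>S. S \<inter> A) ` {S. maximal_sumfree G S \<and> S - A = B} \<subseteq> mis (link B) A"
    using maximal_sumfree_Int_mis assms by blast
  show "finite (mis (link B) A)" using finite_subset[OF assms(2,1)] by simp
qed

text \<open>The plain Moon--Moser bound, as the case q = 1 of the stability theorem, where any
  degree bound is admissible.\<close>

lemma card_mis_le:
  fixes t :: real
  assumes "t ^ 3 = 3" "0 < t" "symp R" "finite W"
  shows "card (mis R W) \<le> t ^ card W"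
proof -
  have "card (nbrs R W u) \<le> max 12 (card W)" for u
  proof -
    have "card (nbrs R W u) \<le> card W" using assms by (intro card_mono) (auto simp: nbrs_def)
    then show ?thesis by simp
  qed
  then show ?thesis using card_mis_defect[OF assms(1,2), of 1 "max 12 (card W)" R W] assms by simp
qed

lemma card_nbrs_link:
  assumes "finite B" 
  shows "card (nbrs (link B) A u) \<le> 3 * card B"
proof -
  have "nbrs (link B) A u \<subseteq> (\<lambda>x. u - x) ` B \<union> (\<lambda>x. u + x) ` B \<union> (\<lambda>x. x - u) ` B"
  proof
    fix v assume "v \<in> nbrs (link B) A u"
    then have "u - v \<in> B \<or> v - u \<in> B \<or> u + v \<in> B" by (auto simp: nbrs_def link_def)
    then show "v \<in> (\<lambda>x. u - x) ` B \<union> (\<lambda>x. u + x) ` B \<union> (\<lambda>x. x - u) ` B"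
      by (auto simp: image_iff intro: bexI[of _ "u - v"] bexI[of _ "v - u"] bexI[of _ "u + v"])
  qed
  then have "card (nbrs (link B) A u) \<le> card ((\<lambda>x. u - x) ` B \<union> (\<lambda>x. u + x) ` B \<union> (\<lambda>x. x - u) ` B)"
    using assms by (intro card_mono) auto
  also have "\<dots> \<le> card ((\<lambda>x. u - x) ` B) + card ((\<lambda>x. u + x) ` B) + card ((\<lambda>x. x - u) ` B)"
    by (meson card_Un_le add_le_mono order_trans order_refl)
  also have "\<dots> \<le> card B + card B + card B" by (intro add_mono card_image_le assms)
  finally show ?thesis by simp
qed

text \<open>A pair \<open>u, x - u\<close> that is linked because its sum \<open>x\<close> lies in \<open>B\<close> has a common neighbour only
  for the few \<open>u\<close> whose double is a combination of three elements of \<open>B\<close>: all other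
  configurations would give a Schur triple in \<open>B\<close>.\<close>

lemma common_nbr_of_sum_edge:
  fixes B :: "'g::ab_group_add set"
  assumes B: "sumfree B" and x: "x \<in> B" and c: "c \<noteq> u" "c \<noteq> x - u" "link B u c" "link B (x - u) c"
  shows "\<exists>y\<in>B. \<exists>z\<in>B. u + u \<in> {x + z + y, x + z - y, x - z + y, x - z - y}"
proof -
  have l: "u - c \<in> B \<or> c - u \<in> B \<or> u + c \<in> B" "(x - u) - c \<in> B \<or> c - (x - u) \<in> B \<or> (x - u) + c \<in> B"
    using c by (auto simp: link_def)
  have no: False if "y \<in> B" "z \<in> B" "y + z \<in> B" for y z using sumfreeD[OF B] that by blast
  consider y where "y \<in> B" "c = u - y" | y where "y \<in> B" "c = u + y" | y where "y \<in> B" "c = y - u"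
    using l(1) by (metis add_diff_cancel_left' add_diff_cancel_right' add_diff_eq diff_add_cancel diff_diff_eq2)
  note y = this
  consider z where "z \<in> B" "c = x - u - z" | z where "z \<in> B" "c = x - u + z" | z where "z \<in> B" "c = z - (x - u)"
    using l(2) by (metis add_diff_cancel_left' add_diff_cancel_right' add_diff_eq diff_add_cancel diff_diff_eq2)
  note z = this
  have *: ?thesis if "y \<in> B" "z \<in> B" "u + u \<in> {x + z + y, x + z - y, x - z + y, x - z - y}" for y z
    using that by blast
  from y show ?thesis
  proof cases
    case y: (1 y)
    from z show ?thesis
    proof cases
      case (1 z) then show ?thesis using y by (intro *[of y z]) (auto simp: algebra_simps)
    next
      case (2 z) then show ?thesis using y by (intro *[of y z]) (auto simp: algebra_simps)
    next
      case (3 z) then have "x = z + y" using y by (simp add: algebra_simps)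
      then show ?thesis using no 3 y x by blast
    qed
  next
    case y: (2 y)
    from z show ?thesis
    proof cases
      case (1 z) then show ?thesis using y by (intro *[of y z]) (auto simp: algebra_simps)
    next
      case (2 z) then show ?thesis using y by (intro *[of y z]) (auto simp: algebra_simps)
    next
      case (3 z) then have "z = x + y" using y by (simp add: algebra_simps)
      then show ?thesis using no 3 y x by blast
    qed
  next
    case y: (3 y)
    from z show ?thesis
    proof cases
      case (1 z) then have "x = y + z" using y by (simp add: algebra_simps)
      then show ?thesis using no 1 y x by blast
    next
      case (2 z) then have "y = x + z" using y by (simp add: algebra_simps)
      then show ?thesis using no 2 y x by blast
    next
      case (3 z)
      then have "u + u = x - z + y" using y by (simp add: algebra_simps)
      then show ?thesis using y 3 by (intro *[of y z]) auto
    qed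
  qed
qed


lemma card_le_of_double_in:
  fixes A :: "'g::ab_group_add set"
  assumes "finite F" and inj: "\<And>u w. u \<in> A \<Longrightarrow> w \<in> A \<Longrightarrow> u + u = w + w \<Longrightarrow> u = w"
  shows "card {u\<in>A. u + u \<in> F} \<le> card F"
  using assms by (intro card_inj_on_le[where f = "\<lambda>u. u + u"]) (auto simp: inj_on_def)

context exp3_group
begin

lemma double_inject:
  fixes u w :: "'a \<times> 'b::{finite,comm_ring_1}"
  assumes p: "prime CARD('b)" "2 < CARD('b)" and "u \<in> V \<times> UNIV" "w \<in> V \<times> UNIV" "u + u = w + w"
  shows "u = w"
proof -
  obtain v i v' i' where uw: "u = (v, i)" "w = (v', i')" by (cases u, cases w)
  then have "v \<in> V" "v' \<in> V" "v + v = v' + v'" "i + i = i' + i'" using assms by auto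
  then have "v = v'" using uminus_eq[of v] uminus_eq[of v'] by (metis neg_equal_iff_equal)
  moreover have "of_nat 2 * (i - i') = 0" using \<open>i + i = i' + i'\<close> by (simp add: algebra_simps)
  then have "i - i' = 0" using of_nat_mult_eq_0_prime_card[OF p(1), of 2 "i - i'"] p(2) by simp
  ultimately show ?thesis using uw by simp
qed

text \<open>For \<open>|B| \<ge> 160\<close> the edges in triangle components are at most a tenth of the edges counted, and
  for smaller \<open>B\<close> only \<open>4|B|\<^sup>2 < 128000\<close> edges with a given sum are in triangle components.\<close>

lemma defect_link:
  fixes B :: "('a \<times> 'b::{finite,comm_ring_1}) set"
  assumes c: "CARD('b) = 23" and I: "card I = 8" "sumset I I = - I"
    and B: "B \<subseteq> V \<times> (- I)" "sumfree B"
  shows "card B * (9 / 10 * card V - 128001) \<le> defect (link B) (V \<times> I)"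
proof -
  let ?A = "V \<times> I" and ?R = "link B"
  have p: "prime CARD('b)" "2 < CARD('b)" using c prime_23 by simp_all
  have dbl: "u = w" if "u \<in> ?A" "w \<in> ?A" "u + u = w + w" for u w
    using double_inject[OF p, of u w] that by auto
  have finB: "finite B" using finite_subset[OF B(1)] by simp
  have finA: "finite ?A" by simp
  have cA: "card ?A = 8 * card V" using I by (simp add: card_cartesian_product)
  define E where "E x = {u\<in>?A. x - u \<in> ?A \<and> x - u \<noteq> u}" for x
  have cE: "card V \<le> card (E x) + 1" if x: "x \<in> B" for x
  proof -
    obtain k j where kj: "x = (k, j)" "k \<in> V" "j \<in> sumset I I" using x B I by (cases x) auto
    then obtain i i' where i: "i \<in> I" "i' \<in> I" "j = i + i'" by (auto simp: sumset_iff)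
    \<comment> \<open>With the second coordinates i and i' fixed, the first coordinate v is free and
      k - v completes the pair. Only the u with u + u = x gives no edge.\<close>
    have "(\<lambda>v. (v, i)) ` V \<subseteq> E x \<union> {u\<in>?A. u + u \<in> {x}}"
      using kj i by (auto simp: E_def algebra_simps)
    then have "card ((\<lambda>v. (v, i)) ` V) \<le> card (E x \<union> {u\<in>?A. u + u \<in> {x}})"
      using finA by (intro card_mono) (auto simp: E_def)
    also have "\<dots> \<le> card (E x) + card {u\<in>?A. u + u \<in> {x}}" by (rule card_Un_le)
    also have "card {u\<in>?A. u + u \<in> {x}} \<le> card {x}" by (rule card_le_of_double_in) (simp, rule dbl)
    finally show ?thesis by (simp add: card_image inj_on_def)
  qed
  have deg: "card {x\<in>B. u \<in> E x} \<le> card (nbrs ?R ?A u)" if "u \<in> ?A" for u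
  proof (rule card_inj_on_le[where f = "\<lambda>x. x - u"])
    show "(\<lambda>x. x - u) ` {x \<in> B. u \<in> E x} \<subseteq> nbrs ?R ?A u"
      by (auto simp: E_def nbrs_def link_def)
  qed (use finA in \<open>auto simp: inj_on_def\<close>)
  have swap: "(\<Sum>u\<in>U. card {x\<in>B. u \<in> E x}) = (\<Sum>x\<in>B. card {u\<in>U. u \<in> E x})" if "finite U" for U
    using that finB by (intro sum_multicount_gen) auto
  let ?T = "in_triangle ?R ?A"
  \<comment> \<open>A crude count: even if all 8n vertices lay in triangles, of degree 2 each, only
    16n would be lost.\<close>
  have "real (card B) * (real (card V) - 1) - 16 * card V \<le> defect ?R ?A"
  proof -
    have "card B * (card V - 1) \<le> (\<Sum>x\<in>B. card (E x))"
    proof -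
      have "(\<Sum>x\<in>B. card V - 1) \<le> (\<Sum>x\<in>B. card (E x))"
        by (intro sum_mono) (use cE in fastforce)
      then show ?thesis by simp
    qed
    also have "\<dots> = (\<Sum>x\<in>B. card {u\<in>?A. u \<in> E x})"
      by (intro sum.cong refl arg_cong[where f = card]) (auto simp: E_def)
    also have "\<dots> = (\<Sum>u\<in>?A. card {x\<in>B. u \<in> E x})" using swap[OF finA] by simp
    also have "\<dots> \<le> (\<Sum>u\<in>?A. card (nbrs ?R ?A u))" by (intro sum_mono deg)
    also have "\<dots> = defect ?R ?A + (\<Sum>u\<in>{u\<in>?A. ?T u}. card (nbrs ?R ?A u))"
    proof -
      have "(\<Sum>u\<in>?A. card (nbrs ?R ?A u)) = (\<Sum>u\<in>{u\<in>?A. \<not> ?T u} \<union> {u\<in>?A. ?T u}. card (nbrs ?R ?A u))"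
        by (intro sum.cong) auto
      also have "\<dots> = (\<Sum>u\<in>{u\<in>?A. \<not> ?T u}. card (nbrs ?R ?A u)) + (\<Sum>u\<in>{u\<in>?A. ?T u}. card (nbrs ?R ?A u))"
        using finA by (intro sum.union_disjoint) auto
      finally show ?thesis by (simp add: defect_def)
    qed
    also have "(\<Sum>u\<in>{u\<in>?A. ?T u}. card (nbrs ?R ?A u)) = 2 * card {u\<in>?A. ?T u}"
      by (simp add: card_nbrs_triangle)
    also have "card {u\<in>?A. ?T u} \<le> card ?A" using finA by (intro card_mono) auto
    finally have "card B * (card V - 1) \<le> defect ?R ?A + 16 * card V" using cA by simp
    then have "real (card B * (card V - 1)) \<le> real (defect ?R ?A + 16 * card V)" by (rule of_nat_mono)
    moreover have "real (card V - 1) = real (card V) - 1" using subgrp_card_pos[OF subgrp_V] by (simp add: of_nat_diff)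
    ultimately show ?thesis by simp
  qed
  note large = this
  have small: "real (card B) * (real (card V) - 1 - 4 * real ((card B)\<^sup>2)) \<le> defect ?R ?A"
  proof -
    have tri: "card {u\<in>E x. ?T u} \<le> 4 * (card B)\<^sup>2" if x: "x \<in> B" for x
    proof -
      define F where "F = (\<Union>(y, z)\<in>B \<times> B. {x + z + y, x + z - y, x - z + y, x - z - y})"
      have finF: "finite F" unfolding F_def
        by (intro finite_UN_I finite_cartesian_product finB) (simp add: case_prod_beta)
      have "card F \<le> (\<Sum>p\<in>B \<times> B. card (case p of (y, z) \<Rightarrow> {x + z + y, x + z - y, x - z + y, x - z - y}))"
        unfolding F_def using finB by (intro card_UN_le) auto
      also have "\<dots> \<le> (\<Sum>p\<in>B \<times> B. 4)"
        by (intro sum_mono) (auto intro!: order_trans[OF card_length[of "[_, _, _, _]", simplified]])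
      finally have cF: "card F \<le> 4 * (card B)\<^sup>2" by (simp add: card_cartesian_product power2_eq_square)
      have "{u\<in>E x. ?T u} \<subseteq> {u\<in>?A. u + u \<in> F}"
      proof clarify
        fix a b assume u: "(a, b) \<in> E x" "?T (a, b)"
        let ?u = "(a, b)"
        have "x - ?u \<in> nbrs ?R ?A ?u" using u x by (auto simp: E_def nbrs_def link_def)
        moreover obtain v w where vw: "nbrs ?R ?A ?u = {v, w}" "nbrs ?R ?A v = {?u, w}" "nbrs ?R ?A w = {?u, v}"
          using u(2) unfolding in_triangle_def by blast
        ultimately have xu: "x - ?u = v \<or> x - ?u = w" by blast
        have "\<exists>c. nbrs ?R ?A ?u = {x - ?u, c} \<and> nbrs ?R ?A (x - ?u) = {?u, c}"
        proof (cases "x - ?u = v")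
          case True
          show ?thesis unfolding True using vw(1,2) by (intro exI[of _ w] conjI)
        next
          case False
          then have w: "x - ?u = w" using xu by blast
          show ?thesis unfolding w using vw(3)
            by (intro exI[of _ v] conjI, subst insert_commute) (rule vw(1), assumption)
        qed
        then obtain c where c: "nbrs ?R ?A ?u = {x - ?u, c}" "nbrs ?R ?A (x - ?u) = {?u, c}" by blast
        then have cc: "c \<noteq> ?u" "c \<noteq> x - ?u" "link B ?u c" "link B (x - ?u) c"
          by (auto simp: nbrs_def)
        have "?u + ?u \<in> F"
          using common_nbr_of_sum_edge[OF B(2) x cc] unfolding F_def by blast
        then show "(a, b) \<in> ?A \<and> (a, b) + (a, b) \<in> F" using u by (auto simp: E_def)
      qed
      then have "card {u\<in>E x. ?T u} \<le> card {u\<in>?A. u + u \<in> F}" using finA by (intro card_mono) auto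
      also have "\<dots> \<le> card F" by (rule card_le_of_double_in[OF finF dbl])
      finally show ?thesis using cF by simp
    qed
    have ex: "real (card V) - 1 - 4 * real ((card B)\<^sup>2) \<le> card {u\<in>{u\<in>?A. \<not> ?T u}. u \<in> E x}" if x: "x \<in> B" for x
    proof -
      have "{u\<in>{u\<in>?A. \<not> ?T u}. u \<in> E x} = E x - {u\<in>E x. ?T u}" by (auto simp: E_def)
      moreover have "finite (E x)" using finA by (simp add: E_def)
      ultimately have "card {u\<in>{u\<in>?A. \<not> ?T u}. u \<in> E x} = card (E x) - card {u\<in>E x. ?T u}"
        by (simp add: card_Diff_subset)
      then show ?thesis using tri[OF x] cE[OF x] by linarith
    qed
    have "real (card B) * (real (card V) - 1 - 4 * real ((card B)\<^sup>2)) = (\<Sum>x\<in>B. real (card V) - 1 - 4 * real ((card B)\<^sup>2))" by simp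
    also have "\<dots> \<le> (\<Sum>x\<in>B. real (card {u\<in>{u\<in>?A. \<not> ?T u}. u \<in> E x}))" by (intro sum_mono ex)
    also have "\<dots> = real (\<Sum>u\<in>{u\<in>?A. \<not> ?T u}. card {x\<in>B. u \<in> E x})"
      using swap[of "{u\<in>?A. \<not> ?T u}"] finA by simp
    also have "\<dots> \<le> real (\<Sum>u\<in>{u\<in>?A. \<not> ?T u}. card (nbrs ?R ?A u))"
      by (intro of_nat_mono sum_mono deg) auto
    also have "\<dots> = defect ?R ?A" by (simp add: defect_def)
    finally show ?thesis .
  qed
  show ?thesis
  proof (cases "card B \<ge> 160")
    case True
    have "160 * real (card V) \<le> card B * real (card V)" using True by (intro mult_right_mono) auto
    then have "card B * (9 / 10 * card V - 128001) \<le> real (card B) * (real (card V) - 1) - 16 * card V"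
      by (simp add: algebra_simps)
    then show ?thesis using large by linarith
  next
    case False
    then have "(card B)\<^sup>2 \<le> 160\<^sup>2" by (intro power_mono) auto
    then have "(card B)\<^sup>2 \<le> 25600" by simp
    then have "real ((card B)\<^sup>2) \<le> real 25600" by (rule of_nat_mono)
    then have "card B * (9 / 10 * card V - 128001) \<le> real (card B) * (real (card V) - 1 - 4 * real ((card B)\<^sup>2))"
      by (intro mult_left_mono) auto
    then show ?thesis using small by linarith
  qed
qed

end

section \<open>The upper bound\<close>

lemma sum_power_card_Pow:
  fixes y :: real
  assumes "finite G"
  shows "(\<Sum>B\<in>Pow G. y ^ card B) = (1 + y) ^ card G"
  using assms
proof (induction G)
  case (insert a G)
  have "(\<Sum>B\<in>Pow (insert a G). y ^ card B) = (\<Sum>B\<in>Pow G. y ^ card B) + (\<Sum>B\<in>insert a ` Pow G. y ^ card B)"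
    unfolding Pow_insert using insert by (intro sum.union_disjoint) auto
  also have "(\<Sum>B\<in>insert a ` Pow G. y ^ card B) = (\<Sum>B\<in>Pow G. y ^ card (insert a B))"
    using insert by (intro sum.reindex_cong[of "insert a"]) (auto simp: inj_on_def)
  also have "\<dots> = (\<Sum>B\<in>Pow G. y * y ^ card B)"
  proof (rule sum.cong[OF refl])
    fix B assume "B \<in> Pow G"
    then have "a \<notin> B" "finite B" using insert finite_subset by auto
    then show "y ^ card (insert a B) = y * y ^ card B" by simp
  qed
  finally show ?case using insert by (simp add: sum_distrib_left[symmetric] algebra_simps)
qed simp

text \<open>Exponential weights: a subset of size at most k has weight at least y^k, and the total
  weight is (1 + y)^|G|.\<close>

lemma card_small_subsets:
  fixes y k :: real
  assumes G: "finite G" and y: "0 < y" "y \<le> 1"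
  shows "card {B. B \<subseteq> G \<and> card B \<le> k} \<le> exp (y * card G) * (1 / y) powr k"
proof -
  have "card {B. B \<subseteq> G \<and> card B \<le> k} * y powr k = (\<Sum>B\<in>{B. B \<subseteq> G \<and> card B \<le> k}. y powr k)" by simp
  also have "\<dots> \<le> (\<Sum>B\<in>{B. B \<subseteq> G \<and> card B \<le> k}. y ^ card B)"
    using y by (intro sum_mono) (auto simp: powr_realpow[symmetric] intro!: powr_mono')
  also have "\<dots> \<le> (\<Sum>B\<in>Pow G. y ^ card B)" using G y by (intro sum_mono2) auto
  also have "\<dots> = (1 + y) ^ card G" using G by (rule sum_power_card_Pow)
  also have "\<dots> \<le> exp y ^ card G" using y by (intro power_mono exp_ge_add_one_self) auto
  also have "\<dots> = exp (y * card G)" by (simp add: exp_of_nat_mult[symmetric] mult.commute)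
  finally have "card {B. B \<subseteq> G \<and> card B \<le> k} \<le> exp (y * card G) / y powr k"
    using y by (simp add: le_divide_eq)
  also have "\<dots> = exp (y * card G) * (1 / y) powr k" using y by (simp add: powr_divide)
  finally show ?thesis .
qed

context exp3_group
begin

text \<open>With b = |B| the choice D = 12b respects both the degree bound 3b and D >= 12, and
  \<open>q\<close> is the largest value with q^(8D) = q^(96b) <= 28/25. The defect is at least b
  times a quantity independent of b, so b cancels in the exponent.\<close>

lemma card_mis_link_le:
  fixes B :: "('a \<times> 'b::{finite,comm_ring_1}) set" and t :: real
  assumes c: "CARD('b) = 23" and I: "card I = 8" "sumset I I = - I"
    and B: "B \<subseteq> V \<times> (- I)" "sumfree B" "B \<noteq> {}" and t: "t ^ 3 = 3" "0 < t"
  shows "card (mis (link B) (V \<times> I)) \<le> t ^ (8 * card V) * (28 / 25) powr (- (9 / 10 * card V - 128001) / 96)"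
proof -
  have finB: "finite B" using finite_subset[OF B(1)] by simp
  define b where "b = card B"
  have b: "0 < b" using B(3) finB by (simp add: b_def card_gt_0_iff)
  define q :: real where "q = (28 / 25) powr (1 / (96 * b))"
  have q1: "1 \<le> q" unfolding q_def by (simp add: ge_one_powr_ge_zero)
  have qpow: "q ^ n = (28 / 25) powr (n / (96 * b))" for n
    unfolding q_def by (simp add: powr_realpow[symmetric] powr_powr)
  have "q ^ (8 * (12 * b)) \<le> 28 / 25" using b unfolding qpow by simp
  moreover have "card (nbrs (link B) (V \<times> I) u) \<le> 12 * b" for u
    using card_nbrs_link[OF finB, of "V \<times> I" u] by (simp add: b_def)
  ultimately have main: "card (mis (link B) (V \<times> I)) * q ^ defect (link B) (V \<times> I) \<le> t ^ card (V \<times> I)"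
    using b q1 by (intro card_mis_defect[OF t, where D = "12 * b"] symp_link) auto
  have "(9 / 10 * card V - 128001) / 96 \<le> defect (link B) (V \<times> I) / (96 * b)"
    using defect_link[OF c I B(1,2)] b by (simp add: b_def field_simps)
  then have "(28 / 25) powr ((9 / 10 * card V - 128001) / 96) \<le> q ^ defect (link B) (V \<times> I)"
    unfolding qpow by (intro powr_mono) auto
  then have "card (mis (link B) (V \<times> I)) * (28 / 25) powr ((9 / 10 * card V - 128001) / 96)
      \<le> card (mis (link B) (V \<times> I)) * q ^ defect (link B) (V \<times> I)"
    by (intro mult_left_mono) auto
  also note main
  also have "card (V \<times> I) = 8 * card V" using I by (simp add: card_cartesian_product)
  finally have "card (mis (link B) (V \<times> I)) \<le> t ^ (8 * card V) / (28 / 25) powr ((9 / 10 * card V - 128001) / 96)"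
    by (simp add: le_divide_eq)
  also have "\<dots> = t ^ (8 * card V) * (28 / 25) powr (- ((9 / 10 * card V - 128001) / 96))"
    by (simp only: powr_minus divide_inverse)
  finally show ?thesis by (simp only: minus_divide_left)
qed

text \<open>Each S is sorted by a container and the part B of S outside it. The leading product
  bounds the choices of B; inside the bracket are the containers of size at most 198n/25, with the
  plain Moon--Moser bound, and the at most 2^23 containers V x I, with the improved one.\<close>

theorem card_maximal_sumfree_upper:
  fixes t \<epsilon> d y :: real
  assumes c: "CARD('b::{finite,comm_ring_1}) = 23" and t: "t ^ 3 = 3" "0 < t"
    and \<epsilon>: "0 < \<epsilon>" "d = \<epsilon> / (2 * CARD('b))" "real CARD('b) < N * ((d\<^sup>2 / 2)\<^sup>2 * (\<epsilon> / 2))"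
    and L: "L = char_bound CARD('b) N" and y: "0 < y" "y \<le> 1"
  shows "card {S. maximal_sumfree (V \<times> (UNIV :: 'b set)) S}
    \<le> exp (y * (23 * card V)) * (1 / y) powr (\<epsilon> * card V) *
      (real (card V ^ L * 2 ^ (3 ^ L * 23)) * t powr (198 / 25 * card V)
       + 2 ^ 23 * (1 + t ^ (8 * card V) * (28 / 25) powr (- (9 / 10 * card V - 128001) / 96)))"
proof -
  let ?G = "V \<times> (UNIV :: 'b set)"
  let ?M = "\<lambda>A B. {S. maximal_sumfree ?G S \<and> S - A = B}"
  define F1 where "F1 = {A :: ('a \<times> 'b) set. (A \<subseteq> ?G \<and> (\<exists>C\<subseteq>chars V. card C \<le> L \<and> cellwise C A))
      \<and> sumfree A \<and> 25 * card A \<le> 198 * card V}"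
  define F2 where "F2 = {I :: 'b set. card I = 8 \<and> sumset I I = - I}"
  define BB where "BB = {B. B \<subseteq> ?G \<and> card B \<le> \<epsilon> * card V}"
  define X where "X = t ^ (8 * card V) * (28 / 25) powr (- (9 / 10 * card V - 128001) / 96)"
  have finG: "finite ?G" by simp
  have cG: "card ?G = 23 * card V" using c by (simp add: card_cartesian_product)
  have X0: "0 \<le> X" unfolding X_def using t by simp
  have F1: "finite F1" "card F1 \<le> card V ^ L * 2 ^ (3 ^ L * 23)"
  proof -
    show "finite F1" unfolding F1_def by (rule finite_subset[OF _ card_cellwise(1)[of L]]) blast
    have "card F1 \<le> card {A :: ('a \<times> 'b) set. A \<subseteq> ?G \<and> (\<exists>C\<subseteq>chars V. card C \<le> L \<and> cellwise C A)}"
      unfolding F1_def by (rule card_mono[OF card_cellwise(1)]) blast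
    also have "\<dots> \<le> card V ^ L * 2 ^ (3 ^ L * 23)" using card_cellwise(2)[of L, where 'b = 'b] c by simp
    finally show "card F1 \<le> card V ^ L * 2 ^ (3 ^ L * 23)" .
  qed
  have F2: "finite F2" "card F2 \<le> 2 ^ 23"
    using card_mono[of "Pow (UNIV :: 'b set)" F2] c by (auto simp: card_Pow)
  have BB: "finite BB" "card BB \<le> exp (y * (23 * card V)) * (1 / y) powr (\<epsilon> * card V)"
    using card_small_subsets[OF finG y, of "\<epsilon> * card V"] cG unfolding BB_def by auto
  have finM: "finite (?M A B)" for A B
    by (rule finite_subset[of _ "Pow ?G"]) (auto simp: maximal_sumfree_def)
  have M1: "card (?M A B) \<le> t powr (198 / 25 * card V)" if "A \<in> F1" for A B
  proof -
    have A: "A \<subseteq> ?G" "sumfree A" "25 * card A \<le> 198 * card V" using that by (auto simp: F1_def)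
    have t1: "1 \<le> t" using cube_root_three_bounds[OF t] by linarith
    have "card (?M A B) \<le> card (mis (link B) A)" by (rule card_maximal_sumfree_le_mis[OF finG A(1,2)])
    also have "real \<dots> \<le> t ^ card A"
      by (rule card_mis_le[OF t symp_link]) (rule finite_subset[OF A(1) finG])
    also have "\<dots> = t powr card A" using t by (simp add: powr_realpow)
    also have "\<dots> \<le> t powr (198 / 25 * card V)" using t1 A(3) by (intro powr_mono) auto
    finally show ?thesis by simp
  qed
  have M2: "card (?M (V \<times> I) B) \<le> 1 + X" if I: "I \<in> F2" for I B
  proof (cases "?M (V \<times> I) B = {}")
    case False
    then obtain S where S: "maximal_sumfree ?G S" "S - V \<times> I = B" by blast
    have sfI: "sumfree (V \<times> I)" using I by (auto simp: F2_def sumfree_def sumset_def)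
    show ?thesis
    \<comment> \<open>Without elements outside V x I the link graph gives no saving, but then
      \<open>S\<close> is V x I itself; this is the summand 1.\<close>
    proof (cases "B = {}")
      case True
      have "?M (V \<times> I) B \<subseteq> {V \<times> I}"
        using True sfI by (auto simp: maximal_sumfree_def)
      then have "card (?M (V \<times> I) B) \<le> card {V \<times> I}" by (intro card_mono) auto
      then show ?thesis using X0 by simp
    next
      case False
      have B: "B \<subseteq> V \<times> (- I)" "sumfree B"
        using S by (auto simp: maximal_sumfree_def sumfree_def)
      have "card (?M (V \<times> I) B) \<le> card (mis (link B) (V \<times> I))"
        by (rule card_maximal_sumfree_le_mis[OF finG _ sfI]) auto
      also have "real \<dots> \<le> X" unfolding X_def using I B False t by (intro card_mis_link_le[OF c]) (auto simp: F2_def)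
      finally show ?thesis by simp
    qed
  next
    case True
    show ?thesis unfolding True using X0 by simp
  qed
  have "{S. maximal_sumfree ?G S} \<subseteq> (\<Union>A\<in>F1. \<Union>B\<in>BB. ?M A B) \<union> (\<Union>I\<in>F2. \<Union>B\<in>BB. ?M (V \<times> I) B)"
  proof clarify
    fix S assume S: "maximal_sumfree ?G S" "S \<notin> (\<Union>I\<in>F2. \<Union>B\<in>BB. ?M (V \<times> I) B)"
    have SG: "S \<subseteq> ?G" "sumfree S" using S by (auto simp: maximal_sumfree_def)
    obtain C A where CA: "C \<subseteq> chars V" "card C \<le> L" "A \<subseteq> ?G" "cellwise C A" "sumfree A" "card (S - A) \<le> \<epsilon> * card V"
      using sumfree_container[OF SG \<epsilon>] L by auto
    have "\<not> 198 * card V < 25 * card A"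
    proof
      assume "198 * card V < 25 * card A"
      then obtain I where I: "card I = 8" "sumset I I = - I" "A \<subseteq> V \<times> I"
        using sumfree_stability[OF c CA(3,5)] by blast
      have "card (S - V \<times> I) \<le> card (S - A)"
        using I SG(1) finite_subset[OF SG(1) finG] by (intro card_mono) auto
      then have "S - V \<times> I \<in> BB" using CA(6) SG unfolding BB_def by auto
      moreover have "I \<in> F2" using I by (simp add: F2_def)
      ultimately show False using S by blast
    qed
    then have "A \<in> F1" using CA unfolding F1_def by auto
    moreover have "S - A \<in> BB" using CA SG unfolding BB_def by auto
    ultimately show "S \<in> (\<Union>A\<in>F1. \<Union>B\<in>BB. ?M A B)" using S by blast
  qed
  then have "card {S. maximal_sumfree ?G S} \<le> card ((\<Union>A\<in>F1. \<Union>B\<in>BB. ?M A B) \<union> (\<Union>I\<in>F2. \<Union>B\<in>BB. ?M (V \<times> I) B))"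
    using F1 F2 BB finM by (intro card_mono) auto
  also have "\<dots> \<le> card (\<Union>A\<in>F1. \<Union>B\<in>BB. ?M A B) + card (\<Union>I\<in>F2. \<Union>B\<in>BB. ?M (V \<times> I) B)"
    by (rule card_Un_le)
  also have "\<dots> \<le> (\<Sum>A\<in>F1. \<Sum>B\<in>BB. card (?M A B)) + (\<Sum>I\<in>F2. \<Sum>B\<in>BB. card (?M (V \<times> I) B))"
    using F1 F2 BB by (intro add_mono order_trans[OF card_UN_le] sum_mono) auto
  finally have "real (card {S. maximal_sumfree ?G S})
      \<le> real ((\<Sum>A\<in>F1. \<Sum>B\<in>BB. card (?M A B)) + (\<Sum>I\<in>F2. \<Sum>B\<in>BB. card (?M (V \<times> I) B)))"
    by (rule of_nat_mono)
  also have "\<dots> = (\<Sum>A\<in>F1. \<Sum>B\<in>BB. real (card (?M A B))) + (\<Sum>I\<in>F2. \<Sum>B\<in>BB. real (card (?M (V \<times> I) B)))"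
    by simp
  also have "\<dots> \<le> (\<Sum>A\<in>F1. \<Sum>B\<in>BB. t powr (198 / 25 * card V)) + (\<Sum>I\<in>F2. \<Sum>B\<in>BB. 1 + X)"
    using M1 M2 by (intro add_mono sum_mono) auto
  also have "\<dots> = real (card BB) * (real (card F1) * t powr (198 / 25 * card V) + real (card F2) * (1 + X))"
    by (simp add: algebra_simps)
  also have "\<dots> \<le> (exp (y * (23 * card V)) * (1 / y) powr (\<epsilon> * card V)) *
      (real (card V ^ L * 2 ^ (3 ^ L * 23)) * t powr (198 / 25 * card V) + 2 ^ 23 * (1 + X))"
  proof (intro mult_mono add_mono)
    show "real (card F1) \<le> real (card V ^ L * 2 ^ (3 ^ L * 23))" using F1(2) by (rule of_nat_mono)
    have "real (card F2) \<le> real (2 ^ 23)" using F2(2) by (rule of_nat_mono)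
    then show "real (card F2) \<le> 2 ^ 23" by simp
  qed (use BB X0 in auto)
  finally show ?thesis unfolding X_def .
qed

end


section \<open>Asymptotic comparison of the exponents\<close>

lemma eventually_power_le_exp:
  fixes c1 c2 a :: real
  assumes a: "0 < a"
  shows "eventually (\<lambda>n. c1 * real n ^ L + c2 \<le> exp (a * real n)) sequentially"
proof -
  have lim: "filterlim (\<lambda>n. a * real n) at_top sequentially"
    using a by (intro filterlim_tendsto_pos_mult_at_top[OF tendsto_const] filterlim_real_sequentially)
  have "((\<lambda>x. (c1 / a ^ L) * (x ^ L / exp x) + c2 * (x ^ 0 / exp x)) \<longlongrightarrow> (c1 / a ^ L) * 0 + c2 * 0) at_top"
    by (intro tendsto_intros tendsto_power_div_exp_0)
  from filterlim_compose[OF this lim]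
  have "eventually (\<lambda>n. (c1 / a ^ L) * ((a * real n) ^ L / exp (a * real n)) + c2 * ((a * real n) ^ 0 / exp (a * real n)) < 1) sequentially"
    by (intro order_tendstoD(2)[where y = 0]) simp_all
  then show ?thesis
  proof eventually_elim
    case (elim n)
    have "(c1 / a ^ L) * ((a * real n) ^ L / exp (a * real n)) + c2 * ((a * real n) ^ 0 / exp (a * real n))
        = (c1 * real n ^ L + c2) / exp (a * real n)"
      using a by (simp add: power_mult_distrib add_divide_distrib)
    then show ?case using elim by (simp add: divide_less_eq)
  qed
qed

lemma ln_3_bounds: "1 \<le> ln (3 :: real)" "ln (3 :: real) \<le> 111 / 100"
proof -
  have "exp (1::real) \<le> 3" using exp_le by simp
  then show "1 \<le> ln (3 :: real)" by (simp add: ln_ge_iff)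
  have e: "(271 / 100 :: real) \<le> exp 1"
  proof -
    have "(\<Sum>n<6. 1 / fact n) \<le> exp (1::real)"
      using sum_le_suminf[OF summable_exp_generic[of "1::real"], of "{..<6}"] by (simp add: exp_def divide_inverse)
    then show ?thesis by (simp add: numeral_eq_Suc lessThan_Suc)
  qed
  have "ln (3 / exp 1) \<le> 3 / exp (1::real) - 1" by (intro ln_le_minus_one) simp
  then have "ln 3 \<le> 3 / exp (1::real)" by (simp add: ln_div)
  also have "\<dots> \<le> 3 / (271 / 100)" using e by (intro divide_left_mono) auto
  also have "\<dots> \<le> 111 / 100" by simp
  finally show "ln (3 :: real) \<le> 111 / 100" .
qed

text \<open>The choices of B cost (23 + ln 10^6)/10^6 <= 5/10^5 in the exponent. The critical term
  is the last one: its saving 9/960 * ln(28/25), at least 99/10^5, must exceed 8/10^4 * ln 3, at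
  most 889/10^6, by that cost and a reserve of 1/10^5.\<close>

lemma upper_asymptotics:
  fixes L :: nat and t :: real
  assumes t: "t = 3 powr (1 / 3)"
  shows "eventually (\<lambda>n. exp (1 / 10 ^ 6 * (23 * real n)) * (1 / (1 / 10 ^ 6)) powr (1 / 10 ^ 6 * real n) *
      (real (n ^ L * 2 ^ (3 ^ L * 23)) * t powr (198 / 25 * real n)
       + 2 ^ 23 * (1 + t ^ (8 * n) * (28 / 25) powr (- (9 / 10 * real n - 128001) / 96)))
     \<le> 3 powr ((1 / 3 - 1 / 10 ^ 4) * (8 * real n))) sequentially"
proof -
  define h l g :: real where "h = ln 3" and "l = ln (28 / 25)" and "g = ln (10 ^ 6)"
  define c1 c2 :: real where "c1 = 2 ^ (3 ^ L * 23)" and "c2 = 2 ^ 23 + 2 ^ 23 * exp (l * 128001 / 96)"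
  have h: "1 \<le> h" "h \<le> 111 / 100" using ln_3_bounds by (simp_all add: h_def)
  have l: "1056 / 10000 \<le> l"
    using ln_one_plus_pos_lower_bound[of "3 / 25"] by (simp add: l_def power2_eq_square)
  have g: "g \<le> 18"
  proof -
    have "10 \<le> (exp 1 :: real) ^ 3"
    proof -
      have "(10 :: real) \<le> (5 / 2) ^ 3" by (simp add: power3_eq_cube)
      also have "(5 / 2 :: real) ^ 3 \<le> exp 1 ^ 3"
        using exp_lower_Taylor_quadratic[of "1::real"] by (intro power_mono) auto
      finally show ?thesis .
    qed
    then have "(10 :: real) ^ 6 \<le> (exp 1 ^ 3) ^ 6" by (intro power_mono) auto
    also have "\<dots> = exp 18" by (simp add: power_mult[symmetric] exp_of_nat_mult[symmetric])
    finally have "ln ((10 :: real) ^ 6) \<le> ln (exp 18)" by (subst ln_le_cancel_iff) auto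
    then show ?thesis by (simp add: g_def)
  qed
  have "eventually (\<lambda>n. c1 * real n ^ L + c2 \<le> exp (1 / 10 ^ 5 * real n)) sequentially"
    by (rule eventually_power_le_exp) simp
  then show ?thesis
  proof eventually_elim
    case (elim n)
    define m where "m = real n"
    have m: "0 \<le> m" by (simp add: m_def)
    define T where "T = exp (h * (8 / 3 - 8 / 10 ^ 4) * m)"
    define E where "E = exp (1 / 10 ^ 6 * (23 * m)) * (1 / (1 / 10 ^ 6)) powr (1 / 10 ^ 6 * m)"
    have E: "E = exp ((23 + g) / 10 ^ 6 * m)"
      by (simp add: E_def powr_def g_def exp_add[symmetric] algebra_simps)
    \<comment> \<open>The reserve exp(-m/10^5) later absorbs the polynomial and constant factors
      \<open>c1 * real n ^ L + c2\<close>.\<close>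
    have decay: "E * exp (a * m) \<le> T * exp (- 1 / 10 ^ 5 * m)"
      if "5 / 10 ^ 5 + a \<le> h * (8 / 3 - 8 / 10 ^ 4) - 1 / 10 ^ 5" for a
    proof -
      have "(23 + g) / 10 ^ 6 + a \<le> h * (8 / 3 - 8 / 10 ^ 4) - 1 / 10 ^ 5"
      proof -
        have "(23 + g) / 10 ^ 6 \<le> 5 / 10 ^ 5" using g by simp
        then show ?thesis using that by linarith
      qed
      then have "((23 + g) / 10 ^ 6 + a) * m \<le> (h * (8 / 3 - 8 / 10 ^ 4) - 1 / 10 ^ 5) * m"
        using m by (rule mult_right_mono)
      then show ?thesis unfolding E T_def exp_add[symmetric] by (simp add: algebra_simps)
    qed
    have t1: "t powr (198 / 25 * m) = exp (h * 66 / 25 * m)"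
      by (simp add: t powr_powr powr_def h_def)
    have t2: "t ^ (8 * n) = exp (h * 8 / 3 * m)"
      by (simp add: t powr_realpow[symmetric] powr_powr m_def) (simp add: powr_def h_def)
    have t3: "(28 / 25) powr (- (9 / 10 * m - 128001) / 96) = exp (l * 128001 / 96) * exp (- (l * 9 / 960) * m)"
      by (simp add: powr_def l_def exp_add[symmetric] field_simps)
    have "E * (real (n ^ L * 2 ^ (3 ^ L * 23)) * t powr (198 / 25 * m)
       + 2 ^ 23 * (1 + t ^ (8 * n) * (28 / 25) powr (- (9 / 10 * m - 128001) / 96)))
      = c1 * real n ^ L * (E * exp (h * 66 / 25 * m)) + 2 ^ 23 * (E * exp (0 * m))
        + 2 ^ 23 * exp (l * 128001 / 96) * (E * exp ((h * 8 / 3 - l * 9 / 960) * m))"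
      unfolding t1 t2 t3 by (simp add: c1_def algebra_simps exp_add[symmetric] exp_diff[symmetric])
    also have "\<dots> \<le> c1 * real n ^ L * (T * exp (- 1 / 10 ^ 5 * m)) + 2 ^ 23 * (T * exp (- 1 / 10 ^ 5 * m))
        + 2 ^ 23 * exp (l * 128001 / 96) * (T * exp (- 1 / 10 ^ 5 * m))"
      using h l by (intro add_mono mult_left_mono decay) (auto simp: c1_def)
    also have "\<dots> = T * ((c1 * real n ^ L + c2) * exp (- 1 / 10 ^ 5 * m))"
      by (simp add: c2_def algebra_simps)
    also have "(c1 * real n ^ L + c2) * exp (- 1 / 10 ^ 5 * m) \<le> exp (1 / 10 ^ 5 * m) * exp (- 1 / 10 ^ 5 * m)"
      using elim by (intro mult_right_mono) (auto simp: m_def)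
    also have "\<dots> = 1" by (simp add: exp_add[symmetric])
    finally have "E * (real (n ^ L * 2 ^ (3 ^ L * 23)) * t powr (198 / 25 * m)
       + 2 ^ 23 * (1 + t ^ (8 * n) * (28 / 25) powr (- (9 / 10 * m - 128001) / 96))) \<le> T"
      by (simp add: T_def)
    moreover have "T = 3 powr ((1 / 3 - 1 / 10 ^ 4) * (8 * m))"
      by (simp add: T_def powr_def h_def algebra_simps)
    ultimately show ?case unfolding E_def m_def by simp
  qed
qed

section \<open>The lower bound and the groups\<close>

text \<open>Groups of all orders must be members of one set, so they need a common carrier type: an
  enumeration of \<open>G\<close> transports its addition, and with it both invariants, to an
  initial segment of \<open>nat\<close>.\<close>

lemma nat_monoid_copy:
  fixes G :: "'g::ab_group_add set"
  assumes G: "finite G" "0 \<in> G" "\<And>x y. x \<in> G \<Longrightarrow> y \<in> G \<Longrightarrow> x + y \<in> G" "\<And>x. x \<in> G \<Longrightarrow> - x \<in> G"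
  shows "\<exists>M :: nat monoid. comm_group M \<and> finite (carrier M) \<and> order M = card G \<and>
    \<mu> M = Max {card S | S. S \<subseteq> G \<and> sumfree S} \<and> f_max M = card {S. maximal_sumfree G S}"
proof -
  let ?N = "{..<card G}"
  obtain g where g: "bij_betw g ?N G" using ex_bij_betw_nat_finite[OF G(1)] by (auto simp: atLeast0LessThan)
  define h where "h = inv_into ?N g"
  have h: "h z \<in> ?N" "g (h z) = z" if "z \<in> G" for z
    using inv_into_into[of z g ?N] f_inv_into_f[of z g ?N] g that unfolding h_def bij_betw_def by auto
  have gG: "g x \<in> G" if "x \<in> ?N" for x using g that by (auto simp: bij_betw_def)
  have hg: "h (g x) = x" if "x \<in> ?N" for x using g that unfolding h_def bij_betw_def by (auto intro: inv_into_f_f)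
  define M :: "nat monoid" where
    "M = \<lparr>carrier = ?N, monoid.mult = (\<lambda>x y. h (g x + g y)), one = h 0\<rparr>"
  have M: "carrier M = ?N" "\<And>x y. x \<otimes>\<^bsub>M\<^esub> y = h (g x + g y)" "\<one>\<^bsub>M\<^esub> = h 0" by (simp_all add: M_def)
  have "comm_group M"
  proof (rule comm_groupI)
    fix x assume x: "x \<in> carrier M"
    then show "\<one>\<^bsub>M\<^esub> \<otimes>\<^bsub>M\<^esub> x = x" using h G hg by (simp add: M)
    show "\<exists>y\<in>carrier M. y \<otimes>\<^bsub>M\<^esub> x = \<one>\<^bsub>M\<^esub>"
      using x h[of "- g x"] gG[of x] G(4)[of "g x"] by (intro bexI[of _ "h (- g x)"]) (auto simp: M)
  qed (use h gG G in \<open>auto simp: M add.assoc\<close>, simp add: add.commute)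
  have img: "(`) g ` Pow ?N = Pow G" using g by (auto simp: bij_betw_def image_Pow_surj)
  have inj: "inj_on ((`) g) (Pow ?N)" using g by (simp add: bij_betw_def inj_on_image_Pow)
  have sf: "sum_free M S \<longleftrightarrow> sumfree (g ` S)" if S: "S \<subseteq> ?N" for S
  proof -
    have eq: "x \<otimes>\<^bsub>M\<^esub> y \<in> S \<longleftrightarrow> g x + g y \<in> g ` S" if "x \<in> S" "y \<in> S" for x y
    proof
      have xy: "g x + g y \<in> G" using that S gG G by blast
      show "g x + g y \<in> g ` S" if "x \<otimes>\<^bsub>M\<^esub> y \<in> S" using that h(2)[OF xy] by (metis M(2) image_eqI)
      show "x \<otimes>\<^bsub>M\<^esub> y \<in> S" if "g x + g y \<in> g ` S" using that S hg unfolding M by auto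
    qed
    show ?thesis using S eq unfolding sum_free_def sumfree_def M(1) by auto
  qed
  have ssub: "S \<subseteq> ?N" if "sum_free M S" for S using that by (simp add: sum_free_def M)
  have cards: "{card S | S. sum_free M S} = {card S | S. S \<subseteq> G \<and> sumfree S}"
  proof (intro equalityI subsetI)
    fix c assume "c \<in> {card S | S. sum_free M S}"
    then obtain S where S: "sum_free M S" "c = card S" by blast
    then have "card (g ` S) = c" "g ` S \<subseteq> G"
      using ssub[OF S(1)] g by (auto simp: bij_betw_def card_image inj_on_subset)
    then show "c \<in> {card S | S. S \<subseteq> G \<and> sumfree S}" using S sf ssub by blast
  next
    fix c assume "c \<in> {card S | S. S \<subseteq> G \<and> sumfree S}"
    then obtain T where T: "T \<subseteq> G" "sumfree T" "c = card T" by blast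
    then obtain S where S: "S \<subseteq> ?N" "T = g ` S" using img by (metis PowD PowI imageE)
    then have "card S = c" using g T by (metis bij_betw_def card_image inj_on_subset)
    then show "c \<in> {card S | S. sum_free M S}" using S T sf by blast
  qed
  have msf: "maximal_sum_free M S \<longleftrightarrow> maximal_sumfree G (g ` S)" if S: "S \<subseteq> ?N" for S
  proof
    assume L: "maximal_sum_free M S"
    show "maximal_sumfree G (g ` S)"
      unfolding maximal_sumfree_def
    proof (intro conjI allI impI)
      show "g ` S \<subseteq> G" using S gG by blast
      show "sumfree (g ` S)" using L sf[OF S] by (simp add: maximal_sum_free_def)
      fix T assume T: "T \<subseteq> G" "sumfree T \<and> g ` S \<subseteq> T"
      obtain U where U: "U \<subseteq> ?N" "T = g ` U" using img T by (metis PowD PowI imageE)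
      have "S \<subseteq> U"
      proof
        fix x assume x: "x \<in> S"
        then obtain u where "u \<in> U" "g x = g u" using T(2) U(2) by blast
        moreover have "inj_on g ?N" using g by (simp add: bij_betw_def)
        ultimately show "x \<in> U" using x S U(1) by (metis inj_onD subsetD)
      qed
      then show "T = g ` S" using L T U sf unfolding maximal_sum_free_def by blast
    qed
  next
    assume R: "maximal_sumfree G (g ` S)"
    show "maximal_sum_free M S"
      unfolding maximal_sum_free_def
    proof (intro conjI allI impI)
      show "sum_free M S" using R sf[OF S] by (simp add: maximal_sumfree_def)
      fix U assume U: "sum_free M U \<and> S \<subseteq> U"
      then have UN: "U \<subseteq> ?N" using ssub by blast
      then have "g ` U \<subseteq> G" using gG by blast
      then have "g ` U = g ` S" using R U sf[OF UN] unfolding maximal_sumfree_def by blast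
      then show "U = S" using UN S inj by (meson PowI inj_onD)
    qed
  qed
  have "{T. maximal_sumfree G T} = (`) g ` {S. maximal_sum_free M S}"
  proof (intro equalityI subsetI)
    fix T assume "T \<in> {T. maximal_sumfree G T}"
    moreover from this obtain S where "S \<subseteq> ?N" "T = g ` S"
      using img by (metis PowD PowI imageE maximal_sumfree_def mem_Collect_eq)
    ultimately show "T \<in> (`) g ` {S. maximal_sum_free M S}" using msf by blast
  next
    fix T assume "T \<in> (`) g ` {S. maximal_sum_free M S}"
    then show "T \<in> {T. maximal_sumfree G T}" using msf ssub unfolding maximal_sum_free_def by blast
  qed
  moreover have "inj_on ((`) g) {S. maximal_sum_free M S}"
    by (rule inj_on_subset[OF inj]) (use ssub in \<open>auto simp: maximal_sum_free_def\<close>)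
  ultimately have "f_max M = card {T. maximal_sumfree G T}" by (simp add: f_max_def card_image)
  moreover have "order M = card G" by (simp add: order_def M)
  ultimately show ?thesis using \<open>comm_group M\<close> cards
    by (intro exI[of _ M]) (simp add: M max_sum_free_size_def)
qed


section \<open>Elementary abelian 3-groups and their characters\<close>

lemma three_cases: "x = 0 \<or> x = 1 \<or> x = (2 :: 3)"
proof -
  obtain n where "n < 3" "x = of_nat n * 1"
    using of_nat_mult_surj_prime_card[of "1 :: 3" x] by auto
  then have "n = 0 \<or> n = 1 \<or> n = 2" "x = of_nat n" by auto
  then show ?thesis by auto
qed

lemma triple_3: "x + x + x = (0 :: 3)"
  using three_cases[of x] by auto

text \<open>\<open>LEAST\<close> picks a natural representative of \<open>x\<close> modulo 3; since
  the base is a cube root of unity, any other gives the same value.\<close>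

definition root_char :: "3 \<Rightarrow> complex" where
  "root_char x = cis (2 * pi / 3) ^ (LEAST n. x = of_nat n)"

lemma cis_cube: "cis (2 * pi / 3) ^ 3 = 1"
  by (simp add: DeMoivre)

lemma root_char_of_nat: "root_char (of_nat n) = cis (2 * pi / 3) ^ n"
proof -
  let ?k = "LEAST k. of_nat n = (of_nat k :: 3)"
  have red: "cis (2 * pi / 3) ^ k = cis (2 * pi / 3) ^ (k mod 3)" for k
  proof -
    have "cis (2 * pi / 3) ^ (3 * (k div 3) + k mod 3) = cis (2 * pi / 3) ^ (k mod 3)"
      by (simp only: power_add power_mult cis_cube) simp
    then show ?thesis by simp
  qed
  have "of_nat n = (of_nat ?k :: 3)" by (rule LeastI) simp
  then have "n mod 3 = ?k mod 3"
    using of_nat_mult_eq_iff_cong[of "1 :: 3" n ?k] by simp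
  then show ?thesis unfolding root_char_def using red[of n] red[of ?k] by simp
qed

lemma three_of_nat: "\<exists>n<3. x = (of_nat n :: 3)"
  using of_nat_mult_surj_prime_card[of "1 :: 3" x] by simp

lemma root_char_add: "root_char (x + y) = root_char x * root_char y"
proof -
  obtain a b where "x = of_nat a" "y = of_nat b" using three_of_nat by metis
  then show ?thesis using root_char_of_nat[of "a + b"] by (simp add: root_char_of_nat power_add)
qed

lemma root_char_cube: "root_char x ^ 3 = 1"
  by (simp add: root_char_def power_mult[symmetric] mult.commute[of _ 3]) (simp add: power_mult cis_cube)

lemma root_char_eq_1D:
  assumes "root_char x = 1"
  shows "x = 0"
proof -
  obtain n where n: "n < 3" "x = of_nat n" using three_of_nat by blast
  let ?w = "cis (2 * pi / 3)"
  have w: "?w \<noteq> 1" using cos_120 by (auto simp: complex_eq_iff)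
  have "?w ^ n = 1" using assms n by (simp add: root_char_of_nat)
  moreover have "?w ^ 2 \<noteq> 1"
  proof
    assume "?w ^ 2 = 1"
    then have "?w ^ 3 = ?w" by (simp add: power3_eq_cube power2_eq_square)
    then show False using w cis_cube by simp
  qed
  ultimately have "n \<noteq> 1" "n \<noteq> 2" using w by auto
  then show ?thesis using n by (auto simp: less_Suc_eq numeral_eq_Suc)
qed

text \<open>Finitely supported functions instead of tuples: all dimensions live in one type with
  pointwise addition.\<close>

definition cube :: "nat \<Rightarrow> (nat \<Rightarrow> 3) set" where
  "cube m = {f. \<forall>i\<ge>m. f i = 0}"

lemma bij_betw_cube: "bij_betw (\<lambda>f. restrict f {..<m}) (cube m) ({..<m} \<rightarrow>\<^sub>E UNIV)"
proof (rule bij_betw_byWitness[where f' = "\<lambda>f i. if i < m then f i else 0"])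
  show "\<forall>f\<in>cube m. (\<lambda>i. if i < m then restrict f {..<m} i else 0) = f"
    by (simp add: cube_def fun_eq_iff)
  show "\<forall>f\<in>{..<m} \<rightarrow>\<^sub>E (UNIV :: 3 set). restrict (\<lambda>i. if i < m then f i else 0) {..<m} = f"
  proof
    fix f :: "nat \<Rightarrow> 3" assume f: "f \<in> {..<m} \<rightarrow>\<^sub>E UNIV"
    have "f i = undefined" if "\<not> i < m" for i by (rule PiE_arb[OF f]) (simp add: that)
    then show "restrict (\<lambda>i. if i < m then f i else 0) {..<m} = f" by (simp add: fun_eq_iff)
  qed
  show "(\<lambda>f. restrict f {..<m}) ` cube m \<subseteq> {..<m} \<rightarrow>\<^sub>E UNIV" by (rule image_subsetI) (simp add: PiE_iff)
  show "(\<lambda>f i. if i < m then f i else 0) ` ({..<m} \<rightarrow>\<^sub>E (UNIV :: 3 set)) \<subseteq> cube m"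
    by (rule image_subsetI) (simp add: cube_def)
qed

lemma card_cube: "card (cube m) = 3 ^ m"
  using bij_betw_same_card[OF bij_betw_cube[of m]] by (simp add: card_PiE)

lemma finite_cube [simp]: "finite (cube m)"
  using bij_betw_finite[OF bij_betw_cube[of m]] by (simp add: finite_PiE)

lemma exp3_group_cube: "exp3_group (cube m)"
proof (rule exp3_group.intro)
  fix f assume f: "f \<in> cube m" "f \<noteq> 0"
  then obtain i where i: "f i \<noteq> 0" by (auto simp: fun_eq_iff)
  let ?\<chi> = "\<lambda>g. if g \<in> cube m then root_char (g i) else 1"
  have \<chi>: "?\<chi> \<in> chars (cube m)"
    by (auto simp: chars_def cube_def root_char_add root_char_cube)
  have "?\<chi> f \<noteq> 1" using f i root_char_eq_1D by auto
  then show "\<exists>\<chi>\<in>chars (cube m). \<chi> f \<noteq> 1" by (rule bexI[of _ ?\<chi>]) (rule \<chi>)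
next
  show "x + x + x = 0" if "x \<in> cube m" for x
    by (rule ext) (simp only: plus_fun_apply zero_fun_apply triple_3)
qed (simp, simp_all add: cube_def)

lemma ex_maximal_sumfree:
  assumes "finite G" "S \<subseteq> G" "sumfree S"
  shows "\<exists>T. maximal_sumfree G T \<and> S \<subseteq> T"
proof -
  let ?F = "{T. T \<subseteq> G \<and> sumfree T \<and> S \<subseteq> T}"
  have fin: "finite ?F" by (rule finite_subset[of _ "Pow G"]) (use assms(1) in auto)
  have "S \<in> ?F" using assms by blast
  from finite_has_maximal2[OF fin this] obtain T
    where T: "T \<in> ?F" "\<forall>U\<in>?F. T \<subseteq> U \<longrightarrow> T = U"
    by (elim bexE conjE)
  have "maximal_sumfree G T"
    unfolding maximal_sumfree_def
  proof (intro conjI allI impI)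
    fix U assume U: "U \<subseteq> G" "sumfree U \<and> T \<subseteq> U"
    then have "U \<in> ?F" using T(1) by auto
    then show "U = T" using T(2) U by auto
  qed (use T(1) in auto)
  then show ?thesis using T(1) by blast
qed

text \<open>With \<open>x = (e, 0)\<close> of order three, the coset \<open>v 0 = 1\<close> splits into translates of the subgroup
  generated by \<open>x\<close>. Together with \<open>x\<close>, every choice of one point from each translate is
  sum-free, and different choices lie in different maximal sum-free sets.\<close>

lemma card_maximal_sumfree_lower:
  assumes m: "2 \<le> m"
  shows "3 ^ card {(v, j) \<in> cube m \<times> (UNIV :: 'b::{finite,ab_group_add} set). v 0 = 1 \<and> v 1 = 0}
    \<le> card {S. maximal_sumfree (cube m \<times> (UNIV :: 'b set)) S}"
proof -
  let ?G = "cube m \<times> (UNIV :: 'b set)"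
  let ?T = "{(v, j) \<in> ?G. v 0 = 1 \<and> v 1 = (0 :: 3)}"
  define e :: "nat \<Rightarrow> 3" where "e = (\<lambda>i. if i = 1 then 1 else 0)"
  \<comment> \<open>\<open>\<phi>\<close> is evaluated at the representative
    \<open>v(1 := 0)\<close> of a translate and prescribes coordinate 1 of the chosen point.\<close>
  define I where "I \<phi> = {(v, j) \<in> ?G. v 0 = 1 \<and> v 1 = \<phi> (v(1 := 0), j)}" for \<phi> :: "(nat \<Rightarrow> 3) \<times> 'b \<Rightarrow> 3"
  let ?x = "(e, 0) :: (nat \<Rightarrow> 3) \<times> 'b"
  have finG: "finite ?G" by simp
  have eG: "?x \<in> ?G" using m by (auto simp: e_def cube_def)
  have upd: "(v + e)(1 := 0) = v(1 := 0)" for v by (auto simp: e_def fun_eq_iff)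
  have two: "(2 :: 3) \<noteq> 1" "(2 :: 3) \<noteq> 0" "(1 :: 3) \<noteq> 0" "(1 :: 3) + 1 = 2" by simp_all
  have sf: "sumfree (insert ?x (I \<phi>))" for \<phi>
    unfolding sumfree_def
  proof (intro ballI notI)
    fix p q assume pq: "p \<in> insert ?x (I \<phi>)" "q \<in> insert ?x (I \<phi>)" "p + q \<in> insert ?x (I \<phi>)"
    \<comment> \<open>Coordinate 0 is 0 at \<open>?x\<close> and 1 on \<open>I \<phi>\<close>. A sum
      of two chosen points therefore has coordinate 2 and lies outside the set; the remaining cases
      involve a shift by \<open>?x\<close>, which \<open>xI\<close> excludes.\<close>
    have c0: "fst p 0 = (if p = ?x then 0 else 1)" if "p \<in> insert ?x (I \<phi>)" for p
      using that by (auto simp: I_def e_def)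
    have c0': "fst (p + q) 0 = fst p 0 + fst q 0" by simp
    have xI: "False" if "a \<in> I \<phi>" "a + ?x \<in> I \<phi>" for a
      using that by (auto simp: I_def upd[unfolded One_nat_def]) (simp add: e_def)
    consider "p = ?x" "q = ?x" | "p = ?x" "q \<in> I \<phi>" | "p \<in> I \<phi>" "q = ?x" | "p \<in> I \<phi>" "q \<in> I \<phi>" "p \<noteq> ?x" "q \<noteq> ?x"
      using pq by blast
    then show False
    proof cases
      case 1
      then have "p + q = ?x" using c0[OF pq(3)] c0' c0[OF pq(1)] by (auto split: if_splits)
      then have "e 1 + e 1 = e 1" using 1 by (metis fst_add fst_conv plus_fun_apply)
      then show False by (simp add: e_def)
    next
      case 2
      then have "q \<noteq> ?x" by (auto simp: I_def e_def)
      then have "p + q \<in> I \<phi>" using c0[OF pq(3)] c0' c0[OF pq(1)] c0[OF pq(2)] 2 pq(3) by (auto split: if_splits)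
      then show False using xI[of q] 2 by (simp add: add.commute)
    next
      case 3
      then have "p \<noteq> ?x" by (auto simp: I_def e_def)
      then have "p + q \<in> I \<phi>" using c0[OF pq(3)] c0' c0[OF pq(1)] c0[OF pq(2)] 3 pq(3) by (auto split: if_splits)
      then show False using xI[of p] 3 by simp
    next
      case 4
      then have "fst (p + q) 0 = 2" using c0[OF pq(1)] c0[OF pq(2)] c0' by simp
      then show False using c0[OF pq(3)] by (auto split: if_splits)
    qed
  qed
  have "\<exists>T. maximal_sumfree ?G T \<and> insert ?x (I \<phi>) \<subseteq> T" for \<phi>
    using eG by (intro ex_maximal_sumfree finG sf) (auto simp: I_def)
  then obtain M where M: "maximal_sumfree ?G (M \<phi>)" "insert ?x (I \<phi>) \<subseteq> M \<phi>" for \<phi> by metis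
  \<comment> \<open>On the coset where coordinate 0 is 1, \<open>M \<phi>\<close> contains nothing
    but \<open>I \<phi>\<close>: any other point of a translate differs from the chosen one by
    \<open>?x\<close> or its negative, which gives a Schur triple. So \<open>M \<phi>\<close>
    determines \<open>\<phi>\<close>.\<close>
  have rec: "v 1 = \<phi> (v(1 := 0), j)" if vj: "(v, j) \<in> M \<phi>" "v 0 = 1" for v j \<phi>
  proof (rule ccontr)
    assume ne: "v 1 \<noteq> \<phi> (v(1 := 0), j)"
    let ?c = "\<phi> (v(1 := 0), j)"
    have vG: "v \<in> cube m" using vj M(1)[of \<phi>] by (auto simp: maximal_sumfree_def)
    let ?a = "(v(1 := ?c), j)"
    have aI: "?a \<in> I \<phi>" using vG vj m by (auto simp: I_def cube_def)
    then have aM: "?a \<in> M \<phi>" "?x \<in> M \<phi>" using M(2) by blast+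
    have sfM: "sumfree (M \<phi>)" using M(1) by (simp add: maximal_sumfree_def)
    have "?c = v 1 + 1 \<or> v 1 = ?c + 1"
      using three_cases[of "v 1"] three_cases[of ?c] ne by auto
    then show False
    proof
      assume "?c = v 1 + 1"
      then have "(v, j) + ?x = ?a" by (auto simp: fun_eq_iff e_def)
      then show False using sumfreeD[OF sfM vj(1) aM(2)] aM(1) by simp
    next
      assume "v 1 = ?c + 1"
      then have "?a + ?x = (v, j)" by (auto simp: fun_eq_iff e_def)
      then show False using sumfreeD[OF sfM aM] vj(1) by simp
    qed
  qed
  have "inj_on M (?T \<rightarrow>\<^sub>E UNIV)"
  proof (rule inj_onI)
    fix \<phi> \<psi> assume F: "\<phi> \<in> ?T \<rightarrow>\<^sub>E UNIV" "\<psi> \<in> ?T \<rightarrow>\<^sub>E UNIV" and eq: "M \<phi> = M \<psi>"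
    show "\<phi> = \<psi>"
    proof (rule PiE_ext[OF F])
      fix p assume p: "p \<in> ?T"
      obtain v j where vj: "p = (v, j)" by (cases p)
      let ?v = "v(1 := \<phi> p)"
      have v0: "?v(1 := 0) = v" "?v 0 = 1" using p vj by (auto simp: fun_eq_iff)
      then have "(?v, j) \<in> I \<phi>" using p vj m by (auto simp: I_def cube_def)
      then have "(?v, j) \<in> M \<psi>" using M(2)[of \<phi>] eq by blast
      then have "?v 1 = \<psi> (?v(1 := 0), j)" using rec v0(2) by blast
      then show "\<phi> p = \<psi> p" using v0 vj by simp
    qed
  qed
  then have "card (?T \<rightarrow>\<^sub>E (UNIV :: 3 set)) \<le> card {S. maximal_sumfree ?G S}"
  proof (rule card_inj_on_le)
    show "finite {S. maximal_sumfree ?G S}"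
      by (rule finite_subset[of _ "Pow ?G"]) (auto simp: maximal_sumfree_def)
  qed (use M(1) in auto)
  moreover have "finite ?T" by (rule finite_subset[OF _ finG]) auto
  then have "card (?T \<rightarrow>\<^sub>E (UNIV :: 3 set)) = 3 ^ card ?T" by (simp add: card_PiE)
  ultimately show ?thesis by simp
qed

lemma card_cube_slice:
  assumes m: "2 \<le> m"
  shows "3 ^ m * CARD('b::finite) \<le> 9 * card {(v, j) \<in> cube m \<times> (UNIV :: 'b set). v 0 = 1 \<and> v 1 = 0}" (is "_ \<le> 9 * card ?T")
proof -
  have fin: "finite ?T" by (rule finite_subset[of _ "cube m \<times> UNIV"]) auto
  have "card (cube m \<times> (UNIV :: 'b set)) \<le> card (?T \<times> (UNIV :: (3 \<times> 3) set))"
  proof (rule card_inj_on_le[where f = "\<lambda>(v, j). ((v(0 := 1, 1 := 0), j), (v 0, v 1))"])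
    show "inj_on (\<lambda>(v, j). ((v(0 := 1, 1 := 0), j), (v 0, v 1))) (cube m \<times> (UNIV :: 'b set))"
    proof (rule inj_onI)
      fix p q :: "(nat \<Rightarrow> 3) \<times> 'b"
      assume "(\<lambda>(v, j). ((v(0 := 1, 1 := 0), j), (v 0, v 1))) p = (\<lambda>(v, j). ((v(0 := 1, 1 := 0), j), (v 0, v 1))) q"
      then have eq: "(fst p)(0 := 1, 1 := 0) = (fst q)(0 := 1, 1 := 0)" "snd p = snd q"
          "fst p 0 = fst q 0" "fst p 1 = fst q 1"
        by (auto simp: case_prod_beta)
      have "fst p i = fst q i" for i using fun_cong[OF eq(1), of i] eq(3,4) by (auto split: if_splits)
      then show "p = q" using eq(2) by (intro prod_eqI ext)
    qed
  qed (use m fin in \<open>auto simp: cube_def\<close>)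
  then show ?thesis using fin by (simp add: card_cartesian_product card_cube)
qed


section \<open>Numerical comparison and the family of groups\<close>

lemma two_powr_le_three_powr:
  fixes x :: real
  assumes "0 \<le> x"
  shows "2 powr ((1 / 2 + 1 / 10 ^ 4) * (8 * x)) \<le> 3 powr (23 / 9 * x)"
proof -
  \<comment> \<open>Over the denominator 36 the exponents 4.0008 and 23/9 become at most 145 and
    exactly 92, which reduces the claim to 2^145 <= 3^92.\<close>
  have "2 powr ((1 / 2 + 1 / 10 ^ 4) * (8 * x)) \<le> 2 powr (145 * (x / 36))"
    using assms by (intro powr_mono) auto
  also have "\<dots> = (2 ^ 145) powr (x / 36)" by (simp only: powr_powr[symmetric] powr_numeral)
  also have "\<dots> \<le> (3 ^ 92) powr (x / 36)" using assms by (intro powr_mono2) auto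
  also have "\<dots> = 3 powr (92 * (x / 36))" by (simp only: powr_powr[symmetric] powr_numeral)
  also have "92 * (x / 36) = 23 / 9 * x" by simp
  finally show ?thesis .
qed

theorem theorem1p4:
  fixes c :: real
  assumes "c = 1 / 10 ^ 4"
  shows "\<exists>\<G> :: nat monoid set.
           infinite \<G> \<and> pairwise (\<lambda>G H. \<not> G \<cong> H) \<G> \<and>
           (\<forall>G\<in>\<G>. comm_group G \<and> finite (carrier G) \<and> type_I G \<and>
              2 powr ((1 / 2 + c) * real (\<mu> G)) \<le> real (f_max G) \<and>
              real (f_max G) \<le> 3 powr ((1 / 3 - c) * real (\<mu> G)))"
proof -
  let ?G = "\<lambda>m. cube m \<times> (UNIV :: 23 set)"
  have c23: "CARD(23) = 23" by simp
  have p23: "prime CARD(23)" using prime_23 by simp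
  have cG: "card (?G m) = 23 * 3 ^ m" for m by (simp add: card_cartesian_product card_cube)
  have "\<exists>M :: nat monoid. comm_group M \<and> finite (carrier M) \<and> order M = card (?G m) \<and>
      \<mu> M = Max {card S | S. S \<subseteq> ?G m \<and> sumfree S} \<and> f_max M = card {S. maximal_sumfree (?G m) S}" for m
  proof (rule nat_monoid_copy)
    show "finite (?G m)" by simp
  qed (auto simp: cube_def zero_prod_def)
  then obtain M :: "nat \<Rightarrow> nat monoid" where M: "comm_group (M m)" "finite (carrier (M m))" "order (M m) = card (?G m)"
      "\<mu> (M m) = Max {card S | S. S \<subseteq> ?G m \<and> sumfree S}" "f_max (M m) = card {S. maximal_sumfree (?G m) S}" for m
    by metis
  have mu: "\<mu> (M m) = 8 * 3 ^ m" for m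
  proof -
    interpret exp3_group "cube m" by (rule exp3_group_cube)
    have I: "card (prog (1 :: 23) 8 8) = 8" "sumset (prog (1 :: 23) 8 8) (prog 1 8 8) = - prog 1 8 8"
      using prog_8_8[of "1 :: 23"] by simp_all
    have "sumfree (cube m \<times> prog (1 :: 23) 8 8)" using I(2) by (auto simp: sumfree_def sumset_def)
    moreover have "card (cube m \<times> prog (1 :: 23) 8 8) = 8 * 3 ^ m"
      using I(1) by (simp add: card_cartesian_product card_cube)
    ultimately have "8 * 3 ^ m \<in> {card S | S. S \<subseteq> ?G m \<and> sumfree S}"
      by (intro CollectI exI[of _ "cube m \<times> prog (1 :: 23) 8 8"]) auto
    moreover have "k \<le> 8 * 3 ^ m" if "k \<in> {card S | S. S \<subseteq> ?G m \<and> sumfree S}" for k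
      using that card_sumfree_le[OF c23] by (auto simp: card_cube)
    moreover from this have "finite {card S | S. S \<subseteq> ?G m \<and> sumfree S}"
      by (meson finite_nat_set_iff_bounded_le)
    ultimately show ?thesis unfolding M(4) by (intro Max_eqI)
  qed
  have lower: "2 powr ((1 / 2 + c) * real (\<mu> (M m))) \<le> real (f_max (M m))" if m: "2 \<le> m" for m
  proof -
    let ?T = "{(v, j) \<in> cube m \<times> (UNIV :: 23 set). v 0 = 1 \<and> v 1 = 0}"
    have "2 powr ((1 / 2 + c) * real (\<mu> (M m))) \<le> 3 powr (23 / 9 * 3 ^ m)"
      using two_powr_le_three_powr[of "3 ^ m"] by (simp add: mu assms)
    also have "\<dots> \<le> 3 powr (card ?T)"
    proof (rule powr_mono)
      have "real (3 ^ m * CARD(23)) \<le> real (9 * card ?T)" by (intro of_nat_mono card_cube_slice m)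
      then show "23 / 9 * 3 ^ m \<le> real (card ?T)" by simp
    qed simp
    also have "\<dots> = real (3 ^ card ?T)" by (simp add: powr_realpow)
    also have "\<dots> \<le> real (f_max (M m))"
      unfolding M(5) by (intro of_nat_mono card_maximal_sumfree_lower m)
    finally show ?thesis .
  qed
  \<comment> \<open>With \<epsilon> = y = 10^(-6) the parameters d, N and L do not depend on m, so
    the number of containers is bounded by a polynomial of fixed degree in the order of V.\<close>
  define t d :: real where "t = 3 powr (1 / 3)" and "d = (1 / 10 ^ 6) / (2 * CARD(23))"
  have t: "t ^ 3 = 3" "0 < t" by (simp_all add: t_def powr_realpow[symmetric] powr_powr)
  obtain N :: nat where N: "real CARD(23) < N * ((d\<^sup>2 / 2)\<^sup>2 * ((1 / 10 ^ 6) / 2))"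
    using ex_less_of_nat_mult[of "(d\<^sup>2 / 2)\<^sup>2 * ((1 / 10 ^ 6) / 2)" "real CARD(23)"] by (auto simp: d_def)
  define L where "L = char_bound CARD(23) N"
  obtain n1 where n1: "\<And>n. n1 \<le> n \<Longrightarrow> exp (1 / 10 ^ 6 * (23 * real n)) * (1 / (1 / 10 ^ 6)) powr (1 / 10 ^ 6 * real n) *
      (real (n ^ L * 2 ^ (3 ^ L * 23)) * t powr (198 / 25 * real n)
       + 2 ^ 23 * (1 + t ^ (8 * n) * (28 / 25) powr (- (9 / 10 * real n - 128001) / 96)))
     \<le> 3 powr ((1 / 3 - 1 / 10 ^ 4) * (8 * real n))"
    using upper_asymptotics[OF t_def, of L] unfolding eventually_sequentially by blast
  have upper: "real (f_max (M m)) \<le> 3 powr ((1 / 3 - c) * real (\<mu> (M m)))" if m: "n1 \<le> m" for m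
  proof -
    interpret exp3_group "cube m" by (rule exp3_group_cube)
    have "m \<le> 3 ^ m" by (simp add: less_imp_le)
    then have "n1 \<le> card (cube m)" using m unfolding card_cube by linarith
    from n1[OF this] have "real (f_max (M m)) \<le> 3 powr ((1 / 3 - 1 / 10 ^ 4) * (8 * real (card (cube m))))"
      unfolding M(5)
      by (intro order_trans[OF card_maximal_sumfree_upper[where y = "1 / 10 ^ 6", OF c23 t _ d_def N L_def]]) auto
    then show ?thesis by (simp add: mu assms card_cube)
  qed
  have ord: "card (carrier (M m)) = 23 * 3 ^ m" for m using M(3)[of m] cG[of m] by (simp add: order_def)
  have inj: "inj M"
  proof (rule injI)
    fix m k assume "M m = M k"
    then have "23 * 3 ^ m = (23 * 3 ^ k :: nat)" by (metis ord)
    then show "m = k" by simp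
  qed
  let ?F = "M ` {max 2 n1..}"
  have "infinite ?F"
    using infinite_Ici[of "max 2 n1"] finite_imageD[of M "{max 2 n1..}"] inj_on_subset[OF inj subset_UNIV] by blast
  moreover have "pairwise (\<lambda>G H. \<not> G \<cong> H) ?F"
  proof (rule pairwiseI)
    fix G H assume "G \<in> ?F" "H \<in> ?F" "G \<noteq> H"
    then obtain m k where mk: "G = M m" "H = M k" "m \<noteq> k" by auto
    show "\<not> G \<cong> H"
    proof
      assume "G \<cong> H"
      then have "card (carrier G) = card (carrier H)"
        by (auto simp: is_iso_def iso_def dest: bij_betw_same_card)
      then show False using mk by (simp add: ord)
    qed
  qed
  moreover have "type_I (M m)" for m
    unfolding type_I_def using prime_23 M(3)[of m] cG[of m] by (intro exI[of _ 23]) (simp add: cong_def)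
  ultimately show ?thesis using M(1,2) lower upper by (intro exI[of _ ?F]) auto
qed

end
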